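(* Let $p$ be an odd prime, $X=R_p$ the dihedral quandle, and write $H^n(M)=H^n(X;X;\mathbf F_p)$. There exist classes $A_m\in H^{2m}(M)$ ($m\ge 0$, with $A_0=\mathbf 1$) and $B\in H^3(M)$ such that (i) the elements $A_{m_1}\cup B^{e_1}\cup P(A_{m_2}\cup B^{e_2}\cup P(\cdots P(A_{m_s}\cup B^{e_s})\cdots))$, indexed by all finite sequences $((m_1,e_1),\dots,(m_s,e_s))$ with $s\ge1$, $m_i\ge 0$, $e_i\in\{0,1\}$, form a basis of $\bigoplus_nH^n(M)$ over $\mathbf F_p$; and (ii) the $A_m$ form a system of divided powers: $A_k\cup A_m=\binom{k+m}{k}A_{k+m}$ for all $k,m\ge 0$.
   Context: $R_p$ is the set $\mathbf Z/p$ with operation $a*b=2b-a$. For a rack $X$ (acting on itself by $*$), $C_n(X;X)$ is the free abelian group on symbols $(y;x_1,\dots,x_n)$ with $y,x_i\in X$, and $\partial=\sum_{i=1}^n(-1)^i(\delta^0_i-\delta^1_i)$, where $\delta^0_i(y;x_1,\dots,x_n)=(y;x_1,\dots,x_{i-1},x_{i+1},\dots,x_n)$ and $\delta^1_i(y;x_1,\dots,x_n)=(y*x_i;x_1*x_i,\dots,x_{i-1}*x_i,x_{i+1},\dots,x_n)$. $H^n(X;X;\mathbf F_p)$ is the cohomology of the complex $C^n(X;X;\mathbf F_p)=\mathrm{Hom}(C_n(X;X),\mathbf F_p)$. Cup product: for $f\in C^k$, $g\in C^m$, $n=k+m$, and $z=(y;x_1,\dots,x_n)$, $(f\cup g)(z)=(-1)^{km}\sum_A\epsilon(A)f(\delta^0_Az)g(\delta^1_Bz)$,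 the sum running over subsets $A=\{a_1<\dots<a_m\}$ of $\{1,\dots,n\}$ with complement $B=\{b_1<\dots<b_k\}$; $\epsilon(A)$ is the sign of the permutation sending $(1,\dots,n)$ to $(b_1,\dots,b_k,a_1,\dots,a_m)$, $\delta^0_A=\delta^0_{a_1}\circ\dots\circ\delta^0_{a_m}$, and $\delta^1_B=\delta^1_{b_1}\circ\dots\circ\delta^1_{b_k}$. This makes $\bigoplus_nH^n(X;X;\mathbf F_p)$ a graded ring with unit $\mathbf 1$, the class of the $0$-cochain with constant value $1$; $B^0=\mathbf 1$, $B^1=B$. The operator $P\colon H^k(X;X;\mathbf F_p)\to H^{k+1}(X;X;\mathbf F_p)$ is induced by the cochain operator $(PF)(x_0;x_1,\dots,x_{k+1})=(-1)^kF(x_1;x_2,\dots,x_{k+1})$. *)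

theory Defs
  imports
    "Jordan_Normal_Form.VS_Connect"
    "Berlekamp_Zassenhaus.Finite_Field"
    "HOL-Library.Poly_Mapping"
    "HOL-Combinatorics.Permutations"
begin

text \<open>
  The rack is the whole type \<open>'x\<close> with operation \<open>s\<close>. The symbol \<open>(y; x\<^sub>1, \<dots>, x\<^sub>n)\<close> is the pair
  \<open>(y, [x\<^sub>1, \<dots>, x\<^sub>n])\<close>, and positions are counted from 1.
\<close>

type_synonym 'x rack_symbol = "'x \<times> 'x list"

definition dihedral :: "'a::comm_ring_1 \<Rightarrow> 'a \<Rightarrow> 'a" where
  "dihedral a b = 2 * b - a"

definition face0 :: "nat \<Rightarrow> 'x rack_symbol \<Rightarrow> 'x rack_symbol" where
  "face0 i z = (fst z, take (i - 1) (snd z) @ drop i (snd z))"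

definition face1 :: "('x \<Rightarrow> 'x \<Rightarrow> 'x) \<Rightarrow> nat \<Rightarrow> 'x rack_symbol \<Rightarrow> 'x rack_symbol" where
  "face1 s i z =
     (let x = snd z ! (i - 1)
      in (s (fst z) x, map (\<lambda>a. s a x) (take (i - 1) (snd z)) @ drop i (snd z)))"

text \<open>The boundary of a generator, in the free abelian group on all symbols.\<close>

definition rack_boundary ::
    "('x \<Rightarrow> 'x \<Rightarrow> 'x) \<Rightarrow> 'x rack_symbol \<Rightarrow> ('x rack_symbol \<Rightarrow>\<^sub>0 int)" where
  "rack_boundary s z =
     (\<Sum>i = 1..length (snd z). frag_cmul ((-1) ^ i) (frag_of (face0 i z) - frag_of (face1 s i z)))"

text \<open>
  A homomorphism \<open>C\<^sub>n \<rightarrow> 'k\<close> is given by its values on the symbols of length \<open>n\<close>; it is extended by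
  zero to symbols of other lengths. \<open>eval_cochain\<close> recovers the homomorphism.
\<close>

type_synonym ('x, 'k) rack_cochain = "'x rack_symbol \<Rightarrow> 'k"

definition cochains :: "nat \<Rightarrow> ('x, 'k::comm_ring_1) rack_cochain set" where
  "cochains n = {f. \<forall>z. length (snd z) \<noteq> n \<longrightarrow> f z = 0}"

definition eval_cochain ::
    "('x, 'k::comm_ring_1) rack_cochain \<Rightarrow> ('x rack_symbol \<Rightarrow>\<^sub>0 int) \<Rightarrow> 'k" where
  "eval_cochain f c = (\<Sum>z\<in>Poly_Mapping.keys c. of_int (Poly_Mapping.lookup c z) * f z)"

definition coboundary ::
    "('x \<Rightarrow> 'x \<Rightarrow> 'x) \<Rightarrow> ('x, 'k::comm_ring_1) rack_cochain \<Rightarrow> ('x, 'k) rack_cochain" where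
  "coboundary s f = (\<lambda>z. eval_cochain f (rack_boundary s z))"

lemma coboundary_eq:
  "coboundary s f z =
     (\<Sum>i = 1..length (snd z). (-1) ^ i * (f (face0 i z) - f (face1 s i z)))"
proof -
  have eval: "eval_cochain f c = (\<Sum>w\<in>S. of_int (Poly_Mapping.lookup c w) * f w)"
    if "finite S" "Poly_Mapping.keys c \<subseteq> S" for c S
    unfolding eval_cochain_def using that
    by (intro sum.mono_neutral_left) (auto simp: in_keys_iff)
  have add: "eval_cochain f (c + d) = eval_cochain f c + eval_cochain f d" for c d
  proof -
    let ?S = "Poly_Mapping.keys c \<union> Poly_Mapping.keys d"
    have "Poly_Mapping.keys (c + d) \<subseteq> ?S" by (rule Poly_Mapping.keys_add)
    then show ?thesis
      by (simp add: eval[of ?S] lookup_add distrib_right sum.distrib)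
  qed
  have cmul: "eval_cochain f (frag_cmul k c) = of_int k * eval_cochain f c" for k c
    using eval[of "Poly_Mapping.keys c" "frag_cmul k c"] keys_cmul[of k c]
    by (simp add: eval_cochain_def sum_distrib_left mult.assoc)
  have gen: "eval_cochain f (frag_of w) = f w" for w
    by (simp add: eval_cochain_def)
  have diff: "eval_cochain f (c - d) = eval_cochain f c - eval_cochain f d" for c d
    using add[of "c - d" d] by (simp add: algebra_simps)
  have zero: "eval_cochain f 0 = 0"
    by (simp add: eval_cochain_def)
  have "eval_cochain f (\<Sum>i\<in>I. F i) = (\<Sum>i\<in>I. eval_cochain f (F i))" if "finite I"
    for I :: "nat set" and F
    using that by (induction I rule: finite_induct) (auto simp: add zero)
  then show ?thesis
    by (simp add: coboundary_def rack_boundary_def cmul diff gen)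
qed

definition cocycles :: "('x \<Rightarrow> 'x \<Rightarrow> 'x) \<Rightarrow> nat \<Rightarrow> ('x, 'k::comm_ring_1) rack_cochain set" where
  "cocycles s n = {f \<in> cochains n. coboundary s f = (\<lambda>_. 0)}"

definition coboundaries :: "('x \<Rightarrow> 'x \<Rightarrow> 'x) \<Rightarrow> nat \<Rightarrow> ('x, 'k::comm_ring_1) rack_cochain set" where
  "coboundaries s n = (case n of 0 \<Rightarrow> {\<lambda>_. 0} | Suc k \<Rightarrow> coboundary s ` cochains k)"

definition cohomologous ::
    "('x \<Rightarrow> 'x \<Rightarrow> 'x) \<Rightarrow> nat \<Rightarrow> ('x, 'k::comm_ring_1) rack_cochain rel" where
  "cohomologous s n =
     {(f, g). f \<in> cocycles s n \<and> g \<in> cocycles s n \<and> (\<lambda>z. g z - f z) \<in> coboundaries s n}"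

type_synonym ('x, 'k) coh_class = "('x, 'k) rack_cochain set"

definition cohomology :: "('x \<Rightarrow> 'x \<Rightarrow> 'x) \<Rightarrow> nat \<Rightarrow> ('x, 'k::comm_ring_1) coh_class set" where
  "cohomology s n = cocycles s n // cohomologous s n"

definition rack_class ::
    "('x \<Rightarrow> 'x \<Rightarrow> 'x) \<Rightarrow> nat \<Rightarrow> ('x, 'k::comm_ring_1) rack_cochain \<Rightarrow> ('x, 'k) coh_class" where
  "rack_class s n f = cohomologous s n `` {f}"

text \<open>
  Operations on classes are induced by cochain operations: the union below is taken over all
  representatives, and its members all coincide when the operation descends to cohomology.
\<close>

definition induced ::
    "('x \<Rightarrow> 'x \<Rightarrow> 'x) \<Rightarrow> nat \<Rightarrow> (('x, 'k::comm_ring_1) rack_cochain \<Rightarrow> ('x, 'k) rack_cochain)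
      \<Rightarrow> ('x, 'k) coh_class \<Rightarrow> ('x, 'k) coh_class" where
  "induced s n F U = (\<Union>f\<in>U. rack_class s n (F f))"

definition induced2 ::
    "('x \<Rightarrow> 'x \<Rightarrow> 'x) \<Rightarrow> nat
      \<Rightarrow> (('x, 'k::comm_ring_1) rack_cochain \<Rightarrow> ('x, 'k) rack_cochain \<Rightarrow> ('x, 'k) rack_cochain)
      \<Rightarrow> ('x, 'k) coh_class \<Rightarrow> ('x, 'k) coh_class \<Rightarrow> ('x, 'k) coh_class" where
  "induced2 s n F U V = (\<Union>f\<in>U. \<Union>g\<in>V. rack_class s n (F f g))"

definition coh_zero :: "('x \<Rightarrow> 'x \<Rightarrow> 'x) \<Rightarrow> nat \<Rightarrow> ('x, 'k::comm_ring_1) coh_class" where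
  "coh_zero s n = rack_class s n (\<lambda>_. 0)"

definition coh_add ::
    "('x \<Rightarrow> 'x \<Rightarrow> 'x) \<Rightarrow> nat \<Rightarrow> ('x, 'k::comm_ring_1) coh_class \<Rightarrow> ('x, 'k) coh_class
      \<Rightarrow> ('x, 'k) coh_class" where
  "coh_add s n = induced2 s n (\<lambda>f g z. f z + g z)"

definition coh_scale ::
    "('x \<Rightarrow> 'x \<Rightarrow> 'x) \<Rightarrow> nat \<Rightarrow> 'k::comm_ring_1 \<Rightarrow> ('x, 'k) coh_class \<Rightarrow> ('x, 'k) coh_class" where
  "coh_scale s n c = induced s n (\<lambda>f z. c * f z)"

text \<open>
  The direct sum of all \<open>H\<^sup>n\<close>: finitely supported families of classes. It is used only as a
  module, so the multiplicative part of the record is left unspecified.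
\<close>

definition total_cohomology ::
    "('x \<Rightarrow> 'x \<Rightarrow> 'x) \<Rightarrow> ('k::comm_ring_1, nat \<Rightarrow> ('x, 'k) coh_class) module" where
  "total_cohomology s =
     \<lparr> carrier = {h. (\<forall>n. h n \<in> cohomology s n) \<and> finite {n. h n \<noteq> coh_zero s n}},
       monoid.mult = undefined,
       one = undefined,
       zero = coh_zero s,
       add = (\<lambda>g h n. coh_add s n (g n) (h n)),
       module.smult = (\<lambda>c h n. coh_scale s n c (h n)) \<rparr>"

lemma coboundary_lin:
  "coboundary s (\<lambda>z. a * f z + b * g z) = (\<lambda>z. a * coboundary s f z + b * coboundary s g z)"
  by (rule ext) (simp add: coboundary_eq sum_distrib_left sum.distrib[symmetric] algebra_simps)

lemma coboundary_zero: "coboundary s (\<lambda>_. 0) = (\<lambda>_. 0)"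
  using coboundary_lin[of s 0 "\<lambda>_. 0" 0 "\<lambda>_. 0"] by simp

lemma cocycles_lin:
  assumes "f \<in> cocycles s n" "g \<in> cocycles s n"
  shows "(\<lambda>z. a * f z + b * g z) \<in> cocycles s n"
  using assms by (auto simp: cocycles_def cochains_def coboundary_lin)

lemma cocycles_zero: "(\<lambda>_. 0) \<in> cocycles s n"
  by (auto simp: cocycles_def cochains_def coboundary_zero)

lemma coboundaries_lin:
  assumes "f \<in> coboundaries s n" "g \<in> coboundaries s n"
  shows "(\<lambda>z. a * f z + b * g z) \<in> coboundaries s n"
proof (cases n)
  case 0
  then show ?thesis using assms by (simp add: coboundaries_def)
next
  case (Suc k)
  then obtain f' g' where "f' \<in> cochains k" "g' \<in> cochains k"
    "f = coboundary s f'" "g = coboundary s g'"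
    using assms by (auto simp: coboundaries_def)
  then have "(\<lambda>z. a * f z + b * g z) = coboundary s (\<lambda>z. a * f' z + b * g' z)"
    "(\<lambda>z. a * f' z + b * g' z) \<in> cochains k"
    by (auto simp: coboundary_lin cochains_def)
  then show ?thesis using Suc by (auto simp: coboundaries_def)
qed

lemma coboundaries_zero: "(\<lambda>_. 0) \<in> coboundaries s n"
proof (cases n)
  case (Suc k)
  have "(\<lambda>_. 0) \<in> cochains k" by (simp add: cochains_def)
  from imageI[OF this, of "coboundary s"] show ?thesis
    using Suc by (simp add: coboundary_zero coboundaries_def)
qed (simp add: coboundaries_def)

lemma cohomologous_lin:
  assumes "(f, f') \<in> cohomologous s n" "(g, g') \<in> cohomologous s n"
  shows "(\<lambda>z. a * f z + b * g z, \<lambda>z. a * f' z + b * g' z) \<in> cohomologous s n"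
proof -
  have "(\<lambda>z. a * (f' z - f z) + b * (g' z - g z)) \<in> coboundaries s n"
    using assms by (intro coboundaries_lin) (auto simp: cohomologous_def)
  then have "(\<lambda>z. (a * f' z + b * g' z) - (a * f z + b * g z)) \<in> coboundaries s n"
    by (simp add: algebra_simps)
  then show ?thesis using assms by (auto simp: cohomologous_def intro: cocycles_lin)
qed

lemma equiv_cohomologous: "equiv (cocycles s n) (cohomologous s n)"
proof (rule equivI)
  show "cohomologous s n \<subseteq> cocycles s n \<times> cocycles s n" by (auto simp: cohomologous_def)
  show "refl_on (cocycles s n) (cohomologous s n)"
    by (auto simp: refl_on_def cohomologous_def coboundaries_zero)
  show "sym (cohomologous s n)"
  proof (rule symI)
    fix f g assume "(f, g) \<in> cohomologous s n"
    then show "(g, f) \<in> cohomologous s n"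
      using coboundaries_lin[of "\<lambda>z. g z - f z" s n "\<lambda>_. 0" "-1" 0]
      by (auto simp: cohomologous_def coboundaries_zero)
  qed
  show "trans (cohomologous s n)"
  proof (rule transI)
    fix f g h assume "(f, g) \<in> cohomologous s n" "(g, h) \<in> cohomologous s n"
    then show "(f, h) \<in> cohomologous s n"
      using coboundaries_lin[of "\<lambda>z. g z - f z" s n "\<lambda>z. h z - g z" 1 1]
      by (auto simp: cohomologous_def)
  qed
qed

lemma rack_class_eqI: "(f, g) \<in> cohomologous s n \<Longrightarrow> rack_class s n f = rack_class s n g"
  using equiv_cohomologous equiv_class_eq unfolding rack_class_def by metis

lemma mem_rack_class: "f \<in> cocycles s n \<Longrightarrow> f \<in> rack_class s n f"
  using equiv_cohomologous equiv_class_self unfolding rack_class_def by metis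

lemma rack_class_in: "f \<in> cocycles s n \<Longrightarrow> rack_class s n f \<in> cohomology s n"
  unfolding rack_class_def cohomology_def by (rule quotientI)

lemma cohomologyE:
  assumes "u \<in> cohomology s n"
  obtains f where "f \<in> cocycles s n" "u = rack_class s n f"
  using assms unfolding rack_class_def cohomology_def by (auto elim: quotientE)

lemma coh_add_class:
  assumes "f \<in> cocycles s n" "g \<in> cocycles s n"
  shows "coh_add s n (rack_class s n f) (rack_class s n g) = rack_class s n (\<lambda>z. f z + g z)"
proof -
  have "rack_class s n (\<lambda>z. f' z + g' z) = rack_class s n (\<lambda>z. f z + g z)"
    if "f' \<in> rack_class s n f" "g' \<in> rack_class s n g" for f' g'
    using that cohomologous_lin[of f f' s n g g' 1 1]
    by (intro rack_class_eqI[symmetric]) (auto simp: rack_class_def)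
  then have "coh_add s n (rack_class s n f) (rack_class s n g) =
      (\<Union>f'\<in>rack_class s n f. \<Union>g'\<in>rack_class s n g. rack_class s n (\<lambda>z. f z + g z))"
    unfolding coh_add_def induced2_def by (intro SUP_cong[OF refl])
  then show ?thesis
    using mem_rack_class[OF assms(1)] mem_rack_class[OF assms(2)] by blast
qed

lemma coh_scale_class:
  assumes "f \<in> cocycles s n"
  shows "coh_scale s n c (rack_class s n f) = rack_class s n (\<lambda>z. c * f z)"
proof -
  have "rack_class s n (\<lambda>z. c * f' z) = rack_class s n (\<lambda>z. c * f z)"
    if "f' \<in> rack_class s n f" for f'
    using that cohomologous_lin[of f f' s n f f' c 0]
    by (intro rack_class_eqI[symmetric]) (auto simp: rack_class_def)
  then have "coh_scale s n c (rack_class s n f) =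
      (\<Union>f'\<in>rack_class s n f. rack_class s n (\<lambda>z. c * f z))"
    unfolding coh_scale_def induced_def by (intro SUP_cong[OF refl])
  then show ?thesis
    using mem_rack_class[OF assms] by blast
qed

lemma cocycles_add: "f \<in> cocycles s n \<Longrightarrow> g \<in> cocycles s n \<Longrightarrow> (\<lambda>z. f z + g z) \<in> cocycles s n"
  using cocycles_lin[of f s n g 1 1] by simp

lemma cocycles_scale: "f \<in> cocycles s n \<Longrightarrow> (\<lambda>z. c * f z) \<in> cocycles s n"
  using cocycles_lin[of f s n f c 0] by simp

lemma coh_closed:
  "u \<in> cohomology s n \<Longrightarrow> v \<in> cohomology s n \<Longrightarrow> coh_add s n u v \<in> cohomology s n"
  "u \<in> cohomology s n \<Longrightarrow> coh_scale s n c u \<in> cohomology s n"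
  "coh_zero s n \<in> cohomology s n"
  by (auto elim!: cohomologyE simp: coh_add_class coh_scale_class coh_zero_def
      intro!: rack_class_in cocycles_add cocycles_scale cocycles_zero)

lemma coh_laws:
  assumes "u \<in> cohomology s n" "v \<in> cohomology s n" "w \<in> cohomology s n"
  shows "coh_add s n (coh_add s n u v) w = coh_add s n u (coh_add s n v w)"
    "coh_add s n u v = coh_add s n v u"
    "coh_add s n (coh_zero s n) u = u"
    "coh_add s n (coh_scale s n (-1) u) u = coh_zero s n"
    "coh_scale s n 1 u = u"
    "coh_scale s n 0 u = coh_zero s n"
    "coh_scale s n c (coh_add s n u v) = coh_add s n (coh_scale s n c u) (coh_scale s n c v)"
    "coh_scale s n (c + d) u = coh_add s n (coh_scale s n c u) (coh_scale s n d u)"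
    "coh_scale s n (c * d) u = coh_scale s n c (coh_scale s n d u)"
    "coh_scale s n c (coh_zero s n) = coh_zero s n"
proof -
  obtain f g h where "f \<in> cocycles s n" "u = rack_class s n f" "g \<in> cocycles s n" "v = rack_class s n g"
    "h \<in> cocycles s n" "w = rack_class s n h"
    using assms by (meson cohomologyE)
  then show "coh_add s n (coh_add s n u v) w = coh_add s n u (coh_add s n v w)"
    "coh_add s n u v = coh_add s n v u"
    "coh_add s n (coh_zero s n) u = u"
    "coh_add s n (coh_scale s n (-1) u) u = coh_zero s n"
    "coh_scale s n 1 u = u"
    "coh_scale s n 0 u = coh_zero s n"
    "coh_scale s n c (coh_add s n u v) = coh_add s n (coh_scale s n c u) (coh_scale s n c v)"
    "coh_scale s n (c + d) u = coh_add s n (coh_scale s n c u) (coh_scale s n d u)"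
    "coh_scale s n (c * d) u = coh_scale s n c (coh_scale s n d u)"
    "coh_scale s n c (coh_zero s n) = coh_zero s n"
    using cocycles_scale[of f s n "-1"]
    by (simp_all add: coh_add_class coh_scale_class coh_zero_def cocycles_add cocycles_scale
        cocycles_zero algebra_simps)
qed

lemma vectorspace_total_cohomology:
  "vectorspace (class_ring :: 'k::field ring) (total_cohomology s)"
proof -
  let ?M = "total_cohomology s :: ('k, nat \<Rightarrow> ('a, 'k) coh_class) module"
  let ?H = "\<lambda>n. cohomology s n :: ('a, 'k) coh_class set"
  have mem: "h \<in> carrier ?M \<longleftrightarrow> (\<forall>n. h n \<in> ?H n) \<and> finite {n. h n \<noteq> coh_zero s n}" for h
    by (simp add: total_cohomology_def)
  have H: "h n \<in> ?H n" if "h \<in> carrier ?M" for h n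
    using that by (simp add: mem)
  have ops: "add ?M g h = (\<lambda>n. coh_add s n (g n) (h n))" "zero ?M = coh_zero s"
    "module.smult ?M c h = (\<lambda>n. coh_scale s n c (h n))" for g h c
    by (simp_all add: total_cohomology_def)
  have zz: "coh_add s n (coh_zero s n) (coh_zero s n) = (coh_zero s n :: ('a, 'k) coh_class)" for n
    by (rule coh_laws(3)) (rule coh_closed(3))+
  have cz: "coh_scale s n c (coh_zero s n) = (coh_zero s n :: ('a, 'k) coh_class)" for n c
    by (rule coh_laws(10)) (rule coh_closed(3))+
  have add: "add ?M g h \<in> carrier ?M" if "g \<in> carrier ?M" "h \<in> carrier ?M" for g h
  proof -
    have "{n. coh_add s n (g n) (h n) \<noteq> coh_zero s n}
        \<subseteq> {n. g n \<noteq> coh_zero s n} \<union> {n. h n \<noteq> coh_zero s n}"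
    proof
      fix n assume n: "n \<in> {n. coh_add s n (g n) (h n) \<noteq> coh_zero s n}"
      show "n \<in> {n. g n \<noteq> coh_zero s n} \<union> {n. h n \<noteq> coh_zero s n}"
      proof (rule ccontr)
        assume "\<not> ?thesis"
        then have "g n = coh_zero s n" "h n = coh_zero s n" by blast+
        then show False using n zz[of n] by simp
      qed
    qed
    moreover have "finite ({n. g n \<noteq> coh_zero s n} \<union> {n. h n \<noteq> coh_zero s n})"
      using that by (simp add: mem)
    ultimately have "finite {n. coh_add s n (g n) (h n) \<noteq> coh_zero s n}"
      by (rule finite_subset)
    then show ?thesis using that by (simp add: mem ops coh_closed(1))
  qed
  have scale: "module.smult ?M c h \<in> carrier ?M" if "h \<in> carrier ?M" for c h
  proof -
    have "{n. coh_scale s n c (h n) \<noteq> coh_zero s n} \<subseteq> {n. h n \<noteq> coh_zero s n}"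
      using cz by (metis (mono_tags, lifting) mem_Collect_eq subsetI)
    moreover have "finite {n. h n \<noteq> coh_zero s n}"
      using that by (simp add: mem)
    ultimately have "finite {n. coh_scale s n c (h n) \<noteq> coh_zero s n}"
      by (rule finite_subset)
    then show ?thesis using that by (simp add: mem ops coh_closed(2))
  qed
  have zero: "zero ?M \<in> carrier ?M"
    by (simp add: mem ops coh_closed(3))
  have grp: "abelian_group ?M"
  proof (rule abelian_groupI)
    fix x y z assume x: "x \<in> carrier ?M" and y: "y \<in> carrier ?M" and z: "z \<in> carrier ?M"
    show "add ?M x y \<in> carrier ?M" by (rule add[OF x y])
    show "add ?M (add ?M x y) z = add ?M x (add ?M y z)"
      unfolding ops by (rule ext, rule coh_laws(1)[OF H[OF x] H[OF y] H[OF z]])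
    show "add ?M x y = add ?M y x"
      unfolding ops by (rule ext, rule coh_laws(2)[OF H[OF x] H[OF y] H[OF y]])
    show "add ?M (zero ?M) x = x"
      unfolding ops by (rule ext, rule coh_laws(3)[OF H[OF x] H[OF x] H[OF x]])
    show "\<exists>y\<in>carrier ?M. add ?M y x = zero ?M"
    proof (rule bexI[OF _ scale[OF x, of "-1"]])
      show "add ?M (module.smult ?M (-1) x) x = zero ?M"
        unfolding ops by (rule ext, rule coh_laws(4)[OF H[OF x] H[OF x] H[OF x]])
    qed
  qed (rule zero)
  have "Module.module (class_ring :: 'k ring) ?M"
  proof (rule moduleI[OF class_cring.is_cring grp])
    fix a b :: 'k and x y assume x: "x \<in> carrier ?M" and y: "y \<in> carrier ?M"
    show "module.smult ?M a x \<in> carrier ?M" by (rule scale[OF x])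
    show "module.smult ?M (add class_ring a b) x
        = add ?M (module.smult ?M a x) (module.smult ?M b x)"
      unfolding ops using coh_laws(8)[OF H[OF x] H[OF x] H[OF x]] by simp
    show "module.smult ?M a (add ?M x y) = add ?M (module.smult ?M a x) (module.smult ?M a y)"
      unfolding ops by (rule ext, rule coh_laws(7)[OF H[OF x] H[OF y] H[OF y]])
    show "module.smult ?M (monoid.mult class_ring a b) x
        = module.smult ?M a (module.smult ?M b x)"
      unfolding ops using coh_laws(9)[OF H[OF x] H[OF x] H[OF x]] by simp
    show "module.smult ?M (one class_ring) x = x"
      unfolding ops using coh_laws(5)[OF H[OF x] H[OF x] H[OF x]] by simp
  qed
  then show ?thesis
    by (simp add: vectorspace_def class_field)
qed

definition homogeneous ::
    "('x \<Rightarrow> 'x \<Rightarrow> 'x) \<Rightarrow> nat \<Rightarrow> ('x, 'k::comm_ring_1) coh_class \<Rightarrow> nat \<Rightarrow> ('x, 'k) coh_class" where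
  "homogeneous s d u = (coh_zero s)(d := u)"

text \<open>
  The permutation sending \<open>(1, \<dots>, n)\<close> to \<open>(b\<^sub>1, \<dots>, b\<^sub>k, a\<^sub>1, \<dots>, a\<^sub>m)\<close>, where \<open>A = {a\<^sub>1 < \<dots> < a\<^sub>m}\<close> and
  \<open>b\<^sub>1 < \<dots> < b\<^sub>k\<close> are the elements of its complement.
\<close>

definition shuffle_perm :: "nat \<Rightarrow> nat set \<Rightarrow> nat \<Rightarrow> nat" where
  "shuffle_perm n A i =
     (if i \<in> {1..n}
      then (sorted_list_of_set ({1..n} - A) @ sorted_list_of_set A) ! (i - 1)
      else i)"

text \<open>
  \<open>foldr F [a\<^sub>1, \<dots>, a\<^sub>m] z = F a\<^sub>1 (F a\<^sub>2 (\<dots> (F a\<^sub>m z)))\<close>, so the face with the largest index is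
  applied first.
\<close>

definition cup ::
    "('x \<Rightarrow> 'x \<Rightarrow> 'x) \<Rightarrow> nat \<Rightarrow> nat \<Rightarrow> ('x, 'k::comm_ring_1) rack_cochain \<Rightarrow> ('x, 'k) rack_cochain
      \<Rightarrow> ('x, 'k) rack_cochain" where
  "cup s k m f g z =
     (if length (snd z) = k + m
      then (-1) ^ (k * m) *
        (\<Sum>A | A \<subseteq> {1..k + m} \<and> card A = m.
           of_int (sign (shuffle_perm (k + m) A)) *
           f (foldr face0 (sorted_list_of_set A) z) *
           g (foldr (face1 s) (sorted_list_of_set ({1..k + m} - A)) z))
      else 0)"

definition coh_cup ::
    "('x \<Rightarrow> 'x \<Rightarrow> 'x) \<Rightarrow> nat \<Rightarrow> nat \<Rightarrow> ('x, 'k::comm_ring_1) coh_class \<Rightarrow> ('x, 'k) coh_class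
      \<Rightarrow> ('x, 'k) coh_class" where
  "coh_cup s k m = induced2 s (k + m) (cup s k m)"

definition coh_one :: "('x \<Rightarrow> 'x \<Rightarrow> 'x) \<Rightarrow> ('x, 'k::comm_ring_1) coh_class" where
  "coh_one s = rack_class s 0 (\<lambda>z. if length (snd z) = 0 then 1 else 0)"

definition P_op :: "nat \<Rightarrow> ('x, 'k::comm_ring_1) rack_cochain \<Rightarrow> ('x, 'k) rack_cochain" where
  "P_op k F z =
     (if length (snd z) = k + 1 then (-1) ^ k * F (hd (snd z), tl (snd z)) else 0)"

definition coh_P ::
    "('x \<Rightarrow> 'x \<Rightarrow> 'x) \<Rightarrow> nat \<Rightarrow> ('x, 'k::comm_ring_1) coh_class \<Rightarrow> ('x, 'k) coh_class" where
  "coh_P s k = induced s (k + 1) (P_op k)"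

definition words :: "(nat \<times> nat) list set" where
  "words = {w. w \<noteq> [] \<and> (\<forall>(m, e) \<in> set w. e \<in> {0, 1})}"

fun word_degree :: "(nat \<times> nat) list \<Rightarrow> nat" where
  "word_degree [(m, e)] = 2 * m + 3 * e"
| "word_degree ((m, e) # v # w) = 2 * m + (3 * e + (word_degree (v # w) + 1))"

text \<open>\<open>B_power s B e\<close> is \<open>B\<^sup>e\<close> for \<open>e \<in> {0, 1}\<close>, a class of degree \<open>3 e\<close>.\<close>

definition B_power ::
    "('x \<Rightarrow> 'x \<Rightarrow> 'x) \<Rightarrow> ('x, 'k::comm_ring_1) coh_class \<Rightarrow> nat \<Rightarrow> ('x, 'k) coh_class" where
  "B_power s B e = (if e = 0 then coh_one s else B)"

text \<open>
  \<open>word_class s A B ((m\<^sub>1, e\<^sub>1) # w)\<close> is \<open>A m\<^sub>1 \<union> (B\<^sup>e\<^sup>1 \<union> P (word_class s A B w))\<close>, with cup products; it has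
  degree \<open>word_degree\<close>.
\<close>

fun word_class ::
    "('x \<Rightarrow> 'x \<Rightarrow> 'x) \<Rightarrow> (nat \<Rightarrow> ('x, 'k::comm_ring_1) coh_class) \<Rightarrow> ('x, 'k) coh_class
      \<Rightarrow> (nat \<times> nat) list \<Rightarrow> ('x, 'k) coh_class" where
  "word_class s A B [(m, e)] = coh_cup s (2 * m) (3 * e) (A m) (B_power s B e)"
| "word_class s A B ((m, e) # v # w) =
     (let d = word_degree (v # w)
      in coh_cup s (2 * m) (3 * e + (d + 1)) (A m)
           (coh_cup s (3 * e) (d + 1) (B_power s B e) (coh_P s d (word_class s A B (v # w)))))"

definition word_element ::
    "('x \<Rightarrow> 'x \<Rightarrow> 'x) \<Rightarrow> (nat \<Rightarrow> ('x, 'k::comm_ring_1) coh_class) \<Rightarrow> ('x, 'k) coh_class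
      \<Rightarrow> (nat \<times> nat) list \<Rightarrow> nat \<Rightarrow> ('x, 'k) coh_class" where
  "word_element s A B w = homogeneous s (word_degree w) (word_class s A B w)"

end

theory Submission
  imports Defs "HOL-Library.Function_Algebras"
begin

text \<open>
  A cochain is a function \<open>F y r\<close> of the base point \<open>y\<close> and of the reversed word
  \<open>r = [x\<^sub>n, \<dots>, x\<^sub>1]\<close>. With this convention coboundary and cup product are recursive in the last
  letter, and identities between them are inductions on the word. For \<open>s = 1\<close> or \<open>s = -1\<close> the
  operator \<open>cobd s\<close> is the alternating sum in which the second family of faces is multiplied by
  \<open>s\<close>; the rack complex is the case \<open>s = 1\<close>. For \<open>s = -1\<close> the complex is acyclic, because repeating
  the base point as first letter contracts it up to the invertible factor \<open>-2\<close> (\<open>odd_acyclic\<close>).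

  Let \<open>D F = F (y + 1) - F (y - 1)\<close>, and let \<open>N\<close> be summation over the base point. Reflections
  exchange \<open>y + 1\<close> and \<open>y - 1\<close>, so \<open>D\<close> interchanges the two signs \<open>s\<close>, while \<open>N\<close> preserves them. A
  function is a difference \<open>D G\<close> exactly when its base sum vanishes, and \<open>D F = 0\<close> exactly when \<open>F\<close>
  does not depend on the base point. For a cocycle \<open>F\<close> acyclicity gives \<open>D F = cobd (-1) E\<close> and
  \<open>N E = cobd (-1) G\<close>; the class of \<open>D G\<close> depends on \<open>F\<close> only, and \<open>F \<mapsto> D G\<close> is an operation \<open>\<Phi>\<close> of
  degree \<open>-2\<close>. A diagram chase shows that \<open>\<Phi>\<close> is surjective (\<open>secondary_surj\<close>). Let \<open>T\<close> be the
  classes of cocycles that do not depend on the base point, and let \<open>B\<close> be the class of degree 3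
  obtained by running the descent backwards from the coboundary of the indicator of the base point
  \<open>0\<close>. The kernel of \<open>\<Phi>\<close> is the direct sum of \<open>T\<close> and \<open>B \<union> T\<close> (\<open>secondary_kernel\<close>,
  \<open>base_free_B_direct\<close>). Finally \<open>P\<close> is injective, and \<open>T\<close> is spanned by the unit and the image of
  \<open>P\<close> (\<open>base_free_decomp\<close>, \<open>drop_base_exact\<close>).

  The definition of \<open>\<Phi>\<close> does not show how it acts on products. The operator that inserts two
  adjacent letters, \<open>F \<mapsto> (\<Sum>u. F (y; u, u + 1, \<dots>) + F (y; u, u - 1, \<dots>))\<close>, is a chain map, and it is
  a derivation on cohomology by an explicit product formula (\<open>pair_op_derivation\<close>). A duality
  argument shows that an equivariant insertion of two letters that vanishes on the 2-cocycles
  killed by \<open>\<Phi>\<close> is a multiple of \<open>\<Phi>\<close> (\<open>front_op_multiple\<close>). The multiple is not zero here, because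
  the insertion takes the value \<open>2\<close> on Mochizuki's 2-cocycle (\<open>pair_op_mochizuki\<close>). Hence \<open>\<Phi>\<close> is a
  derivation on cohomology.

  Antisymmetrising in every letter defines a chain map \<open>proj\<close>. It is idempotent, multiplicative up
  to homotopy (\<open>proj_shuf\<close>), commutes with \<open>\<Phi>\<close> on cohomology, and kills \<open>T\<close> in positive degrees.
  Starting with \<open>A\<^sub>0 = 1\<close>, choose \<open>A\<^sub>m\<^sub>+\<^sub>1\<close> fixed by \<open>proj\<close> with \<open>\<Phi> A\<^sub>m\<^sub>+\<^sub>1 = A\<^sub>m\<close>. By induction
  and Pascal's rule, \<open>\<Phi>\<close> annihilates \<open>A\<^sub>k \<union> A\<^sub>m - (k + m choose k) A\<^sub>k\<^sub>+\<^sub>m\<close>, which therefore lies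
  in \<open>T + B \<union> T\<close>. It is fixed by \<open>proj\<close>, but \<open>proj\<close> kills this sum in even positive degree, since
  there the factor of \<open>B\<close> has odd degree.

  On words \<open>\<Phi>\<close> lowers the first exponent \<open>m\<^sub>1\<close> by one and annihilates the words with \<open>m\<^sub>1 = 0\<close>. The
  latter are \<open>1\<close>, \<open>B\<close>, \<open>P w\<close> and \<open>B \<union> P w\<close> for shorter words \<open>w\<close>, which is what the description of
  the kernel asks for. Generation and linear independence follow by induction on the degree
  (\<open>span\<close>, \<open>independent\<close>).
\<close>

section \<open>Coboundary and shuffle product on reversed words\<close>

type_synonym ('a, 'k) cochain = "'a \<Rightarrow> 'a list \<Rightarrow> 'k"

definition fix_last :: "('a, 'k) cochain \<Rightarrow> 'a \<Rightarrow> ('a, 'k) cochain" where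
  "fix_last F x = (\<lambda>y r. F y (x # r))"

text \<open>
  The action of the letter \<open>x\<close> on a symbol, \<open>a * x = 2 x - a\<close> in every entry, twisted by the sign
  \<open>s\<close>.
\<close>

definition reflect :: "'k::comm_ring_1 \<Rightarrow> ('a::comm_ring_1, 'k) cochain \<Rightarrow> 'a \<Rightarrow> ('a, 'k) cochain" where
  "reflect s F x = (\<lambda>y r. s * F (2 * x - y) (map (\<lambda>a. 2 * x - a) r))"

text \<open>
  The sign of the degree. It enters the Leibniz rule on the right argument, so that all rules hold
  for inhomogeneous cochains and no degrees have to be carried along.
\<close>

definition dsign :: "('a, 'k::comm_ring_1) cochain \<Rightarrow> ('a, 'k) cochain" where
  "dsign F = (\<lambda>y r. (-1) ^ length r * F y r)"

definition scale :: "'k::comm_ring_1 \<Rightarrow> ('a, 'k) cochain \<Rightarrow> ('a, 'k) cochain" where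
  "scale c F = (\<lambda>y r. c * F y r)"

text \<open>
  The last letter contributes the summand \<open>i = n\<close>; all other faces leave it in place, and on them
  it is a parameter. Nothing bounds the length of the words, so \<open>cobd s\<close> acts on the product of the
  groups of all degrees.
\<close>

fun cobd :: "'k::comm_ring_1 \<Rightarrow> ('a::comm_ring_1, 'k) cochain \<Rightarrow> ('a, 'k) cochain" where
  "cobd s F y [] = 0"
| "cobd s F y (x # r) = cobd s (fix_last F x) y r - (-1) ^ length r * (F y r - reflect s F x y r)"

text \<open>
  The cup product, with the overall sign \<open>(-1)\<^sup>k\<^sup>m\<close> absorbed into the recursion: the last letter
  either belongs to the first factor and then acts on all arguments of the second, or it belongs to
  the second factor and has to pass the arguments of the first. The parameter \<open>s\<close> twists that
  action, which is needed for products with cochains of the acyclic complex.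
\<close>

fun shuf :: "'k::comm_ring_1 \<Rightarrow> ('a::comm_ring_1, 'k) cochain \<Rightarrow> ('a, 'k) cochain \<Rightarrow> ('a, 'k) cochain" where
  "shuf s F G y [] = F y [] * G y []"
| "shuf s F G y (x # r) = shuf s (fix_last F x) (reflect s G x) y r + shuf s (dsign F) (fix_last G x) y r"

lemma fix_last_lin [simp]:
  "fix_last (F + G) x = fix_last F x + fix_last G x" "fix_last (F - G) x = fix_last F x - fix_last G x"
  "fix_last (- F) x = - fix_last F x" "fix_last 0 x = 0"
  "fix_last (scale c F) x = scale c (fix_last F x)"
  by (auto simp: fix_last_def scale_def fun_eq_iff)

lemma reflect_lin [simp]:
  "reflect s (F + G) x = reflect s F x + reflect s G x"
  "reflect s (F - G) x = reflect s F x - reflect s G x"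
  "reflect s (- F) x = - reflect s F x" "reflect s 0 x = 0"
  "reflect s (scale c F) x = scale c (reflect s F x)"
  by (auto simp: reflect_def scale_def fun_eq_iff algebra_simps)

lemma dsign_lin [simp]:
  "dsign (F + G) = dsign F + dsign G" "dsign (F - G) = dsign F - dsign G" "dsign (- F) = - dsign F"
  "dsign 0 = 0"
  "dsign (scale c F) = scale c (dsign F)"
  by (auto simp: dsign_def scale_def fun_eq_iff algebra_simps)

lemma scale_lin:
  "scale c (F + G) = scale c F + scale c G" "scale c (F - G) = scale c F - scale c G"
  "scale c (- F) = - scale c F" "scale (c + d) F = scale c F + scale d F"
  "scale (c - d) F = scale c F - scale d F" "scale (- c) F = - scale c F"
  by (auto simp: scale_def fun_eq_iff algebra_simps)

lemma scale_simps [simp]: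
  "scale c 0 = 0" "scale 0 F = 0" "scale 1 F = F" "scale c (scale d F) = scale (c * d) F"
  by (auto simp: scale_def fun_eq_iff algebra_simps)

lemma scale_apply [simp]: "scale c F y r = c * F y r"
  by (simp add: scale_def)

lemma dsign_dsign [simp]: "dsign (dsign F) = F"
  by (auto simp: dsign_def fun_eq_iff mult.assoc[symmetric] power_add[symmetric] mult_2[symmetric])

lemma fix_last_dsign [simp]: "fix_last (dsign F) x = - dsign (fix_last F x)"
  by (auto simp: dsign_def fix_last_def fun_eq_iff)

lemma dsign_reflect: "dsign (reflect s F x) = reflect s (dsign F) x"
  by (auto simp: dsign_def reflect_def fun_eq_iff algebra_simps)

lemma fix_last_reflect: "fix_last (reflect s F x) a = reflect s (fix_last F (2 * x - a)) x"
  by (auto simp: reflect_def fix_last_def fun_eq_iff)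

lemma reflect_reflect: "reflect s (reflect t F x) a = reflect t (reflect s F (2 * x - a)) x"
  by (auto simp: reflect_def fun_eq_iff o_def algebra_simps)

lemma reflect_same: "reflect s (reflect t F x) x = scale (s * t) F"
  by (auto simp: reflect_def scale_def fun_eq_iff o_def algebra_simps)

lemma cobd_add: "cobd s (F + G) = cobd s F + cobd s G"
proof (intro ext)
  fix y r show "cobd s (F + G) y r = (cobd s F + cobd s G) y r"
    by (induction r arbitrary: F G) (auto simp: algebra_simps)
qed

lemma cobd_scale: "cobd s (scale c F) = scale c (cobd s F)"
proof (intro ext)
  fix y r show "cobd s (scale c F) y r = (scale c (cobd s F)) y r"
    by (induction r arbitrary: F) (auto simp: algebra_simps)
qed

lemma cobd_zero [simp]: "cobd s 0 = 0"
  using cobd_scale[of s 0 0] by simp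

lemma cobd_uminus: "cobd s (- F) = - cobd s F"
  using cobd_scale[of s "-1" F] by (simp add: scale_lin)

lemma cobd_diff: "cobd s (F - G) = cobd s F - cobd s G"
  using cobd_add[of s F "- G"] by (simp add: cobd_uminus)

lemmas cobd_lin [simp] = cobd_add cobd_scale cobd_uminus cobd_diff

lemma fix_last_cobd: "fix_last (cobd s F) x = cobd s (fix_last F x) - dsign (F - reflect s F x)"
  by (auto simp: fun_eq_iff fix_last_def dsign_def)

lemma cobd_dsign [simp]: "cobd s (dsign F) = - dsign (cobd s F)"
proof (intro ext)
  fix y r show "cobd s (dsign F) y r = (- dsign (cobd s F)) y r"
  proof (induction r arbitrary: F)
    case (Cons x r)
    then show ?case by (auto simp: dsign_reflect[symmetric]) (auto simp: dsign_def algebra_simps)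
  qed (auto simp: dsign_def)
qed

lemma reflect_cobd: "reflect t (cobd s F) x = cobd s (reflect t F x)"
proof (intro ext)
  fix y r show "reflect t (cobd s F) x y r = cobd s (reflect t F x) y r"
  proof (induction r arbitrary: F)
    case (Cons a r)
    have "reflect t (cobd s F) x y (a # r) = reflect t (fix_last (cobd s F) (2 * x - a)) x y r"
      using fix_last_reflect[of t "cobd s F" x a] by (simp add: fix_last_def fun_eq_iff)
    also have "\<dots> = cobd s (fix_last (reflect t F x) a) y r - dsign (reflect t F x - reflect t (reflect s F (2 * x - a)) x) y r"
      by (simp add: fix_last_cobd Cons fix_last_reflect dsign_reflect)
    also have "\<dots> = cobd s (reflect t F x) y (a # r)"
      by (simp add: reflect_reflect[of s t] dsign_def)
    finally show ?case .
  qed (auto simp: reflect_def)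
qed

lemma cobd_cobd [simp]: "cobd s (cobd s F) = 0"
proof (intro ext)
  fix y r show "cobd s (cobd s F) y r = 0 y r"
  proof (induction r arbitrary: F)
    case (Cons x r)
    then show ?case by (simp add: fix_last_cobd reflect_cobd) (simp add: dsign_def algebra_simps)
  qed auto
qed

lemma shuf_add_left: "shuf s (F + F') G = shuf s F G + shuf s F' G"
proof (intro ext)
  fix y r show "shuf s (F + F') G y r = (shuf s F G + shuf s F' G) y r"
    by (induction r arbitrary: F F' G) (auto simp: algebra_simps)
qed

lemma shuf_add_right: "shuf s F (G + G') = shuf s F G + shuf s F G'"
proof (intro ext)
  fix y r show "shuf s F (G + G') y r = (shuf s F G + shuf s F G') y r"
    by (induction r arbitrary: F G' G) (auto simp: algebra_simps)
qed

lemma shuf_scale_left: "shuf s (scale c F) G = scale c (shuf s F G)"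
proof (intro ext)
  fix y r show "shuf s (scale c F) G y r = scale c (shuf s F G) y r"
    by (induction r arbitrary: F G) (auto simp: algebra_simps)
qed

lemma shuf_scale_right: "shuf s F (scale c G) = scale c (shuf s F G)"
proof (intro ext)
  fix y r show "shuf s F (scale c G) y r = scale c (shuf s F G) y r"
    by (induction r arbitrary: F G) (auto simp: algebra_simps)
qed

lemma shuf_zero [simp]: "shuf s 0 G = 0" "shuf s F 0 = 0"
  using shuf_scale_left[of s 0 0 G] shuf_scale_right[of s F 0 0] by simp_all

lemma shuf_uminus: "shuf s (- F) G = - shuf s F G" "shuf s F (- G) = - shuf s F G"
  using shuf_scale_left[of s "-1" F G] shuf_scale_right[of s F "-1" G] by (simp_all add: scale_lin)

lemma shuf_diff: "shuf s (F - F') G = shuf s F G - shuf s F' G"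
  "shuf s F (G - G') = shuf s F G - shuf s F G'"
  using shuf_add_left[of s F "- F'" G] shuf_add_right[of s F G "- G'"] by (simp_all add: shuf_uminus)

lemmas shuf_lin [simp] = shuf_add_left shuf_add_right shuf_scale_left shuf_scale_right shuf_uminus shuf_diff

lemma fix_last_shuf: "fix_last (shuf s F G) x = shuf s (fix_last F x) (reflect s G x) + shuf s (dsign F) (fix_last G x)"
  by (auto simp: fun_eq_iff fix_last_def)

lemma dsign_shuf: "dsign (shuf s F G) = shuf s (dsign F) (dsign G)"
proof (intro ext)
  fix y r show "dsign (shuf s F G) y r = shuf s (dsign F) (dsign G) y r"
  proof (induction r arbitrary: F G)
    case (Cons x r)
    have "dsign (shuf s F G) y (x # r) = - dsign (fix_last (shuf s F G) x) y r"
      by (simp add: fix_last_def dsign_def)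
    then show ?case by (simp add: fix_last_shuf Cons dsign_reflect[symmetric])
  qed (auto simp: dsign_def)
qed

lemma reflect_shuf: "reflect (t * s) (shuf s F G) x = shuf s (reflect t F x) (reflect s G x)"
proof (intro ext)
  fix y r show "reflect (t * s) (shuf s F G) x y r = shuf s (reflect t F x) (reflect s G x) y r"
  proof (induction r arbitrary: F G)
    case (Cons a r)
    have "reflect (t * s) (shuf s F G) x y (a # r) = reflect (t * s) (fix_last (shuf s F G) (2 * x - a)) x y r"
      using fix_last_reflect[of "t * s" "shuf s F G" x a] by (simp add: fix_last_def fun_eq_iff)
    also have "\<dots> = shuf s (reflect t F x) (reflect s G x) y (a # r)"
      using reflect_reflect[of s s G x a] by (simp add: fix_last_shuf Cons fix_last_reflect dsign_reflect)
    finally show ?case .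
  qed (auto simp: reflect_def)
qed

text \<open>
  The Leibniz rule. In the induction, the terms in which the last letter is removed cancel in pairs
  because a reflection applied twice is the identity.
\<close>

lemma cobd_shuf: "cobd (t * s) (shuf s F G) = shuf s (cobd t F) (dsign G) + shuf s F (cobd s G)"
proof (intro ext)
  fix y r
  show "cobd (t * s) (shuf s F G) y r = (shuf s (cobd t F) (dsign G) + shuf s F (cobd s G)) y r"
  proof (induction r arbitrary: F G)
    case (Cons x r)
    have "cobd (t * s) (shuf s F G) y (x # r) = cobd (t * s) (fix_last (shuf s F G) x) y r
        - dsign (shuf s F G - reflect (t * s) (shuf s F G) x) y r"
      by (simp add: dsign_def)
    also have "cobd (t * s) (fix_last (shuf s F G) x) y r =
        (shuf s (cobd t (fix_last F x)) (dsign (reflect s G x)) + shuf s (fix_last F x) (cobd s (reflect s G x))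
         + (shuf s (cobd t (dsign F)) (dsign (fix_last G x)) + shuf s (dsign F) (cobd s (fix_last G x)))) y r"
      by (simp only: fix_last_shuf cobd_add plus_fun_apply Cons)
    finally have 1: "cobd (t * s) (shuf s F G) y (x # r) =
        (shuf s (cobd t (fix_last F x)) (dsign (reflect s G x)) + shuf s (fix_last F x) (cobd s (reflect s G x))
         + (shuf s (cobd t (dsign F)) (dsign (fix_last G x)) + shuf s (dsign F) (cobd s (fix_last G x)))) y r
        - dsign (shuf s F G - reflect (t * s) (shuf s F G) x) y r" .
    have 2: "shuf s (cobd t F) (dsign G) y (x # r) = shuf s (fix_last (cobd t F) x) (reflect s (dsign G) x) y r
          + shuf s (dsign (cobd t F)) (fix_last (dsign G) x) y r"
      "shuf s F (cobd s G) y (x # r) = shuf s (fix_last F x) (reflect s (cobd s G) x) y r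
          + shuf s (dsign F) (fix_last (cobd s G) x) y r"
      by simp_all
    show ?case
      unfolding 1 plus_fun_apply 2 fix_last_cobd
      apply (simp only: reflect_shuf dsign_shuf reflect_cobd dsign_reflect shuf_lin dsign_lin fix_last_dsign cobd_dsign)
      apply (simp only: plus_fun_apply minus_apply uminus_apply)
      by (simp only: algebra_simps)
  qed auto
qed

section \<open>Insertion of letters in front\<close>

definition lin_form :: "(('a, 'k::comm_ring_1) cochain \<Rightarrow> 'k) \<Rightarrow> bool" where
  "lin_form L \<longleftrightarrow> (\<forall>g h. L (g + h) = L g + L h) \<and> (\<forall>c g. L (scale c g) = c * L g)"

text \<open>
  \<open>L y\<close> is a functional that eats the first letters of a word (the end of the reversed list); the
  remaining letters stay in place.
\<close>

definition front :: "('a \<Rightarrow> ('a, 'k) cochain \<Rightarrow> 'k) \<Rightarrow> ('a, 'k) cochain \<Rightarrow> ('a, 'k) cochain" where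
  "front L F = (\<lambda>y r. L y (\<lambda>w l. F w (r @ l)))"

text \<open>
  \<open>m\<close> letters are consumed, and \<open>L\<close> commutes with reflections up to the sign \<open>t\<close>. The last
  condition is what makes \<open>front L\<close> compatible with those faces that act on the consumed letters.
\<close>

definition front_op :: "nat \<Rightarrow> 'k::comm_ring_1 \<Rightarrow> ('a::comm_ring_1 \<Rightarrow> ('a, 'k) cochain \<Rightarrow> 'k) \<Rightarrow> bool" where
  "front_op m t L \<longleftrightarrow> (\<forall>y. lin_form (L y)) \<and>
     (\<forall>y g h. (\<forall>w l. length l = m \<longrightarrow> g w l = h w l) \<longrightarrow> L y g = L y h) \<and>
     (\<forall>x y g. L (2 * x - y) g = t * L y (reflect 1 g x))"

text \<open>
  The faces at the kept letters commute with \<open>front L\<close> by equivariance; the faces at the consumed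
  letters form the second summand.
\<close>

lemma front_cobd:
  fixes L :: "'a::comm_ring_1 \<Rightarrow> ('a, 'k::comm_ring_1) cochain \<Rightarrow> 'k"
  assumes L: "front_op m t L" and t: "t * t = 1"
  shows "front L (cobd s F) y r = (-1) ^ m * cobd (s * t) (front L F) y r
    + L y (cobd s (\<lambda>w l. F w (r @ l)))"
proof (induction r arbitrary: F)
  case Nil
  then show ?case by (simp add: front_def)
next
  case (Cons x r)
  have add: "L y (g + h) = L y g + L y h" and scale: "L y (scale c g) = c * L y g" for g h c
    using L by (auto simp: front_op_def lin_form_def)
  have cong: "L y g = L y h" if "\<And>w l. length l = m \<Longrightarrow> g w l = h w l" for g h
    using L that unfolding front_op_def by blast
  have eqv: "L y (reflect 1 g x) = t * L (2 * x - y) g" for g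
    using L t unfolding front_op_def by (simp add: mult.assoc[symmetric])
  let ?c = "(-1) ^ (length r + m) :: 'k"
  let ?G = "\<lambda>w l. F w (r @ l)"
  let ?H = "\<lambda>w l. F w (map (\<lambda>a. 2 * x - a) r @ l)"
  have "front L (cobd s F) y (x # r) = L y ((\<lambda>w l. cobd s (fix_last F x) w (r @ l))
      + scale (- ?c) ?G + scale (?c * s) (reflect 1 ?H x))"
    unfolding front_def
    by (rule cong) (simp add: scale_def reflect_def power_add algebra_simps)
  also have "\<dots> = front L (cobd s (fix_last F x)) y r - ?c * front L F y r
      + ?c * s * (t * front L F (2 * x - y) (map (\<lambda>a. 2 * x - a) r))"
    by (simp add: add scale eqv front_def)
  also have "front L (cobd s (fix_last F x)) y r = (-1) ^ m * cobd (s * t) (fix_last (front L F) x) y r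
      + L y (cobd s (\<lambda>w l. F w ((x # r) @ l)))"
    using Cons[of "fix_last F x"] by (simp add: fix_last_def front_def)
  finally show ?case
    by (simp add: reflect_def power_add algebra_simps)
qed

lemma front_chain:
  assumes "front_op m t L" "t * t = 1" "\<And>y g. L y (cobd s g) = 0"
  shows "front L (cobd s F) = scale ((-1) ^ m) (cobd (s * t) (front L F))"
  using front_cobd[OF assms(1,2)] assms(3) by (auto simp: fun_eq_iff scale_def)

section \<open>Operations on the base point\<close>

type_synonym 'p dcochain = "('p mod_ring, 'p mod_ring) cochain"

definition base_diff :: "'p::prime_card dcochain \<Rightarrow> 'p dcochain" where
  "base_diff F = (\<lambda>y r. F (y + 1) r - F (y - 1) r)"

definition base_sum :: "'p::prime_card dcochain \<Rightarrow> 'p dcochain" where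
  "base_sum F = (\<lambda>y r. \<Sum>u\<in>UNIV. F u r)"

text \<open>
  A primitive for the base sum: \<open>base_weight\<close> of a difference is the base sum
  (\<open>base_weight_base_diff\<close>), so base sums of cocycles become coboundaries.
\<close>

definition base_weight :: "'p::prime_card dcochain \<Rightarrow> 'p dcochain" where
  "base_weight F = (\<lambda>y r. \<Sum>u\<in>UNIV. (y - u) / 2 * F u r)"

definition insert_base :: "'p::prime_card dcochain \<Rightarrow> 'p dcochain" where
  "insert_base F = (\<lambda>y r. F y (r @ [y]))"

definition base_free :: "'p::prime_card dcochain \<Rightarrow> bool" where
  "base_free F \<longleftrightarrow> (\<forall>y y' r. F y r = F y' r)"

definition base_delta :: "'p::prime_card dcochain \<Rightarrow> 'p dcochain" where
  "base_delta F = (\<lambda>y r. if y = 0 then F y r else 0)"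

definition unit :: "'p::prime_card dcochain" where
  "unit = (\<lambda>y r. if r = [] then 1 else 0)"

lemma sum_shift:
  fixes f :: "'p::prime_card mod_ring \<Rightarrow> 'b::comm_monoid_add"
  shows "(\<Sum>u\<in>UNIV. f (u + c)) = sum f UNIV" "(\<Sum>u\<in>UNIV. f (u - c)) = sum f UNIV"
    "(\<Sum>u\<in>UNIV. f (c - u)) = sum f UNIV" "(\<Sum>u\<in>UNIV. f (c + u)) = sum f UNIV"
proof -
  show "(\<Sum>u\<in>UNIV. f (u + c)) = sum f UNIV"
    by (rule sum.reindex_bij_witness[where i = "\<lambda>u. u - c" and j = "\<lambda>u. u + c"]) auto
  show "(\<Sum>u\<in>UNIV. f (u - c)) = sum f UNIV"
    by (rule sum.reindex_bij_witness[where i = "\<lambda>u. u + c" and j = "\<lambda>u. u - c"]) auto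
  show "(\<Sum>u\<in>UNIV. f (c - u)) = sum f UNIV"
    by (rule sum.reindex_bij_witness[where i = "\<lambda>u. c - u" and j = "\<lambda>u. c - u"]) auto
  show "(\<Sum>u\<in>UNIV. f (c + u)) = sum f UNIV"
    by (rule sum.reindex_bij_witness[where i = "\<lambda>u. u - c" and j = "\<lambda>u. c + u"]) auto
qed

lemma sum_const_zero: "(\<Sum>u\<in>(UNIV :: 'p::prime_card mod_ring set). (c :: 'p mod_ring)) = 0"
  by (simp add: CARD_mod_ring)

lemma two_neq_zero:
  assumes "odd CARD('p::prime_card)" shows "(2 :: 'p mod_ring) \<noteq> 0"
proof
  assume "(2 :: 'p mod_ring) = 0"
  then have "of_nat 2 = (0 :: 'p mod_ring)" by simp
  then have "CARD('p) dvd 2" by (rule of_nat_0_mod_ring_dvd)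
  moreover have "CARD('p) > 1" using prime_card[where 'a = 'p] prime_gt_1_nat by blast
  ultimately have "CARD('p) = 2" using dvd_imp_le[of "CARD('p)" 2] by simp
  then show False using assms by simp
qed

lemma base_diff_lin [simp]: "base_diff (F + G) = base_diff F + base_diff G"
  "base_diff (F - G) = base_diff F - base_diff G" "base_diff (- F) = - base_diff F"
  "base_diff 0 = 0" "base_diff (scale c F) = scale c (base_diff F)"
  by (auto simp: base_diff_def fun_eq_iff algebra_simps)

lemma base_sum_lin [simp]: "base_sum (F + G) = base_sum F + base_sum G"
  "base_sum (F - G) = base_sum F - base_sum G" "base_sum (- F) = - base_sum F"
  "base_sum 0 = 0" "base_sum (scale c F) = scale c (base_sum F)"
  by (auto simp: base_sum_def fun_eq_iff sum.distrib sum_subtractf sum_negf sum_distrib_left)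

lemma insert_base_lin [simp]: "insert_base (F + G) = insert_base F + insert_base G"
  "insert_base (F - G) = insert_base F - insert_base G"
  "insert_base (- F) = - insert_base F" "insert_base 0 = 0"
  "insert_base (scale c F) = scale c (insert_base F)"
  by (auto simp: insert_base_def fun_eq_iff)

lemma dsign_base: "base_diff (dsign F) = dsign (base_diff F)"
  "base_sum (dsign F) = dsign (base_sum F)" "base_delta (dsign F) = dsign (base_delta F)"
  by (auto simp: base_diff_def base_sum_def base_delta_def dsign_def fun_eq_iff algebra_simps sum_distrib_left)

lemma fix_last_base: "fix_last (base_diff F) x = base_diff (fix_last F x)"
  "fix_last (base_sum F) x = base_sum (fix_last F x)"
  by (auto simp: base_diff_def base_sum_def fix_last_def fun_eq_iff)

text \<open>
  The reflection in \<open>x\<close> sends \<open>y + 1\<close> to \<open>(2 x - y) - 1\<close>; this is where the sign changes.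
\<close>

lemma base_diff_cobd: "base_diff (cobd s F) = cobd (- s) (base_diff F)"
proof -
  let ?L = "\<lambda>y g. g (y + 1) [] - g (y - 1) [] :: 'a mod_ring"
  have "front_op 0 (-1) ?L"
    by (auto simp: front_op_def lin_form_def reflect_def algebra_simps)
  from front_chain[OF this, of s F] show ?thesis
    by (simp add: front_def base_diff_def)
qed

lemma base_sum_cobd: "base_sum (cobd s F) = cobd s (base_sum F)"
proof -
  let ?L = "\<lambda>(y :: 'a mod_ring) (g :: 'a dcochain). \<Sum>u\<in>UNIV. g u []"
  have "(\<Sum>u\<in>UNIV. g (2 * x - u) []) = (\<Sum>u\<in>UNIV. g u [])" for x and g :: "'a dcochain"
    by (rule sum_shift(3)[of "\<lambda>u. g u []"])
  then have "front_op 0 1 ?L"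
    by (simp add: front_op_def lin_form_def reflect_def sum.distrib sum_distrib_left)
  from front_chain[OF this, of s F] show ?thesis
    by (simp add: front_def base_sum_def)
qed

lemma base_weight_cobd: "base_weight (cobd s F) = cobd (- s) (base_weight F)"
proof -
  let ?L = "\<lambda>y g. \<Sum>u\<in>UNIV. (y - u) / 2 * g u [] :: 'a mod_ring"
  have "?L (2 * x - y) g = - ?L y (reflect 1 g x)" for x y g
  proof -
    have "?L (2 * x - y) g = (\<Sum>u\<in>UNIV. (2 * x - y - (2 * x - u)) / 2 * g (2 * x - u) [])"
      by (rule sum_shift(3)[symmetric])
    also have "\<dots> = (\<Sum>u\<in>UNIV. - ((y - u) / 2 * g (2 * x - u) []))"
    proof (rule sum.cong[OF refl])
      fix u
      have "2 * x - y - (2 * x - u) = - (y - u)" by simp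
      then show "(2 * x - y - (2 * x - u)) / 2 * g (2 * x - u) [] = - ((y - u) / 2 * g (2 * x - u) [])"
        by (simp only: minus_divide_left[symmetric] mult_minus_left)
    qed
    finally show ?thesis by (simp add: reflect_def sum_negf)
  qed
  then have "front_op 0 (-1) ?L"
    by (simp add: front_op_def lin_form_def distrib_left sum.distrib sum_distrib_left
        mult.left_commute sum_negf del: times_divide_eq_left)
  from front_chain[OF this, of s F] show ?thesis
    by (simp add: front_def base_weight_def)
qed

text \<open>
  The face that removes the inserted first letter returns the symbol itself, and the dihedral
  operation is idempotent, so both families of faces contribute at that letter.
\<close>

lemma insert_base_cobd: "insert_base (cobd s F) = - cobd s (insert_base F) - scale (1 - s) F"
proof (intro ext)
  fix y r
  let ?L = "\<lambda>y g. g y [y] :: 'a mod_ring"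
  have "front_op 1 1 ?L"
    by (auto simp: front_op_def lin_form_def reflect_def)
  from front_cobd[OF this, of s F y r] show "insert_base (cobd s F) y r = (- cobd s (insert_base F) - scale (1 - s) F) y r"
    by (simp add: front_def insert_base_def reflect_def algebra_simps)
qed

text \<open>
  As \<open>2\<close> generates \<open>\<int>/p\<close>, steps of length two connect all base points.
\<close>

lemma base_free_iff_base_diff:
  assumes "odd CARD('p::prime_card)"
  shows "base_free (F :: 'p dcochain) \<longleftrightarrow> base_diff F = 0"
proof
  assume "base_free F" then show "base_diff F = 0" unfolding base_free_def base_diff_def fun_eq_iff by auto
next
  assume F: "base_diff F = 0"
  have step: "F (y + 2) r = F y r" for y r
  proof -
    have "base_diff F (y + 1) r = 0" using F by simp
    then show ?thesis by (simp add: base_diff_def add.assoc)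
  qed
  have mult: "F (y + 2 * of_nat n) r = F y r" for y r n
  proof (induction n)
    case (Suc n)
    have "F (y + 2 * of_nat (Suc n)) r = F (y + 2 * of_nat n + 2) r" by (simp add: algebra_simps)
    then show ?case by (simp add: step Suc)
  qed simp
  have "F z r = F y r" for y z r
  proof -
    obtain n where "(z - y) / 2 = of_nat n" using surj_of_nat_mod_ring by blast
    then have "z = y + 2 * of_nat n" using two_neq_zero[OF assms] by (simp add: field_simps)
    then show ?thesis by (simp add: mult)
  qed
  then show "base_free F" by (auto simp: base_free_def)
qed

lemma base_free_lin: "base_free F \<Longrightarrow> base_free G \<Longrightarrow> base_free (F + G)"
  "base_free F \<Longrightarrow> base_free G \<Longrightarrow> base_free (F - G)"
  "base_free F \<Longrightarrow> base_free (- F)"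
  "base_free F \<Longrightarrow> base_free (scale c F)" "base_free 0"
  "base_free F \<Longrightarrow> base_free (dsign F)" "base_free unit"
  "base_free F \<Longrightarrow> base_free (fix_last F x)"
  "base_free F \<Longrightarrow> base_free (reflect s F x)"
  unfolding base_free_def dsign_def unit_def fix_last_def reflect_def plus_fun_apply minus_apply uminus_apply
    zero_fun_apply scale_apply by metis+

lemma base_free_base_sum: "base_free (base_sum F)"
  by (simp add: base_free_def base_sum_def)

lemma zero_eta [simp]: "(\<lambda>y r. 0) = (0 :: ('a, 'k::zero) cochain)"
  by (auto simp: fun_eq_iff)

lemma base_free_cobd:
  assumes "odd CARD('p::prime_card)" "base_free (F :: 'p dcochain)" shows "base_free (cobd s F)"
  using assms by (simp add: base_free_iff_base_diff base_diff_cobd)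

lemma base_diff_base_sum: "base_diff (base_sum F) = 0"
  by (auto simp: base_diff_def base_sum_def)

lemma base_sum_base_diff: "base_sum (base_diff F) = 0"
  by (auto simp: base_diff_def base_sum_def fun_eq_iff sum_subtractf sum_shift(1)[of "\<lambda>u. F u _"] sum_shift(2)[of "\<lambda>u. F u _"])

lemma base_weight_base_diff:
  assumes "odd CARD('p::prime_card)"
  shows "base_weight (base_diff F) = base_sum (F :: 'p dcochain)"
proof (intro ext)
  fix y r
  have "base_weight (base_diff F) y r = (\<Sum>u\<in>UNIV. (y - u) / 2 * F (u + 1) r) - (\<Sum>u\<in>UNIV. (y - u) / 2 * F (u - 1) r)"
    by (simp add: base_weight_def base_diff_def sum_subtractf algebra_simps)
  also have "(\<Sum>u\<in>UNIV. (y - u) / 2 * F (u + 1) r) = (\<Sum>u\<in>UNIV. (y - (u - 1)) / 2 * F u r)"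
    using sum_shift(1)[of "\<lambda>u. (y - (u - 1)) / 2 * F u r" 1] by simp
  also have "(\<Sum>u\<in>UNIV. (y - u) / 2 * F (u - 1) r) = (\<Sum>u\<in>UNIV. (y - (u + 1)) / 2 * F u r)"
    using sum_shift(2)[of "\<lambda>u. (y - (u + 1)) / 2 * F u r" 1] by simp
  also have "(\<Sum>u\<in>UNIV. (y - (u - 1)) / 2 * F u r) - \<dots> = (\<Sum>u\<in>UNIV. F u r)"
    unfolding sum_subtractf[symmetric]
  proof (rule sum.cong)
    fix u
    have "(y - (u - 1)) / 2 - (y - (u + 1)) / 2 = 1"
      using two_neq_zero[OF assms] by (simp add: diff_divide_distrib[symmetric])
    then show "(y - (u - 1)) / 2 * F u r - (y - (u + 1)) / 2 * F u r = F u r"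
      by (simp only: left_diff_distrib[symmetric] mult_1)
  qed simp
  finally show "base_weight (base_diff F) y r = base_sum F y r" by (simp add: base_sum_def)
qed

lemma base_sum_base_delta: "base_free F \<Longrightarrow> base_sum (base_delta F) = F"
  unfolding base_sum_def base_delta_def base_free_def fun_eq_iff by simp

text \<open>
  A function with vanishing sum over the base point is summed up along the cycle \<open>0, 2, 4, \<dots>\<close>; the
  total being zero, the sum closes up after \<open>p\<close> steps.
\<close>

lemma base_diff_surj:
  assumes odd: "odd CARD('p::prime_card)" and F: "base_sum (F :: 'p dcochain) = 0"
  obtains G where "F = base_diff G"
proof -
  let ?N = "CARD('p)"
  have two: "(2 :: 'p mod_ring) \<noteq> 0" by (rule two_neq_zero[OF odd])
  have N0: "(of_nat ?N :: 'p mod_ring) = 0" by simp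
  \<comment> \<open>the number of the step at which the cycle \<open>0, 2, 4, \<dots>\<close> meets \<open>y\<close>\<close>
  define idx :: "'p mod_ring \<Rightarrow> nat" where "idx y = (THE i. i < ?N \<and> y = 2 * of_nat i)" for y
  have inj: "i = j" if "i < ?N" "j < ?N" "(of_nat i :: 'p mod_ring) = of_nat j" for i j
  proof -
    have *: "i = j" if "i < ?N" "j < ?N" "(of_nat i :: 'p mod_ring) = of_nat j" "i \<le> j" for i j
    proof -
      have "(of_nat (j - i) :: 'p mod_ring) = 0" using that by (simp add: of_nat_diff)
      then have "?N dvd j - i" by (rule of_nat_0_mod_ring_dvd)
      then show ?thesis using that by (auto dest: dvd_imp_le)
    qed
    show ?thesis using *[of i j] *[of j i] that by (cases "i \<le> j") auto
  qed
  have idx: "idx y < ?N \<and> y = 2 * of_nat (idx y)" for y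
    unfolding idx_def
  proof (rule theI')
    obtain i where "i < ?N" "y / 2 = of_nat i" using surj_of_nat_mod_ring by blast
    then show "\<exists>!i. i < ?N \<and> y = 2 * of_nat i"
      using two inj by (intro ex1I[of _ i]) (auto simp: field_simps)
  qed
  have idxI: "idx (2 * of_nat i) = i" if "i < ?N" for i
    using idx[of "2 * of_nat i"] two inj that by auto
  define G where "G y r = (\<Sum>i<idx y. F (2 * of_nat i + 1) r)" for y r
  have total: "(\<Sum>i<?N. F (2 * of_nat i + 1) r) = 0" for r
  proof -
    have "(\<Sum>i<?N. F (2 * of_nat i + 1) r) = (\<Sum>u\<in>UNIV. F (u + 1) r)"
      by (rule sum.reindex_bij_witness[where i = idx and j = "\<lambda>i. 2 * of_nat i"])
         (use idx idxI in auto)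
    also have "\<dots> = base_sum F 0 r" by (simp add: base_sum_def sum_shift(1)[of "\<lambda>u. F u r"])
    finally show ?thesis using F by simp
  qed
  have "base_diff G (2 * of_nat i + 1) r = F (2 * of_nat i + 1) r" if "i < ?N" for i r
  proof (cases "Suc i < ?N")
    case True
    have "2 * of_nat i + 1 + 1 = (2 * of_nat (Suc i) :: 'p mod_ring)" by simp
    then have "base_diff G (2 * of_nat i + 1) r = G (2 * of_nat (Suc i)) r - G (2 * of_nat i) r"
      by (simp only: base_diff_def add_diff_cancel_right')
    then show ?thesis
      unfolding G_def idxI[OF that] idxI[OF True] by simp
  next
    case False
    then have N: "?N = Suc i" using that by simp
    have "2 * of_nat i + 1 + 1 = (2 * of_nat ?N :: 'p mod_ring)" unfolding N by simp
    also have "\<dots> = 2 * of_nat 0" using N0 by simp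
    finally have "idx (2 * of_nat i + 1 + 1) = 0" using idxI[of 0] that by simp
    then have "base_diff G (2 * of_nat i + 1) r = - (\<Sum>j<i. F (2 * of_nat j + 1) r)"
      using that by (simp add: base_diff_def G_def idxI)
    also have "\<dots> = F (2 * of_nat i + 1) r"
      using total[of r] unfolding N by (simp add: add_eq_0_iff)
    finally show ?thesis .
  qed
  then have "base_diff G y r = F y r" for y r
    using idx[of "y - 1"] by (metis diff_add_cancel)
  then have "F = base_diff G" by (simp add: fun_eq_iff)
  then show ?thesis by (rule that)
qed

lemma odd_acyclic:
  assumes odd: "odd CARD('p::prime_card)" and F: "cobd (-1) (F :: 'p dcochain) = 0"
  shows "F = cobd (-1) (scale (- 1 / 2) (insert_base F))"
proof -
  have "scale 2 F = - cobd (-1) (insert_base F)" using insert_base_cobd[of "-1" F] F by (simp add: algebra_simps)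
  then have "scale (1 / 2) (scale 2 F) = scale (1 / 2) (- cobd (-1) (insert_base F))" by simp
  then show ?thesis using two_neq_zero[OF odd] by (simp add: scale_lin)
qed

section \<open>The complex of functions that do not depend on the base point\<close>

lemma cobd_base_free_snoc:
  assumes "odd CARD('p::prime_card)" "base_free (F :: 'p dcochain)"
  shows "cobd 1 F y (r @ [u]) = - cobd 1 (insert_base F) u r"
proof -
  have "cobd 1 F y (r @ [u]) = insert_base (cobd 1 F) u r"
    using base_free_cobd[OF assms, of 1] unfolding insert_base_def base_free_def by blast
  then show ?thesis by (simp add: insert_base_cobd)
qed

text \<open>
  Replacing the base point by the first letter of the word turns any primitive of a
  base-point-independent coboundary into a base-point-independent primitive.
\<close>

lemma base_free_exact:
  assumes odd: "odd CARD('p::prime_card)" and F: "base_free (F :: 'p dcochain)" "F = cobd 1 G"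
  obtains G' where "base_free G'" "F = cobd 1 G'"
proof
  let ?G = "\<lambda>y r. if r = [] then 0 else G (last r) r"
  show y: "base_free ?G" by (simp add: base_free_def)
  show "F = cobd 1 ?G"
  proof (intro ext)
    fix y r
    show "F y r = cobd 1 ?G y r"
    proof (cases r rule: rev_cases)
      case Nil then show ?thesis using F(2) by simp
    next
      case (snoc r' u)
      have "insert_base ?G = insert_base G" by (auto simp: insert_base_def)
      then have "cobd 1 ?G y r = - cobd 1 (insert_base G) u r'" by (simp add: snoc cobd_base_free_snoc[OF odd y])
      also have "\<dots> = insert_base F u r'" using F(2) by (simp add: insert_base_cobd)
      also have "\<dots> = F u r" by (simp add: insert_base_def snoc)
      also have "\<dots> = F y r" using F(1) unfolding base_free_def by blast
      finally show ?thesis by simp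
    qed
  qed
qed

text \<open>
  The operator \<open>P\<close>: the first letter, at the end of the reversed word, becomes the base point.
\<close>

definition drop_base :: "'p::prime_card dcochain \<Rightarrow> 'p dcochain" where
  "drop_base F = (\<lambda>y r. if r = [] then 0 else (-1) ^ (length r - 1) * F (last r) (butlast r))"

lemma drop_base_lin [simp]: "drop_base (F + G) = drop_base F + drop_base G"
  "drop_base (F - G) = drop_base F - drop_base G"
  "drop_base (- F) = - drop_base F" "drop_base 0 = 0" "drop_base (scale c F) = scale c (drop_base F)"
  by (auto simp: drop_base_def fun_eq_iff algebra_simps)

lemma base_free_drop_base: "base_free (drop_base F)"
  by (simp add: base_free_def drop_base_def)

lemma insert_base_drop_base: "insert_base (drop_base F) = dsign F"
  by (auto simp: insert_base_def drop_base_def dsign_def)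

lemma cobd_drop_base:
  assumes odd: "odd CARD('p::prime_card)"
  shows "cobd 1 (drop_base F) = drop_base (cobd 1 (F :: 'p dcochain))"
proof (intro ext)
  fix y r show "cobd 1 (drop_base F) y r = drop_base (cobd 1 F) y r"
  proof (cases r rule: rev_cases)
    case (snoc r' u)
    then show ?thesis
      by (simp add: cobd_base_free_snoc[OF odd base_free_drop_base] insert_base_drop_base) (simp add: drop_base_def dsign_def)
  qed (simp add: drop_base_def)
qed

lemma minus_one_power_cancel: "(-1) ^ n * ((-1) ^ n * x) = (x :: 'k::comm_ring_1)"
  by (cases "even n") auto

text \<open>
  A cochain of positive degree that does not depend on the base point is in the image of \<open>P\<close>: only
  the constant part of degree 0 is missed.
\<close>

lemma base_free_decomp:
  assumes "base_free F"
  shows "F = scale (F 0 []) unit + drop_base (dsign (insert_base F))"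
proof (intro ext)
  fix y r
  show "F y r = (scale (F 0 []) unit + drop_base (dsign (insert_base F))) y r"
  proof (cases r rule: rev_cases)
    case Nil
    have "F y [] = F 0 []" using assms unfolding base_free_def by blast
    then show ?thesis using Nil by (simp add: unit_def drop_base_def)
  next
    case (snoc r' u)
    have "F y r = F u r" using assms unfolding base_free_def by blast
    then show ?thesis using snoc
      by (simp add: unit_def drop_base_def dsign_def insert_base_def minus_one_power_cancel)
  qed
qed

text \<open>
  Summation over the base point vanishes on cohomology: it factors through \<open>base_diff\<close>, whose
  values lie in the acyclic complex.
\<close>

lemma base_sum_cocycle_exact:
  assumes odd: "odd CARD('p::prime_card)" and F: "cobd 1 (F :: 'p dcochain) = 0"
  obtains t where "base_free t" "base_sum F = cobd 1 t"
proof -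
  have "cobd (-1) (base_diff F) = 0" using base_diff_cobd[of 1 F] F by simp
  then obtain E where E: "base_diff F = cobd (-1) E" using odd_acyclic[OF odd] by blast
  have "base_sum F = cobd 1 (base_weight E)"
    using base_weight_base_diff[OF odd, of F] base_weight_cobd[of "-1" E] by (simp add: E)
  from base_free_exact[OF odd base_free_base_sum this] obtain t where "base_free t"
  "base_sum F = cobd 1 t" .
  then show ?thesis by (rule that)
qed

lemma cobd_unit [simp]: "cobd 1 unit = 0"
proof (intro ext)
  fix y r show "cobd 1 (unit :: 'a dcochain) y r = 0 y r"
  proof (cases r)
    case (Cons x r)
    have "fix_last unit x = (0 :: 'a dcochain)" by (intro ext) (simp add: fix_last_def unit_def)
    moreover have "unit y r = reflect 1 (unit :: 'a dcochain) x y r" by (simp add: reflect_def unit_def)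
    ultimately show ?thesis by (simp add: Cons)
  qed simp
qed

section \<open>The secondary operation\<close>

text \<open>
  The zigzag of the connecting map: \<open>E\<close> and \<open>G\<close> are cochains of the complex for \<open>s = -1\<close>.
\<close>

definition descent :: "'p::prime_card dcochain \<Rightarrow> 'p dcochain \<Rightarrow> 'p dcochain \<Rightarrow> bool" where
  "descent F E G \<longleftrightarrow> base_diff F = cobd (-1) E \<and> base_sum E = cobd (-1) G"

text \<open>
  \<open>base_diff G\<close> for the canonical zigzag given by the contraction of \<open>odd_acyclic\<close>. It is linear,
  defined on all cochains, and consumes the first two letters of a word.
\<close>

definition secondary :: "'p::prime_card dcochain \<Rightarrow> 'p dcochain" where
  "secondary F = base_diff (scale (- 1 / 2) (insert_base (base_sum (scale (- 1 / 2) (insert_base (base_diff F))))))"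

lemma descent_lin: "descent F E G \<Longrightarrow> descent F' E' G' \<Longrightarrow> descent (F + F') (E + E') (G + G')"
  "descent F E G \<Longrightarrow> descent F' E' G' \<Longrightarrow> descent (F - F') (E - E') (G - G')"
  by (auto simp: descent_def)

lemma descent_secondary:
  assumes odd: "odd CARD('p::prime_card)" and F: "cobd 1 (F :: 'p dcochain) = 0"
  obtains E G where "descent F E G" "secondary F = base_diff G"
proof
  let ?E = "scale (- 1 / 2) (insert_base (base_diff F))"
  let ?G = "scale (- 1 / 2) (insert_base (base_sum ?E))"
  have "cobd (-1) (base_diff F) = 0" using base_diff_cobd[of 1 F] F by simp
  from odd_acyclic[OF odd this] have E: "base_diff F = cobd (-1) ?E" .
  have "cobd (-1) (base_sum ?E) = 0" by (simp only: base_sum_cobd[symmetric] E[symmetric] base_sum_base_diff)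
  from odd_acyclic[OF odd this] E show "descent F ?E ?G" by (simp only: descent_def)
  show "secondary F = base_diff ?G" by (simp only: secondary_def)
qed

text \<open>
  The class of \<open>base_diff G\<close> depends only on the class of the cochain at the start of the zigzag.
\<close>

lemma descent_exact:
  assumes odd: "odd CARD('p::prime_card)" and d: "descent (cobd 1 v) E (G :: 'p dcochain)"
  obtains g where "base_diff G = cobd 1 (base_diff g)"
proof -
  have "cobd (-1) (E - base_diff v) = 0" using d by (simp add: descent_def base_diff_cobd)
  then obtain e where e: "E - base_diff v = cobd (-1) e" using odd_acyclic[OF odd] by blast
  have "base_sum (E - base_diff v) = base_sum E" by (simp add: base_sum_base_diff)
  then have "cobd (-1) (G - base_sum e) = 0" using d by (simp add: e descent_def base_sum_cobd)
  then obtain g where "G - base_sum e = cobd (-1) g" using odd_acyclic[OF odd] by blast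
  then have "base_diff (G - base_sum e) = base_diff (cobd (-1) g)" by simp
  then show ?thesis using that by (simp add: base_diff_base_sum base_diff_cobd)
qed

lemma descent_unique:
  assumes odd: "odd CARD('p::prime_card)" and "descent F E G" "descent (F :: 'p dcochain) E' G'"
  obtains g where "base_diff G - base_diff G' = cobd 1 g"
proof -
  have "descent (cobd 1 0) (E - E') (G - G')" using descent_lin(2)[OF assms(2,3)] by simp
  from descent_exact[OF odd this] show ?thesis using that by auto
qed

text \<open>
  Runs the zigzag backwards from \<open>x\<close>; the condition on the base sum is the only obstruction at the
  first step. The cochain \<open>base_delta\<close> inverts the base sum on functions without base point.
\<close>

lemma odd_lift:
  assumes odd: "odd CARD('p::prime_card)" and x: "cobd 1 (x :: 'p dcochain) = 0" "base_sum x = 0"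
  obtains F E G where "cobd 1 F = 0" "descent F E G" "base_diff G = x"
proof -
  obtain G where G: "x = base_diff G" using base_diff_surj[OF odd x(2)] by blast
  have "base_diff (cobd (-1) G) = 0" using x(1) by (simp add: base_diff_cobd G[symmetric])
  then have f: "base_free (cobd (-1) G)" by (simp add: base_free_iff_base_diff[OF odd])
  let ?E = "base_delta (cobd (-1) G)"
  have E: "base_sum ?E = cobd (-1) G" by (rule base_sum_base_delta[OF f])
  have "base_sum (cobd (-1) ?E) = 0" by (simp add: base_sum_cobd E)
  then obtain F where F: "cobd (-1) ?E = base_diff F" using base_diff_surj[OF odd] by metis
  have "base_diff (cobd 1 F) = 0" by (simp add: base_diff_cobd F[symmetric])
  then have "base_free (cobd 1 F)" by (simp add: base_free_iff_base_diff[OF odd])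
  then obtain b where b: "base_free b" "cobd 1 F = cobd 1 b" using base_free_exact[OF odd] by metis
  show ?thesis
  proof
    show "cobd 1 (F - b) = 0" by (simp add: b(2))
    have "base_diff b = 0" using b(1) by (simp add: base_free_iff_base_diff[OF odd])
    then show "descent (F - b) ?E G" by (simp add: descent_def F E)
    show "base_diff G = x" by (simp add: G)
  qed
qed

lemma secondary_surj:
  assumes odd: "odd CARD('p::prime_card)" and x: "cobd 1 (x :: 'p dcochain) = 0"
  obtains F g where "cobd 1 F = 0" "secondary F = x + cobd 1 g"
proof -
  obtain t where t: "base_free t" "base_sum x = cobd 1 t" using base_sum_cocycle_exact[OF odd x] by blast
  let ?x = "x - cobd 1 (base_delta t)"
  have "cobd 1 ?x = 0" "base_sum ?x = 0" using x by (simp_all add: base_sum_cobd base_sum_base_delta[OF t(1)] t(2))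
  then obtain F E G where F: "cobd 1 F = 0" "descent F E G"
    "base_diff G = ?x" using odd_lift[OF odd] by blast
  obtain E' G' where F': "descent F E' G'"
  "secondary F = base_diff G'" using descent_secondary[OF odd F(1)] by blast
  obtain g where "base_diff G' - base_diff G = cobd 1 g" using descent_unique[OF odd F'(1) F(2)] by blast
  then have "secondary F = x + cobd 1 (g - base_delta t)" using F(3) F'(2) by (simp add: algebra_simps)
  then show ?thesis using that F(1) by blast
qed

text \<open>
  The right end of the zigzag is a coboundary, but the cochain \<open>base_delta unit\<close> below it has base
  sum 1. By \<open>secondary_kernel_of_sum_zero\<close>, a base sum 0 would force \<open>B\<close> into the classes without
  base point.
\<close>

definition is_B :: "'p::prime_card dcochain \<Rightarrow> 'p dcochain \<Rightarrow> 'p dcochain \<Rightarrow> bool" where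
  "is_B B E G \<longleftrightarrow> cobd 1 B = 0 \<and> descent B E G \<and> base_diff G = cobd 1 (base_delta unit)"

lemma is_B_exists:
  assumes odd: "odd CARD('p::prime_card)"
  obtains B E G :: "'p::prime_card dcochain" where "is_B B E G"
proof -
  have "base_sum (cobd 1 (base_delta unit)) = (0 :: 'p dcochain)" by (simp add: base_sum_cobd base_sum_base_delta base_free_lin)
  from odd_lift[OF odd _ this] obtain F E G :: "'p dcochain"
    where "cobd 1 F = 0" "descent F E G" "base_diff G = cobd 1 (base_delta unit)" by auto
  then show ?thesis by (intro that) (auto simp: is_B_def)
qed

text \<open>
  Here all choices in the zigzag can be corrected in turn, from right to left, until \<open>base_diff\<close>
  vanishes on the corrected \<open>F\<close>.
\<close>

lemma secondary_kernel_of_sum_zero: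
  assumes odd: "odd CARD('p::prime_card)"
    and F: "descent (F :: 'p dcochain) E G" "base_diff G = cobd 1 u" "base_sum u = 0"
  obtains t v where "base_free t" "F = t + cobd 1 v"
proof -
  obtain u' where u': "u = base_diff u'" using base_diff_surj[OF odd F(3)] by blast
  let ?g = "G - cobd (-1) u'"
  have "base_diff ?g = 0" using F(2) by (simp add: base_diff_cobd u')
  then have g: "base_free ?g" by (simp add: base_free_iff_base_diff[OF odd])
  let ?E = "E - cobd (-1) (base_delta ?g)"
  have "base_sum ?E = 0" using F(1) by (simp only: base_sum_lin base_sum_cobd base_sum_base_delta[OF g]) (simp add: descent_def)
  then obtain v where v: "?E = base_diff v" using base_diff_surj[OF odd] by blast
  have "base_diff (F - cobd 1 v) = cobd (-1) E - cobd (-1) ?E" using F(1) by (simp only: v) (simp add: descent_def base_diff_cobd)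
  also have "\<dots> = 0" by simp
  finally have "base_free (F - cobd 1 v)" by (simp add: base_free_iff_base_diff[OF odd])
  then show ?thesis using that[of "F - cobd 1 v" v] by simp
qed

lemma base_shuf:
  assumes "base_free f"
  shows "base_diff (shuf 1 F f) = shuf 1 (base_diff F) f" "base_sum (shuf 1 F f) = shuf 1 (base_sum F) f"
proof -
  have "base_diff (shuf 1 F f) y r = shuf 1 (base_diff F) f y r \<and> base_sum (shuf 1 F f) y r = shuf 1 (base_sum F) f y r" for y r
    using assms
  proof (induction r arbitrary: F f)
    case Nil
    define c where "c = f 0 []"
    have "f u [] = c" for u using Nil unfolding base_free_def c_def by blast
    then show ?case by (simp add: base_diff_def base_sum_def left_diff_distrib sum_distrib_right)
  next
    case (Cons x r)
    have "base_diff (shuf 1 F f) y (x # r) = fix_last (base_diff (shuf 1 F f)) x y r"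
      "base_sum (shuf 1 F f) y (x # r) = fix_last (base_sum (shuf 1 F f)) x y r" by (simp_all add: fix_last_def)
    then show ?case
      using Cons(1)[of "reflect 1 f x" "fix_last F x"] Cons(1)[of "fix_last f x" "dsign F"] Cons(2)
      by (simp add: fix_last_base fix_last_shuf dsign_base base_free_lin)
  qed
  then show "base_diff (shuf 1 F f) = shuf 1 (base_diff F) f"
    "base_sum (shuf 1 F f) = shuf 1 (base_sum F) f" by (auto simp: fun_eq_iff)
qed

lemma unit_shuf: "shuf 1 unit f = f"
proof (intro ext)
  fix y r show "shuf 1 unit f y r = f y r"
  proof (induction r arbitrary: f)
    case (Cons x r)
    have "fix_last unit x = (0 :: 'a dcochain)" "dsign unit = (unit :: 'a dcochain)"
      by (intro ext, simp add: fix_last_def unit_def dsign_def)+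
    then show ?case by (simp add: Cons) (simp add: fix_last_def)
  qed (simp add: unit_def)
qed

lemma shuf_unit: "shuf 1 f unit = f"
proof (intro ext)
  fix y r show "shuf 1 f unit y r = f y r"
  proof (induction r arbitrary: f)
    case (Cons x r)
    have "fix_last unit x = (0 :: 'a dcochain)" "reflect 1 unit x = (unit :: 'a dcochain)"
      by (intro ext, simp add: fix_last_def unit_def reflect_def)+
    then show ?case by (simp add: Cons) (simp add: fix_last_def)
  qed (simp add: unit_def)
qed

lemma B_descent:
  fixes G :: "'p::prime_card dcochain"
  assumes B: "is_B B E G" and f: "base_free f" "cobd 1 f = 0"
  shows "descent (shuf 1 B f) (shuf 1 E (dsign f)) (shuf 1 G f)"
    "base_diff (shuf 1 G f) = cobd 1 (shuf 1 (base_delta unit) (dsign f))"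
    "base_sum (shuf 1 (base_delta unit) (dsign f)) = dsign f" "cobd 1 (shuf 1 B f) = 0"
proof -
  have s: "base_free (dsign f)" "cobd 1 (dsign f) = 0" using f by (simp_all add: base_free_lin)
  have l: "cobd t (shuf 1 H (dsign f)) = shuf 1 (cobd t H) f"
    "cobd t (shuf 1 H f) = shuf 1 (cobd t H) (dsign f)" for t H
    using cobd_shuf[of t 1 H "dsign f"] cobd_shuf[of t 1 H f] f s by simp_all
  show "descent (shuf 1 B f) (shuf 1 E (dsign f)) (shuf 1 G f)"
    "base_diff (shuf 1 G f) = cobd 1 (shuf 1 (base_delta unit) (dsign f))"
    using B by (simp_all add: is_B_def descent_def base_shuf[OF f(1)] base_shuf[OF s(1)] l)
  show "base_sum (shuf 1 (base_delta unit) (dsign f)) = dsign f"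
    by (simp add: base_shuf[OF s(1)] base_sum_base_delta base_free_lin unit_shuf)
  show "cobd 1 (shuf 1 B f) = 0" using B by (simp add: l is_B_def)
qed

text \<open>
  If \<open>secondary F = cobd 1 u\<close>, the base sum of \<open>u\<close> is a cocycle \<open>f\<close> up to sign. Subtracting
  \<open>B \<union> f\<close>, whose zigzag has the same base sum, reduces to the case of base sum zero.
\<close>

theorem secondary_kernel:
  assumes odd: "odd CARD('p::prime_card)" and B: "is_B B E0 (G0 :: 'p dcochain)"
    and F: "cobd 1 F = 0" "secondary F = cobd 1 u"
  obtains t f v where "base_free t" "base_free f" "cobd 1 t = 0" "cobd 1 f = 0"
    "F = t + shuf 1 B f + cobd 1 v"
proof -
  obtain E G where d: "descent F E G"
  "secondary F = base_diff G" using descent_secondary[OF odd F(1)] by blast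
  have G: "base_diff G = cobd 1 u" using d F by simp
  have "cobd 1 (base_sum u) = 0" by (simp add: base_sum_cobd[symmetric] G[symmetric] base_sum_base_diff)
  \<comment> \<open>the sign compensates the one in \<open>B_descent\<close>\<close>
  define f where "f = dsign (base_sum u)"
  have f: "base_free f" "cobd 1 f = 0" "dsign f = base_sum u"
    using \<open>cobd 1 (base_sum u) = 0\<close> by (simp_all add: f_def base_free_lin base_free_base_sum)
  note b = B_descent[OF B f(1,2)]
  obtain t v where t: "base_free t" "F - shuf 1 B f = t + cobd 1 v"
  proof (rule secondary_kernel_of_sum_zero[OF odd descent_lin(2)[OF d(1) b(1)]])
    show "base_diff (G - shuf 1 G0 f) = cobd 1 (u - shuf 1 (base_delta unit) (dsign f))" by (simp add: G b(2))
    show "base_sum (u - shuf 1 (base_delta unit) (dsign f)) = 0" by (simp only: base_sum_lin b(3)) (simp add: f(3))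
  qed
  have "t = F - shuf 1 B f - cobd 1 v" using t(2) by simp
  then have "cobd 1 t = 0" using F b(4) by simp
  then show ?thesis using that[OF t(1) f(1) _ f(2), of v] t(2) by (simp add: algebra_simps)
qed

text \<open>
  The zigzag of a coboundary \<open>t + B \<union> f\<close> ends in \<open>cobd 1\<close> of a difference. Comparing with the
  zigzag of \<open>B\<close> exhibits \<open>f\<close>, up to sign, as the base sum of a cocycle.
\<close>

theorem base_free_B_direct:
  assumes odd: "odd CARD('p::prime_card)" and B: "is_B B E0 (G0 :: 'p dcochain)"
    and f: "base_free t" "base_free f" "cobd 1 f = 0" "t + shuf 1 B f = cobd 1 v"
  obtains t' f' where "base_free t'" "base_free f'" "t = cobd 1 t'" "f = cobd 1 f'"
proof -
  note b = B_descent[OF B f(2,3)]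
  have "descent t 0 0" using f(1) by (simp add: descent_def base_free_iff_base_diff[OF odd])
  from descent_lin(1)[OF this b(1)] have "descent (cobd 1 v) (shuf 1 E0 (dsign f)) (shuf 1 G0 f)" by (simp add: f(4))
  from descent_exact[OF odd this] obtain g where "base_diff (shuf 1 G0 f) = cobd 1 (base_diff g)" .
  then have "cobd 1 (shuf 1 (base_delta unit) (dsign f) - base_diff g) = 0" by (simp add: b(2))
  from base_sum_cocycle_exact[OF odd this] obtain t0 where t0: "base_free t0" "dsign f = cobd 1 t0"
    by (auto simp: b(3) base_sum_base_diff)
  have "f = dsign (cobd 1 t0)" using t0(2) by (metis dsign_dsign)
  then have f': "f = cobd 1 (- dsign t0)" by simp
  have "shuf 1 B f = cobd 1 (shuf 1 B (- dsign t0))"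
    using cobd_shuf[of 1 1 B "- dsign t0"] B by (simp add: is_B_def f'[symmetric] del: cobd_lin cobd_dsign)
  moreover have "t = cobd 1 v - shuf 1 B f" using f(4) by (simp add: eq_diff_eq)
  ultimately have "t = cobd 1 (v - shuf 1 B (- dsign t0))" by (simp only: cobd_diff)
  from base_free_exact[OF odd f(1) this] obtain t' where "base_free t'" "t = cobd 1 t'" .
  then show ?thesis using that[of t' "- dsign t0"] t0(1) f' by (simp add: base_free_lin)
qed

section \<open>Homogeneous parts\<close>

definition homog :: "nat \<Rightarrow> ('a, 'k::zero) cochain \<Rightarrow> bool" where
  "homog n F \<longleftrightarrow> (\<forall>y r. length r \<noteq> n \<longrightarrow> F y r = 0)"

definition cut :: "nat \<Rightarrow> ('a, 'k::zero) cochain \<Rightarrow> ('a, 'k) cochain" where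
  "cut n F = (\<lambda>y r. if length r = n then F y r else 0)"

lemma homog_cut: "homog n (cut n F)"
  by (simp add: homog_def cut_def)

lemma cut_homog: "homog n F \<Longrightarrow> cut n F = F"
  by (auto simp: homog_def cut_def fun_eq_iff)

lemma homog_iff_cut: "homog n F \<longleftrightarrow> cut n F = F"
  using homog_cut[of n F] cut_homog[of n F] by metis

lemma homog_0 [simp]: "homog n 0"
  by (simp add: homog_def)

lemma homog_lin: "homog n F \<Longrightarrow> homog n G \<Longrightarrow> homog n (F + G)"
  "homog n F \<Longrightarrow> homog n G \<Longrightarrow> homog n (F - G)"
  "homog n F \<Longrightarrow> homog n (scale c F)" "homog n F \<Longrightarrow> homog n (- F)"
  for F G :: "('a, 'k::comm_ring_1) cochain"
  by (auto simp: homog_def)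

lemma cut_lin [simp]: "cut n (F + G) = cut n F + cut n G" "cut n (F - G) = cut n F - cut n G"
  "cut n (scale c F) = scale c (cut n F)" "cut n 0 = 0" for F G :: "('a, 'k::comm_ring_1) cochain"
  by (auto simp: cut_def fun_eq_iff)

lemma fix_last_cut: "fix_last (cut (Suc n) F) x = cut n (fix_last F x)" "fix_last (cut 0 F) x = 0"
  by (auto simp: cut_def fix_last_def fun_eq_iff)

lemma cobd_cut: "cobd s (cut n F) = cut (Suc n) (cobd s F)"
proof (intro ext)
  fix y r show "cobd s (cut n F) y r = cut (Suc n) (cobd s F) y r"
  proof (induction r arbitrary: F n)
    case (Cons x r)
    show ?case
    proof (cases n)
      case 0
      then show ?thesis
        unfolding \<open>n = 0\<close> cobd.simps fix_last_cut by (cases r) (simp_all add: cut_def reflect_def)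
    next
      case (Suc m)
      then show ?thesis by (auto simp: fix_last_cut Cons) (auto simp: cut_def reflect_def)
    qed
  qed (simp add: cut_def)
qed

lemma homog_cobd: "homog n F \<Longrightarrow> homog (Suc n) (cobd s F)"
  by (metis homog_iff_cut cobd_cut)

lemma base_cut: "base_diff (cut n F) = cut n (base_diff F)" "base_sum (cut n F) = cut n (base_sum F)"
  "insert_base (cut (Suc n) F) = cut n (insert_base F)"
  by (auto simp: base_diff_def base_sum_def insert_base_def cut_def fun_eq_iff)

lemma base_free_cut: "base_free F \<Longrightarrow> base_free (cut n F)"
  unfolding base_free_def cut_def by metis

lemma secondary_cut: "secondary (cut (Suc (Suc n)) F) = cut n (secondary F)"
  by (simp add: secondary_def base_cut flip: cut_lin)

lemma shuf_low:
  assumes "\<And>y r. length r < k \<Longrightarrow> F y r = 0" "length r < k"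
  shows "shuf s F G y r = 0"
  using assms
proof (induction r arbitrary: F G k)
  case (Cons x r)
  have "shuf s (fix_last F x) (reflect s G x) y r = 0"
    by (rule Cons(1)[of "k - 1"]) (use Cons(2,3) in \<open>auto simp: fix_last_def\<close>)
  moreover have "shuf s (dsign F) (fix_last G x) y r = 0"
    by (rule Cons(1)[of k]) (use Cons(2,3) in \<open>auto simp: dsign_def\<close>)
  ultimately show ?case by simp
qed auto

lemma homog_fix_last: "homog (Suc k) F \<Longrightarrow> homog k (fix_last F x)"
  by (auto simp: homog_def fix_last_def)

lemma homog_reflect: "homog k F \<Longrightarrow> homog k (reflect s F x)"
  by (auto simp: homog_def reflect_def)

lemma homog_dsign: "homog k F \<Longrightarrow> homog k (dsign F)"
  by (auto simp: homog_def dsign_def)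

lemma homog_shuf:
  assumes "homog k F" "homog m G"
  shows "homog (k + m) (shuf s F G)"
  unfolding homog_def
proof (intro allI impI)
  fix y :: 'a and r :: "'a list" assume "length r \<noteq> k + m"
  then show "shuf s F G y r = 0" using assms
  proof (induction r arbitrary: F G k m)
    case Nil
    then show ?case by (auto simp: homog_def)
  next
    case (Cons x r)
    have "shuf s (fix_last F x) (reflect s G x) y r = 0"
    proof (cases k)
      case 0
      then have "fix_last F x = 0" using Cons(3) by (intro ext) (simp add: homog_def fix_last_def)
      then show ?thesis by simp
    next
      case (Suc k')
      then show ?thesis
        using Cons(1)[of k' m "fix_last F x"
        "reflect s G x"] Cons(2-4) by (simp add: homog_fix_last homog_reflect)
    qed
    moreover have "shuf s (dsign F) (fix_last G x) y r = 0"
    proof (cases m)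
      case 0
      then have "fix_last G x = 0" using Cons(4) by (intro ext) (simp add: homog_def fix_last_def)
      then show ?thesis by simp
    next
      case (Suc m')
      then show ?thesis
        using Cons(1)[of k m' "dsign F"
        "fix_last G x"] Cons(2-4) by (simp add: homog_fix_last homog_dsign)
    qed
    ultimately show ?case by simp
  qed
qed

lemma is_B_homog_exists:
  assumes odd: "odd CARD('p::prime_card)"
  obtains B E G :: "'p::prime_card dcochain" where "is_B B E G" "homog 3 B"
proof -
  obtain B E G :: "'p dcochain" where B: "is_B B E G" using is_B_exists[OF odd] .
  have h: "cut 0 (base_delta unit) = (base_delta unit :: 'p dcochain)"
    by (intro ext) (simp add: cut_def base_delta_def unit_def)
  have dB: "cobd 1 B = 0" and dE: "base_diff B = cobd (-1) E" and dG: "base_sum E = cobd (-1) G"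
    and dh: "base_diff G = cobd 1 (base_delta unit)"
    using B unfolding is_B_def descent_def by blast+
  have "cobd 1 (cut 3 B) = 0" by (simp only: cobd_cut dB cut_lin)
  moreover have "base_diff (cut 3 B) = cobd (-1) (cut 2 E)"
    using cobd_cut[of "-1" 2 E] by (simp add: base_cut dE)
  moreover have "base_sum (cut 2 E) = cobd (-1) (cut 1 G)"
    using cobd_cut[of "-1" 1 G] by (simp add: base_cut dG numeral_2_eq_2)
  moreover have "base_diff (cut 1 G) = cobd 1 (base_delta unit)"
    using cobd_cut[of 1 0 "base_delta unit :: 'p dcochain"] by (simp only: base_cut dh h One_nat_def)
  ultimately have "is_B (cut 3 B) (cut 2 E) (cut 1 G)" unfolding is_B_def descent_def by blast
  then show ?thesis using that homog_cut by blast
qed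

section \<open>The shuffle product as a sum\<close>

text \<open>
  The base point after the action of the letters of the reversed word \<open>b\<close>, the first letter acting
  first.
\<close>

fun act :: "'a::comm_ring_1 \<Rightarrow> 'a list \<Rightarrow> 'a" where
  "act y [] = y"
| "act y (x # b) = 2 * x - act y b"

text \<open>
  The sum over all distributions of the letters of a word into a part \<open>b\<close> for the first and a part
  \<open>a\<close> for the second factor of a product. The letters of \<open>b\<close> act on earlier letters of \<open>a\<close>, and \<open>c\<close>
  is the shuffle sign.
\<close>

fun shuf_sum :: "'a::comm_ring_1 list \<Rightarrow> ('k::comm_ring_1 \<Rightarrow> 'a list \<Rightarrow> 'a list \<Rightarrow> 'k) \<Rightarrow> 'k" where
  "shuf_sum [] h = h 1 [] []"
| "shuf_sum (x # r) h = shuf_sum r (\<lambda>c b a. h c (x # b) (map (\<lambda>z. 2 * x - z) a) + h (c * (-1) ^ length b) b (x # a))"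

lemma shuf_sum_add: "shuf_sum r (\<lambda>c b a. h c b a + h' c b a) = shuf_sum r h + shuf_sum r h'"
  by (induction r arbitrary: h h') (auto simp: algebra_simps)

lemma shuf_shuf_sum: "shuf s F G y r = shuf_sum r (\<lambda>c b a. c * (F y b * (s ^ length b * G (act y b) a)))"
  by (induction r arbitrary: F G) (simp_all add: shuf_sum_add fix_last_def reflect_def dsign_def mult_ac)

lemma shuf_sum_zero: "shuf_sum r (\<lambda>c b a. 0) = 0"
  by (induction r) auto

lemma shuf_sum_sum: "shuf_sum r (\<lambda>c b a. \<Sum>u\<in>U. h u c b a) = (\<Sum>u\<in>U. shuf_sum r (h u))"
proof (cases "finite U")
  case True
  then show ?thesis by (induction U rule: finite_induct) (auto simp: shuf_sum_zero shuf_sum_add)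
qed (simp add: shuf_sum_zero)

text \<open>
  Splits off the first letter \<open>u\<close> of the word: put into \<open>b\<close> it passes all letters of \<open>a\<close>, put into
  \<open>a\<close> it is acted on by all letters of \<open>b\<close>.
\<close>

lemma shuf_sum_snoc:
  "shuf_sum (r @ [u]) h = shuf_sum r (\<lambda>c b a. h (c * (-1) ^ length a) (b @ [u]) a + h c b (a @ [act u b]))"
proof (induction r arbitrary: h)
  case (Cons x r)
  show ?case
    by (simp add: Cons) (simp add: algebra_simps)
qed simp

lemma act_snoc: "act y (b @ [v]) = act (2 * v - y) b"
  by (induction b) auto

lemma act_diff: "act (y + d) b = act y b + (-1) ^ length b * d"
  by (induction b) (auto simp: algebra_simps)

lemma sum_act:
  fixes b :: "'p::prime_card mod_ring list" and g :: "'p mod_ring \<Rightarrow> 'b::comm_monoid_add"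
  shows "(\<Sum>u\<in>UNIV. g (act u b)) = sum g UNIV"
proof (induction b arbitrary: g)
  case (Cons x b)
  have "(\<Sum>u\<in>UNIV. g (act u (x # b))) = (\<Sum>u\<in>UNIV. (\<lambda>v. g (2 * x - v)) (act u b))" by simp
  also have "\<dots> = (\<Sum>u\<in>UNIV. g (2 * x - u))" by (rule Cons)
  finally show ?case by (simp only: sum_shift(3))
qed simp

section \<open>Insertion of two adjacent letters\<close>

definition pair_ins :: "'p::prime_card mod_ring \<Rightarrow> 'p dcochain \<Rightarrow> 'p dcochain" where
  "pair_ins d F = (\<lambda>y r. \<Sum>u\<in>UNIV. F y (r @ [u + d, u]))"

definition pair_op :: "'p::prime_card dcochain \<Rightarrow> 'p dcochain" where
  "pair_op F = pair_ins 1 F + pair_ins (-1) F"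

text \<open>
  The antisymmetric companion of \<open>pair_op\<close>. It maps to the complex for \<open>s = -1\<close> and occurs only in
  the product formula.
\<close>

definition pair_alt :: "'p::prime_card dcochain \<Rightarrow> 'p dcochain" where
  "pair_alt F = pair_ins 1 F - pair_ins (-1) F"

definition base_diff2 :: "'p::prime_card dcochain \<Rightarrow> 'p dcochain" where
  "base_diff2 F = (\<lambda>y r. F (y + 2) r - F (y - 2) r)"

lemma pair_ins_lin [simp]: "pair_ins d (F + G) = pair_ins d F + pair_ins d G"
  "pair_ins d (F - G) = pair_ins d F - pair_ins d G"
  "pair_ins d (- F) = - pair_ins d F" "pair_ins d 0 = 0"
  "pair_ins d (scale c F) = scale c (pair_ins d F)"
  by (auto simp: pair_ins_def fun_eq_iff sum.distrib sum_subtractf sum_negf sum_distrib_left)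

lemma pair_op_lin [simp]: "pair_op (F + G) = pair_op F + pair_op G"
  "pair_op (F - G) = pair_op F - pair_op G"
  "pair_op (- F) = - pair_op F" "pair_op 0 = 0" "pair_op (scale c F) = scale c (pair_op F)"
  by (simp_all add: pair_op_def scale_lin)

text \<open>
  The chain \<open>\<Sum>u. (u, u + d)\<close> is a cycle: the four face sums cancel in pairs after a shift of \<open>u\<close>.
\<close>

lemma pair_ins_cycle: "pair_ins d (cobd s F) y [] = 0"
proof -
  have "pair_ins d (cobd s F) y [] = (\<Sum>u\<in>UNIV. (F y [u] - F y [u + d])
      + s * (F (2 * u - y) [u + d] - F (2 * (u + d) - y) [2 * (u + d) - u]))"
    unfolding pair_ins_def by (rule sum.cong) (auto simp: fix_last_def reflect_def algebra_simps)
  also have "\<dots> = ((\<Sum>u\<in>UNIV. F y [u]) - (\<Sum>u\<in>UNIV. F y [u + d]))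
      + s * ((\<Sum>u\<in>UNIV. F (2 * u - y) [u + d]) - (\<Sum>u\<in>UNIV. F (2 * (u + d) - y) [2 * (u + d) - u]))"
    by (simp only: sum.distrib sum_subtractf sum_distrib_left[symmetric])
  also have "(\<Sum>u\<in>UNIV. F y [u + d]) = (\<Sum>u\<in>UNIV. F y [u])"
    by (rule sum_shift(1)[of "\<lambda>u. F y [u]"])
  also have "(\<Sum>u\<in>UNIV. F (2 * (u + d) - y) [2 * (u + d) - u]) = (\<Sum>u\<in>UNIV. F (2 * u - y) [u + d])"
  proof -
    have "(\<Sum>u\<in>UNIV. F (2 * (u + d) - y) [2 * (u + d) - u]) = (\<Sum>u\<in>UNIV. F (2 * (u + d) - y) [(u + d) + d])"
      by (rule sum.cong) (auto simp: algebra_simps)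
    then show ?thesis using sum_shift(1)[of "\<lambda>u. F (2 * u - y) [u + d]" d] by simp
  qed
  finally show ?thesis by simp
qed

lemma pair_ins_reflect: "pair_ins d (reflect t F x) = reflect t (pair_ins (- d) F) x"
proof (intro ext)
  fix y r
  have "pair_ins d (reflect t F x) y r = (\<Sum>u\<in>UNIV. t * F (2 * x - y) (map (\<lambda>a. 2 * x - a) r @ [(2 * x - u) + - d, 2 * x - u]))"
    by (simp add: pair_ins_def reflect_def algebra_simps)
  also have "\<dots> = (\<Sum>u\<in>UNIV. t * F (2 * x - y) (map (\<lambda>a. 2 * x - a) r @ [u + - d, u]))"
    by (rule sum_shift(3)[of "\<lambda>u. t * F (2 * x - y) (map (\<lambda>a. 2 * x - a) r @ [u + - d, u])"])
  finally show "pair_ins d (reflect t F x) y r = reflect t (pair_ins (- d) F) x y r"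
    by (simp add: pair_ins_def reflect_def sum_distrib_left)
qed

lemma front_op_pair_op:
  shows "front_op 2 1 (\<lambda>y (g :: 'p::prime_card dcochain). pair_op g y [])"
    and "front_op 2 (-1) (\<lambda>y (g :: 'p dcochain). pair_alt g y [])"
proof -
  have l: "lin_form (\<lambda>g. pair_op g y [])"
    "lin_form (\<lambda>g. pair_alt g y [])" for y :: "'p mod_ring"
    by (simp_all add: lin_form_def pair_alt_def algebra_simps)
  have c: "pair_ins d g y [] = pair_ins d h y []" if "\<And>w l. length l = 2 \<Longrightarrow> g w l = h w l"
    for g h :: "'p dcochain" and y d using that by (simp add: pair_ins_def)
  have c2: "pair_op g y [] = pair_op h y []"
    "pair_alt g y [] = pair_alt h y []" if "\<forall>w l. length l = 2 \<longrightarrow> g w l = h w l"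
    for g h :: "'p dcochain" and y using that c[of g h] by (simp_all add: pair_op_def pair_alt_def)
  have e: "pair_op g (2 * x - y) [] = pair_op (reflect 1 g x) y []"
    "pair_alt g (2 * x - y) [] = - pair_alt (reflect 1 g x) y []"
    for g :: "'p dcochain" and x y
    by (simp_all add: pair_op_def pair_alt_def pair_ins_reflect) (simp_all add: reflect_def)
  show "front_op 2 1 (\<lambda>y (g :: 'p dcochain). pair_op g y [])"
    "front_op 2 (-1) (\<lambda>y (g :: 'p dcochain). pair_alt g y [])"
    using l c2 e unfolding front_op_def by auto
qed

lemma front_pair_op: "front (\<lambda>y g. pair_op g y []) F = pair_op F"
  "front (\<lambda>y g. pair_alt g y []) F = pair_alt F"
  by (auto simp: front_def pair_op_def pair_alt_def pair_ins_def fun_eq_iff)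

lemma pair_op_cobd: "pair_op (cobd s F) = cobd s (pair_op F)"
proof -
  have "pair_op (cobd s g) y [] = 0" for y and g :: "'a dcochain" by (simp add: pair_op_def pair_ins_cycle)
  with front_chain[OF front_op_pair_op(1), of s F] show ?thesis by (simp add: front_pair_op)
qed

lemma pair_alt_cobd: "pair_alt (cobd s F) = cobd (- s) (pair_alt F)"
proof -
  have "pair_alt (cobd s g) y [] = 0" for y and g :: "'a dcochain" by (simp add: pair_alt_def pair_ins_cycle)
  with front_chain[OF front_op_pair_op(2), of s F] show ?thesis by (simp add: front_pair_op)
qed

lemma base_diff2_cobd: "base_diff2 (cobd s F) = cobd (- s) (base_diff2 F)"
proof -
  let ?L = "\<lambda>y g. g (y + 2) [] - g (y - 2) [] :: 'a mod_ring"
  have "front_op 0 (-1) ?L"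
    by (auto simp: front_op_def lin_form_def reflect_def algebra_simps)
  from front_chain[OF this, of s F] show ?thesis
    by (simp add: front_def base_diff2_def)
qed

text \<open>
  Of the two inserted letters, both go to the first factor, both to the second, or one to each. In
  the first case they translate the base point of \<open>G\<close> by \<open>2 d\<close>, with a sign from the letters
  between; the two mixed cases cancel after a shift of the summation variable.
\<close>

lemma pair_ins_shuf:
  "pair_ins d (shuf 1 F G) y r = shuf_sum r (\<lambda>c b a.
     c * (pair_ins d F y b * G (act y b + (-1) ^ length b * (2 * d)) a)
     + c * (F y b * pair_ins ((-1) ^ length b * d) G (act y b) a))"
proof -
  let ?h = "\<lambda>c b a. c * (F y b * G (act y b) a)"
  have "shuf 1 F G y (r @ [u + d, u]) = shuf_sum r (\<lambda>c b a.
       c * (F y (b @ [u + d, u]) * G (act y b + (-1) ^ length b * (2 * d)) a)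
     + ?h (c * (-1) ^ length a) (b @ [u + d]) (a @ [act ((u + d) + d) b])
     - ?h (c * (-1) ^ length a) (b @ [u]) (a @ [act (u + d) b])
     + c * (F y b * G (act y b) (a @ [act u b + (-1) ^ length b * d, act u b])))" for u
  proof -
    have "shuf 1 F G y ((r @ [u + d]) @ [u]) = shuf_sum r (\<lambda>c b a.
       c * (F y (b @ [u + d, u]) * G (act y b + (-1) ^ length b * (2 * d)) a)
     + ?h (c * (-1) ^ length a) (b @ [u + d]) (a @ [act ((u + d) + d) b])
     - ?h (c * (-1) ^ length a) (b @ [u]) (a @ [act (u + d) b])
     + c * (F y b * G (act y b) (a @ [act u b + (-1) ^ length b * d, act u b])))"
      unfolding shuf_shuf_sum shuf_sum_snoc
    proof (intro arg_cong[where f = "shuf_sum r"] ext)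
      fix c :: "'a mod_ring" and b a :: "'a mod_ring list"
      have 1: "act y (b @ [u + d, u]) = act y b + (-1) ^ length b * (2 * d)"
        using act_snoc[of y "b @ [u + d]" u] act_snoc[of "2 * u - y" b "u + d"] act_diff[of y "2 * d" b]
        by (simp add: algebra_simps)
      have 2: "act u (b @ [u + d]) = act ((u + d) + d) b"
        using act_snoc[of u b "u + d"] by (simp add: algebra_simps)
      show "c * (- 1) ^ length a * (- 1) ^ length a * (F y ((b @ [u + d]) @ [u]) *
             (1 ^ length ((b @ [u + d]) @ [u]) * G (act y ((b @ [u + d]) @ [u])) a)) +
         c * (- 1) ^ length a * (F y (b @ [u + d]) * (1 ^ length (b @ [u + d]) *
            G (act y (b @ [u + d])) (a @ [act u (b @ [u + d])]))) +
         (c * (- 1) ^ length (a @ [act (u + d) b]) * (F y (b @ [u]) * (1 ^ length (b @ [u]) *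
            G (act y (b @ [u])) (a @ [act (u + d) b]))) +
          c * (F y b * (1 ^ length b * G (act y b) ((a @ [act (u + d) b]) @ [act u b])))) =
         c * (F y (b @ [u + d, u]) * G (act y b + (- 1) ^ length b * (2 * d)) a) +
         ?h (c * (- 1) ^ length a) (b @ [u + d]) (a @ [act (u + d + d) b]) -
         ?h (c * (- 1) ^ length a) (b @ [u]) (a @ [act (u + d) b]) +
         c * (F y b * G (act y b) (a @ [act u b + (- 1) ^ length b * d, act u b]))"
        using minus_one_power_cancel[of "length a" c]
        by (simp add: 1 2 act_diff[of u d b] mult_ac)
    qed
    then show ?thesis by simp
  qed
  then have "pair_ins d (shuf 1 F G) y r = shuf_sum r (\<lambda>c b a. \<Sum>u\<in>UNIV.
       c * (F y (b @ [u + d, u]) * G (act y b + (-1) ^ length b * (2 * d)) a)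
     + ?h (c * (-1) ^ length a) (b @ [u + d]) (a @ [act ((u + d) + d) b])
     - ?h (c * (-1) ^ length a) (b @ [u]) (a @ [act (u + d) b])
     + c * (F y b * G (act y b) (a @ [act u b + (-1) ^ length b * d, act u b])))"
    unfolding shuf_sum_sum by (simp add: pair_ins_def)
  also have "\<dots> = shuf_sum r (\<lambda>c b a.
     c * (pair_ins d F y b * G (act y b + (-1) ^ length b * (2 * d)) a)
     + c * (F y b * pair_ins ((-1) ^ length b * d) G (act y b) a))"
  proof (intro arg_cong[where f = "shuf_sum r"] ext)
    fix c :: "'a mod_ring" and b a :: "'a mod_ring list"
    have 1: "(\<Sum>u\<in>UNIV. ?h (c * (-1) ^ length a) (b @ [u + d]) (a @ [act ((u + d) + d) b]))
        = (\<Sum>u\<in>UNIV. ?h (c * (-1) ^ length a) (b @ [u]) (a @ [act (u + d) b]))"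
      by (rule sum_shift(1)[of "\<lambda>u. ?h (c * (-1) ^ length a) (b @ [u]) (a @ [act (u + d) b])"])
    have 2: "(\<Sum>u\<in>UNIV. G (act y b) (a @ [act u b + (-1) ^ length b * d, act u b]))
        = pair_ins ((-1) ^ length b * d) G (act y b) a"
      unfolding pair_ins_def by (rule sum_act)
    have 3: "(\<Sum>u\<in>UNIV. c * (F y (b @ [u + d, u]) * K)) = c * (pair_ins d F y b * K)" for K
      by (simp add: pair_ins_def sum_distrib_left sum_distrib_right)
    have 4: "(\<Sum>u\<in>UNIV. c * (F y b * g u)) = c * (F y b * sum g UNIV)"
      for g :: "'a mod_ring \<Rightarrow> 'a mod_ring"
      by (simp add: sum_distrib_left)
    show "(\<Sum>u\<in>UNIV.
       c * (F y (b @ [u + d, u]) * G (act y b + (-1) ^ length b * (2 * d)) a)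
     + ?h (c * (-1) ^ length a) (b @ [u + d]) (a @ [act ((u + d) + d) b])
     - ?h (c * (-1) ^ length a) (b @ [u]) (a @ [act (u + d) b])
     + c * (F y b * G (act y b) (a @ [act u b + (-1) ^ length b * d, act u b])))
     = c * (pair_ins d F y b * G (act y b + (-1) ^ length b * (2 * d)) a)
     + c * (F y b * pair_ins ((-1) ^ length b * d) G (act y b) a)"
      unfolding sum.distrib sum_subtractf 1 3 4 2 by simp
  qed
  finally show ?thesis .
qed

text \<open>
  Adding the previous formula for \<open>d = 1\<close> and \<open>d = -1\<close>, the translated values \<open>G (v + 2)\<close> and
  \<open>G (v - 2)\<close> are expressed by \<open>G v\<close>, a second difference and a first difference.
\<close>

lemma pair_op_shuf:
  assumes odd: "odd CARD('p::prime_card)"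
  shows "pair_op (shuf 1 F G) = shuf 1 (pair_op F) G + shuf 1 F (pair_op G)
    + shuf 1 (scale (1 / 2) (pair_op F)) (base_diff (base_diff G)) + shuf (-1) (scale (1 / 2) (pair_alt (F :: 'p dcochain))) (base_diff2 G)"
proof (intro ext)
  fix y r
  have two: "(2 :: 'p mod_ring) \<noteq> 0" by (rule two_neq_zero[OF odd])
  let ?R = "\<lambda>c b a. c * (pair_op F y b * (1 ^ length b * G (act y b) a))
     + c * (F y b * (1 ^ length b * pair_op G (act y b) a))
     + c * (scale (1 / 2) (pair_op F) y b * (1 ^ length b * base_diff (base_diff G) (act y b) a))
     + c * (scale (1 / 2) (pair_alt F) y b * ((-1) ^ length b * base_diff2 G (act y b) a))"
  have "pair_op (shuf 1 F G) y r = shuf_sum r (\<lambda>c b a.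
     (c * (pair_ins 1 F y b * G (act y b + (-1) ^ length b * (2 * 1)) a)
     + c * (F y b * pair_ins ((-1) ^ length b * 1) G (act y b) a))
     + (c * (pair_ins (-1) F y b * G (act y b + (-1) ^ length b * (2 * (-1))) a)
     + c * (F y b * pair_ins ((-1) ^ length b * (-1)) G (act y b) a)))"
    unfolding pair_op_def plus_fun_apply pair_ins_shuf shuf_sum_add ..
  also have "\<dots> = shuf_sum r ?R"
  proof (intro arg_cong[where f = "shuf_sum r"] ext)
    fix c :: "'p mod_ring" and b a :: "'p mod_ring list"
    define v where "v = act y b"
    define P M where "P = pair_ins 1 F y b" and "M = pair_ins (-1) F y b"
    have b2: "base_diff (base_diff G) v a = G (v + 2) a - 2 * G v a + G (v - 2) a"
      by (simp add: base_diff_def algebra_simps)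
    have h2: "1 / 2 * (P + M) + 1 / 2 * (P - M) = P" "1 / 2 * (P + M) - 1 / 2 * (P - M) = M"
      using two by (simp_all add: field_simps)
    \<comment> \<open>the sign of the translation by 2 depends on the parity of \<open>b\<close>, hence two versions\<close>
    have key: "P * g1 + M * g2 = (P + M) * g0 + (1 / 2 * (P + M)) * (g1 - 2 * g0 + g2)
        + (1 / 2 * (P - M)) * (g1 - g2)"
      "P * g2 + M * g1 = (P + M) * g0 + (1 / 2 * (P + M)) * (g1 - 2 * g0 + g2)
        - (1 / 2 * (P - M)) * (g1 - g2)" for g0 g1 g2
    proof -
      define S D where "S = 1 / 2 * (P + M)" and "D = 1 / 2 * (P - M)"
      have PM: "P = S + D" "M = S - D" using h2 by (simp_all add: S_def D_def)
      show "P * g1 + M * g2 = (P + M) * g0 + (1 / 2 * (P + M)) * (g1 - 2 * g0 + g2)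
        + (1 / 2 * (P - M)) * (g1 - g2)"
        unfolding S_def[symmetric] D_def[symmetric] unfolding PM by (simp add: algebra_simps)
      show "P * g2 + M * g1 = (P + M) * g0 + (1 / 2 * (P + M)) * (g1 - 2 * g0 + g2)
        - (1 / 2 * (P - M)) * (g1 - g2)"
        unfolding S_def[symmetric] D_def[symmetric] unfolding PM by (simp add: algebra_simps)
    qed
    have g: "pair_op G v a = pair_ins 1 G v a + pair_ins (-1) G v a" "pair_op F y b = P + M"
      "pair_alt F y b = P - M"
      "base_diff2 G v a = G (v + 2) a - G (v - 2) a"
      by (simp_all add: pair_op_def pair_alt_def P_def M_def base_diff2_def)
    show "(c * (pair_ins 1 F y b * G (act y b + (-1) ^ length b * (2 * 1)) a)
     + c * (F y b * pair_ins ((-1) ^ length b * 1) G (act y b) a))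
     + (c * (pair_ins (-1) F y b * G (act y b + (-1) ^ length b * (2 * (-1))) a)
     + c * (F y b * pair_ins ((-1) ^ length b * (-1)) G (act y b) a)) = ?R c b a"
    proof (cases "even (length b)")
      case True
      then show ?thesis
        using arg_cong[OF key(1)[of "G (v + 2) a" "G (v - 2) a" "G v a"], of "\<lambda>z. c * z"]
        by (simp add: v_def[symmetric] P_def[symmetric] M_def[symmetric] g b2 distrib_left)
    next
      case False
      then show ?thesis
        using arg_cong[OF key(2)[of "G (v - 2) a" "G (v + 2) a" "G v a"], of "\<lambda>z. c * z"]
        by (simp add: v_def[symmetric] P_def[symmetric] M_def[symmetric] g b2 distrib_left
            right_diff_distrib)
    qed
  qed
  finally show "pair_op (shuf 1 F G) y r = (shuf 1 (pair_op F) G + shuf 1 F (pair_op G)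
    + shuf 1 (scale (1 / 2) (pair_op F)) (base_diff (base_diff G)) + shuf (-1) (scale (1 / 2) (pair_alt F)) (base_diff2 G)) y r"
    unfolding plus_fun_apply shuf_shuf_sum shuf_sum_add .
qed

text \<open>
  The two error terms of \<open>pair_op_shuf\<close> contain differences of the cocycle \<open>G\<close>, which are cocycles
  of the acyclic complex and therefore coboundaries there.
\<close>

theorem pair_op_derivation:
  assumes odd: "odd CARD('p::prime_card)" and F: "cobd 1 (F :: 'p dcochain) = 0" and G: "cobd 1 G = 0"
  obtains v where "pair_op (shuf 1 F G) = shuf 1 (pair_op F) G + shuf 1 F (pair_op G) + cobd 1 v"
proof -
  have "cobd (-1) (base_diff G) = 0" "cobd (-1) (base_diff2 G) = 0" 
    using base_diff_cobd[of 1 G] base_diff2_cobd[of 1 G] G by (simp_all add: base_diff2_def)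
  then obtain E E2 where E: "base_diff G = cobd (-1) E" "base_diff2 G = cobd (-1) E2"
    using odd_acyclic[OF odd] by metis
  have 1: "shuf 1 (scale (1 / 2) (pair_op F)) (base_diff (base_diff G)) = cobd 1 (shuf 1 (scale (1 / 2) (pair_op F)) (base_diff E))"
  proof -
    have "base_diff (base_diff G) = cobd 1 (base_diff E)" by (simp add: E base_diff_cobd)
    moreover have "cobd 1 (scale (1 / 2) (pair_op F)) = 0" by (simp add: F flip: pair_op_cobd)
    ultimately show ?thesis using cobd_shuf[of 1 1 "scale (1 / 2) (pair_op F)" "base_diff E"] by simp
  qed
  have 2: "shuf (-1) (scale (1 / 2) (pair_alt F)) (base_diff2 G) = cobd 1 (shuf (-1) (scale (1 / 2) (pair_alt F)) E2)"
  proof -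
    have "cobd (-1) (scale (1 / 2) (pair_alt F)) = 0" using pair_alt_cobd[of 1 F] F by (simp add: pair_alt_def)
    then show ?thesis using cobd_shuf[of "-1" "-1" "scale (1 / 2) (pair_alt F)" E2] E by simp
  qed
  show ?thesis
    by (rule that[of "shuf 1 (scale (1 / 2) (pair_op F)) (base_diff E) + shuf (-1) (scale (1 / 2) (pair_alt F)) E2"])
       (simp only: pair_op_shuf[OF odd] 1 2 cobd_add add.assoc)
qed

section \<open>Linear forms vanishing on a common kernel\<close>

lemma lin_formD: "lin_form L \<Longrightarrow> L (g + h) = L g + L h"
  "lin_form L \<Longrightarrow> L (scale c g) = c * L g"
  "lin_form L \<Longrightarrow> L (g - h) = L g - L h" "lin_form L \<Longrightarrow> L 0 = 0"
proof -
  show add: "L (g + h) = L g + L h" and scale: "L (scale c g) = c * L g" if "lin_form L" for g h c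
    using that unfolding lin_form_def by blast+
  show "L 0 = 0" if "lin_form L" using scale[OF that, of 0 0] by simp
  show "L (g - h) = L g - L h" if "lin_form L"
  proof -
    have "L (g + scale (-1) h) = L g + (-1) * L h" using add[OF that] scale[OF that] by simp
    then show ?thesis by (simp add: scale_lin)
  qed
qed

text \<open>
  The space of all cochains is infinite-dimensional, but finitely many forms behave as in finite
  dimension: each form that is independent of the others is removed with a cochain on which only it
  is non-zero.
\<close>

lemma form_in_span:
  fixes f :: "('a, 'k::field) cochain \<Rightarrow> 'k"
  assumes "finite I" "lin_form f" "\<And>i. i \<in> I \<Longrightarrow> lin_form (g i)"
    and "\<And>h. (\<And>i. i \<in> I \<Longrightarrow> g i h = 0) \<Longrightarrow> f h = 0"
  shows "\<exists>c. \<forall>h. f h = (\<Sum>i\<in>I. c i * g i h)"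
  using assms
proof (induction I arbitrary: f rule: finite_induct)
  case (insert i I)
  show ?case
  proof (cases "\<exists>h0. g i h0 \<noteq> 0 \<and> (\<forall>j\<in>I. g j h0 = 0)")
    case True
    then obtain h0 where h0: "g i h0 \<noteq> 0"
      "\<And>j. j \<in> I \<Longrightarrow> g j h0 = 0" by blast
    \<comment> \<open>subtracting this multiple of \<open>g i\<close> makes \<open>f\<close> vanish on \<open>h0\<close>, where only \<open>g i\<close> is non-zero\<close>
    define k where "k = f h0 / g i h0"
    have li: "lin_form (g i)" using insert by simp
    have lf: "lin_form f" using insert by simp
    have "\<exists>c. \<forall>h. f h - k * g i h = (\<Sum>j\<in>I. c j * g j h)"
    proof (rule insert(3))
      show "lin_form (\<lambda>h. f h - k * g i h)"
        using li lf by (simp add: lin_form_def algebra_simps)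
      show "lin_form (g j)" if "j \<in> I" for j using insert that by simp
      show "f h - k * g i h = 0" if h: "\<And>j. j \<in> I \<Longrightarrow> g j h = 0" for h
      proof -
        let ?h = "h - scale (g i h / g i h0) h0"
        have "f ?h = 0"
        proof (rule insert(6))
          fix j assume j: "j \<in> insert i I"
          then have lj: "lin_form (g j)" using insert by simp
          have "g j ?h = g j h - g i h / g i h0 * g j h0"
            by (simp add: lin_formD[OF lj])
          then show "g j ?h = 0" using j h h0 by auto
        qed
        then show ?thesis by (simp add: lin_formD[OF lf] k_def)
      qed
    qed
    then obtain c where c: "\<And>h. f h - k * g i h = (\<Sum>j\<in>I. c j * g j h)" by blast
    have "f h = (\<Sum>j\<in>insert i I. (c(i := k)) j * g j h)" for h
    proof -
      have "(\<Sum>j\<in>I. (c(i := k)) j * g j h) = (\<Sum>j\<in>I. c j * g j h)"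
        by (rule sum.cong) (use insert(2) in auto)
      then show ?thesis using c[of h] insert(1,2) by (simp add: algebra_simps)
    qed
    then show ?thesis by blast
  next
    case False
    have "\<exists>c. \<forall>h. f h = (\<Sum>j\<in>I. c j * g j h)"
    proof (rule insert(3))
      show "f h = 0" if h: "\<And>j. j \<in> I \<Longrightarrow> g j h = 0" for h
        by (rule insert(6)) (use False h in auto)
    qed (use insert in auto)
    then obtain c where c: "\<And>h. f h = (\<Sum>j\<in>I. c j * g j h)" by blast
    have "f h = (\<Sum>j\<in>insert i I. (c(i := 0)) j * g j h)" for h
    proof -
      have "(\<Sum>j\<in>I. (c(i := 0)) j * g j h) = (\<Sum>j\<in>I. c j * g j h)"
        by (rule sum.cong) (use insert(2) in auto)
      then show ?thesis using c[of h] insert(1,2) by simp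
    qed
    then show ?thesis by blast
  qed
qed auto

section \<open>Equivariance of the secondary operation\<close>

lemma reflect_base: "base_diff (reflect t F x) = reflect (- t) (base_diff F) x"
  "base_sum (reflect t F x) = reflect t (base_sum F) x"
  "insert_base (reflect t F x) = reflect t (insert_base F) x"
proof -
  show "base_diff (reflect t F x) = reflect (- t) (base_diff F) x" by (auto simp: base_diff_def reflect_def fun_eq_iff algebra_simps)
  show "insert_base (reflect t F x) = reflect t (insert_base F) x" by (auto simp: insert_base_def reflect_def fun_eq_iff)
  show "base_sum (reflect t F x) = reflect t (base_sum F) x"
  proof (intro ext)
    fix y r
    show "base_sum (reflect t F x) y r = reflect t (base_sum F) x y r"
      using sum_shift(3)[of "\<lambda>u. t * F u (map (\<lambda>a. 2 * x - a) r)" "2 * x"]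
      by (simp add: base_sum_def reflect_def sum_distrib_left)
  qed
qed

lemma reflect_secondary: "secondary (reflect t F x) = reflect t (secondary F) x"
  unfolding secondary_def by (simp only: reflect_base reflect_lin(5)[symmetric] minus_minus)

lemma secondary_append: "secondary F y r = secondary (\<lambda>w l. F w (r @ l)) y []"
  by (simp add: secondary_def base_diff_def insert_base_def base_sum_def scale_def)

lemma secondary_lin: "secondary (F + G) = secondary F + secondary G"
  "secondary (scale c F) = scale c (secondary F)"
  by (simp_all add: secondary_def scale_lin mult_ac)

lemma degree0_const:
  assumes odd: "odd CARD('p::prime_card)" and "cobd 1 (F :: 'p dcochain) = 0"
  shows "F y [] = F y' []"
proof -
  have two: "(2 :: 'p mod_ring) \<noteq> 0" by (rule two_neq_zero[OF odd])
  have "cobd 1 F y [(y + y') / 2] = 0" using assms(2) by simp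
  then show ?thesis using two by (simp add: reflect_def)
qed

text \<open>
  A 2-cochain without base point is a function \<open>G\<close> of two letters. Put \<open>S j = (\<Sum>u. G u (u + j))\<close>.
  The cocycle condition makes \<open>S j - S (j - 1)\<close> independent of \<open>j\<close>, and \<open>S 0 = p * G 0 0 = 0\<close>, so
  \<open>S 1 + S (-1) = 0\<close>.
\<close>

lemma pair_op_base_free_degree2:
  assumes odd: "odd CARD('p::prime_card)" and t: "base_free (t :: 'p dcochain)" "cobd 1 t = 0"
  shows "pair_op t y [] = 0"
proof -
  have two: "(2 :: 'p mod_ring) \<noteq> 0" by (rule two_neq_zero[OF odd])
  define G where "G a b = t 0 [b, a]" for a b
  have tG: "t y [b, a] = G a b" for y a b using t(1) unfolding base_free_def G_def by blast
  \<comment> \<open>the cocycle condition on the word \<open>(u, v, c)\<close>\<close>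
  have id: "G u c - G (2 * v - u) c = G u v - G (2 * c - u) (2 * c - v)" for u v c
  proof -
    have "cobd 1 t 0 [c, v, u] = 0" using t(2) by simp
    then show ?thesis by (simp add: fix_last_def reflect_def tG algebra_simps)
  qed
  have diag: "G u u = G 0 0" for u
  proof -
    have "G u u = G (2 * (u / 2) - u) (2 * (u / 2) - u)" using id[of u "u / 2" u] by simp
    then show ?thesis using two by simp
  qed
  define S where "S j = (\<Sum>u\<in>UNIV. G u (u + j))" for j
  have step: "S j - S (j - 1) = S (1 / 2) - S (- (1 / 2))" for j
  proof -
    have "(\<Sum>u\<in>UNIV. G u (u + j) - G (u + 1) (u + j))
        = (\<Sum>u\<in>UNIV. G u (u + 1 / 2) - G (u + 2 * j) ((u + 2 * j) - 1 / 2))"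
    proof (rule sum.cong)
      fix u :: "'p mod_ring"
      have e: "2 * (u + 1 / 2) - u = u + 1" "2 * (u + j) - u = u + 2 * j"
        "2 * (u + j) - (u + 1 / 2) = (u + 2 * j) - 1 / 2"
        using two by (simp_all add: algebra_simps)
      show "G u (u + j) - G (u + 1) (u + j) = G u (u + 1 / 2) - G (u + 2 * j) ((u + 2 * j) - 1 / 2)"
        using id[of u "u + j" "u + 1 / 2"] unfolding e .
    qed simp
    moreover have "(\<Sum>u\<in>UNIV. G (u + 1) (u + j)) = S (j - 1)"
      using sum_shift(1)[of "\<lambda>u. G u (u + (j - 1))" 1] by (simp add: S_def algebra_simps)
    moreover have "(\<Sum>u\<in>UNIV. G (u + 2 * j) ((u + 2 * j) - 1 / 2)) = S (- (1 / 2))"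
      using sum_shift(1)[of "\<lambda>u. G u (u - 1 / 2)" "2 * j"] by (simp add: S_def)
    ultimately show ?thesis by (simp add: sum_subtractf S_def)
  qed
  have "S 0 = (\<Sum>u\<in>(UNIV :: 'p mod_ring set). G 0 0)"
    unfolding S_def add_0_right by (rule sum.cong[OF refl]) (rule diag)
  then have "S 0 = 0" using sum_const_zero[of "G 0 0"] by simp
  then have "S 1 = S (1 / 2) - S (- (1 / 2))" "- S (-1) = S (1 / 2) - S (- (1 / 2))"
    using step[of 1] step[of 0] by simp_all
  then have "S 1 = - S (-1)" by (simp only:)
  then have "S 1 + S (-1) = 0" by simp
  then show ?thesis by (simp add: pair_op_def pair_ins_def tG S_def)
qed

section \<open>Two-letter insertions are multiples of the secondary operation\<close>

lemma front_op_lin_form: "front_op m t L \<Longrightarrow> lin_form (L y)"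
  by (simp add: front_op_def)

text \<open>
  The form \<open>L 0\<close> vanishes wherever \<open>secondary\<close> and the coboundary vanish in degree 2, so it is \<open>k\<close>
  times \<open>secondary\<close> plus a form in the coboundary. Made equivariant, that form consumes three
  letters and is, by \<open>front_cobd\<close>, a homotopy between \<open>front L\<close> and \<open>k\<close> times the secondary
  operation.
\<close>

theorem front_op_multiple:
  assumes odd: "odd CARD('p::prime_card)" and L: "front_op 2 1 (L :: _ \<Rightarrow> 'p dcochain \<Rightarrow> _)"
    and van: "\<And>g. homog 2 g \<Longrightarrow> cobd 1 g = 0 \<Longrightarrow> secondary g = 0 \<Longrightarrow> L 0 g = 0"
  obtains k where "\<And>F. cobd 1 F = 0 \<Longrightarrow> \<exists>v. front L F = scale k (secondary F) + cobd 1 v"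
    and "\<And>g. cobd 1 g = 0 \<Longrightarrow> L 0 g = k * secondary g 0 []"
proof -
  have two: "(2 :: 'p mod_ring) \<noteq> 0" by (rule two_neq_zero[OF odd])
  have half: "2 * (z / 2) = (z :: 'p mod_ring)" for z using two by simp
  have linL: "lin_form (L y)" for y by (rule front_op_lin_form[OF L])
  have congL: "L y g = L y h" if "\<And>w l. length l = 2 \<Longrightarrow> g w l = h w l" for y g h
    using L that unfolding front_op_def by blast
  have eqvL: "L (2 * x - y) g = L y (reflect 1 g x)" for x y g
    using L unfolding front_op_def by simp
  \<comment> \<open>\<open>None\<close> stands for the secondary operation, \<open>Some (w, l)\<close> for the value of the coboundary at the
    symbol with base point \<open>w\<close> and reversed word \<open>l\<close>\<close>
  define I :: "('p mod_ring \<times> 'p mod_ring list) option set"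
    where "I = insert None (Some ` (UNIV \<times> {l. length l = 3}))"
  define g :: "_ \<Rightarrow> 'p dcochain \<Rightarrow> 'p mod_ring"
    where "g i h = (case i of None \<Rightarrow> secondary h 0 [] | Some (w, l) \<Rightarrow> cobd 1 h w l)" for i h
  have fin: "finite I"
    using finite_lists_length_eq[of "UNIV :: 'p mod_ring set" 3] by (simp add: I_def)
  have "\<exists>c. \<forall>h. L 0 h = (\<Sum>i\<in>I. c i * g i h)"
  proof (rule form_in_span[OF fin linL])
    show "lin_form (g i)" if "i \<in> I" for i
      by (cases i) (auto simp: lin_form_def g_def secondary_lin)
    fix h assume h: "\<And>i. i \<in> I \<Longrightarrow> g i h = 0"
    have d0: "cobd 1 h w l = 0" if "length l = 3" for w l
      using h[of "Some (w, l)"] that by (simp add: I_def g_def)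
    have p0: "secondary h 0 [] = 0" using h[of None] by (simp add: I_def g_def)
    let ?h = "cut 2 h"
    have dh: "cobd 1 ?h = 0"
    proof (intro ext)
      fix y r show "cobd 1 ?h y r = 0 y r"
        using d0[of r y] by (simp add: cobd_cut) (simp add: cut_def)
    qed
    have sec: "secondary ?h = cut 0 (secondary h)" using secondary_cut[of 0 h] by (simp add: numeral_2_eq_2)
    obtain E G where "descent ?h E G"
    "secondary ?h = base_diff G" using descent_secondary[OF odd dh] by blast
    then have "cobd 1 (secondary ?h) = base_diff (base_sum E)" by (simp add: descent_def base_diff_cobd)
    then have "cobd 1 (secondary ?h) = 0" by (simp add: base_diff_base_sum)
    then have const: "secondary ?h y [] = secondary ?h 0 []" for y by (rule degree0_const[OF odd])
    have "cut 0 (secondary h) 0 [] = 0" using p0 by (simp add: cut_def)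
    then have "secondary ?h y [] = 0" for y using const[of y] unfolding sec by simp
    then have "secondary ?h y r = 0" for y r
      unfolding sec by (cases "r = []") (simp, simp add: cut_def)
    then have "secondary ?h = 0" by (simp add: fun_eq_iff)
    from van[OF homog_cut dh this] have "L 0 ?h = 0" .
    moreover have "L 0 ?h = L 0 h" by (rule congL) (simp add: cut_def)
    ultimately show "L 0 h = 0" by simp
  qed
  then obtain c where c: "\<And>h. L 0 h = (\<Sum>i\<in>I. c i * g i h)" by blast
  define k where "k = c None"
  define M where "M h = (\<Sum>i\<in>UNIV \<times> {l. length l = 3}. c (Some i) * h (fst i) (snd i))" for h :: "'p dcochain"
  have L0: "L 0 h = k * secondary h 0 [] + M (cobd 1 h)" for h
  proof -
    have "L 0 h = c None * g None h + (\<Sum>i\<in>Some ` (UNIV \<times> {l. length l = 3}). c i * g i h)"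
      unfolding c I_def using fin by (subst sum.insert) (auto simp: I_def)
    also have "(\<Sum>i\<in>Some ` (UNIV \<times> {l. length l = 3}). c i * g i h) = M (cobd 1 h)"
      unfolding M_def by (subst sum.reindex) (auto simp: g_def intro!: sum.cong)
    finally show ?thesis by (simp add: k_def g_def)
  qed
  have linM: "M (g + h) = M g + M h" "M (scale a g) = a * M g" for g h a
    by (simp_all add: M_def distrib_left sum.distrib sum_distrib_left mult_ac)
  have congM: "M g = M h" if "\<And>w l. length l = 3 \<Longrightarrow> g w l = h w l" for g h
    unfolding M_def by (rule sum.cong) (use that in auto)
  \<comment> \<open>every \<open>y\<close> is the image of 0 under the reflection in \<open>y / 2\<close>; averaging over the reflection
    in 0, which fixes 0, makes the transported form equivariant\<close>
  define N where "N y h = 1 / 2 * (M (reflect 1 (reflect 1 h (y / 2)) 0) + M (reflect 1 h (y / 2)))" for y h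
  have N: "front_op 3 1 N"
    unfolding front_op_def
  proof (intro conjI allI impI)
    show "lin_form (N y)" for y
      by (simp add: lin_form_def N_def linM algebra_simps)
    show "N y g = N y h" if "\<forall>w l. length l = 3 \<longrightarrow> g w l = h w l" for y g h
    proof -
      have "M (reflect 1 (reflect 1 g (y / 2)) 0) = M (reflect 1 (reflect 1 h (y / 2)) 0)"
        "M (reflect 1 g (y / 2)) = M (reflect 1 h (y / 2))"
        by (rule congM; use that in \<open>simp add: reflect_def\<close>)+
      then show ?thesis by (simp add: N_def)
    qed
    show "N (2 * x - y) g = 1 * N y (reflect 1 g x)" for x y g
    proof -
      have 1: "reflect 1 (reflect 1 g ((2 * x - y) / 2)) 0 = reflect 1 (reflect 1 g x) (y / 2)"
        by (intro ext) (simp add: reflect_def o_def half algebra_simps del: times_divide_eq_right)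
      have 2: "reflect 1 g ((2 * x - y) / 2) = reflect 1 (reflect 1 (reflect 1 g x) (y / 2)) 0"
        by (intro ext) (simp add: reflect_def o_def half algebra_simps del: times_divide_eq_right)
      show ?thesis unfolding N_def 1 2 by (simp add: add.commute reflect_same)
    qed
  qed
  have Ny: "L y h = k * secondary h y [] + N y (cobd 1 h)" for y h
  proof -
    have two': "2 * (y / 2) = y" using two by simp
    have 1: "L 0 (reflect 1 h (y / 2)) = L y h" using eqvL[of "y / 2" 0 h] two' by simp
    have 2: "L 0 (reflect 1 (reflect 1 h (y / 2)) 0) = L y h" using eqvL[of 0 0 "reflect 1 h (y / 2)"] 1 by simp
    have 3: "secondary (reflect 1 h (y / 2)) 0 [] = secondary h y []"
      using two' by (simp add: reflect_secondary) (simp add: reflect_def)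
    have 4: "secondary (reflect 1 (reflect 1 h (y / 2)) 0) 0 [] = secondary h y []"
      using two' by (simp add: reflect_secondary) (simp add: reflect_def)
    have "2 * L y h = 2 * (k * secondary h y []) + 2 * N y (cobd 1 h)"
      using L0[of "reflect 1 h (y / 2)"] L0[of "reflect 1 (reflect 1 h (y / 2)) 0"] two
      unfolding 1 2 3 4 N_def reflect_cobd by simp
    then have "2 * L y h = 2 * (k * secondary h y [] + N y (cobd 1 h))" by (simp only: distrib_left)
    from this[unfolded mult_cancel_left] two show ?thesis by blast
  qed
  show ?thesis
  proof (rule that)
    fix F :: "'p dcochain" assume F: "cobd 1 F = 0"
    have N0: "N y 0 = 0" for y using front_op_lin_form[OF N] by (rule lin_formD(4))
    have "front L F = scale k (secondary F) + cobd 1 (front N F)"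
    proof (intro ext)
      fix y r
      have "N y (cobd 1 (\<lambda>w l. F w (r @ l))) = cobd 1 (front N F) y r"
        using front_cobd[OF N, of 1 F y r] by (simp add: F front_def N0)
      then show "front L F y r = (scale k (secondary F) + cobd 1 (front N F)) y r"
        using Ny[of y "\<lambda>w l. F w (r @ l)"] by (simp add: front_def secondary_append[of F y r])
    qed
    then show "\<exists>v. front L F = scale k (secondary F) + cobd 1 v" by blast
  next
    fix h :: "'p dcochain" assume h: "cobd 1 h = 0"
    have "M 0 = 0" by (simp add: M_def)
    then show "L 0 h = k * secondary h 0 []" using L0[of h] h by simp
  qed
qed

text \<open>
  A product with \<open>B\<close> starts in degree 3, so in degree 2 only the part without base point survives.
\<close>

lemma kernel_degree2:
  assumes odd: "odd CARD('p::prime_card)" and g: "homog 2 (g :: 'p dcochain)" "cobd 1 g = 0"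
    "secondary g = 0"
  obtains t v where "base_free t" "cobd 1 t = 0"
    "\<And>y r. length r = 2 \<Longrightarrow> g y r = t y r + cobd 1 v y r"
proof -
  obtain B E G :: "'p dcochain" where B: "is_B B E G" "homog 3 B" using is_B_homog_exists[OF odd] .
  have "secondary g = cobd 1 0" using g(3) by simp
  from secondary_kernel[OF odd B(1) g(2) this] obtain t f v where
    t: "base_free t" "cobd 1 t = 0" "g = t + shuf 1 B f + cobd 1 v" .
  have "shuf 1 B f y r = 0" if "length r = 2" for y r
    by (rule shuf_low[of 3]) (use B(2) that in \<open>auto simp: homog_def\<close>)
  then show ?thesis using t by (intro that[of t v]) auto
qed

lemma pair_op_multiple:
  assumes odd: "odd CARD('p::prime_card)"
  obtains k where "\<And>F :: 'p dcochain. cobd 1 F = 0 \<Longrightarrow> \<exists>v. pair_op F = scale k (secondary F) + cobd 1 v"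
    and "\<And>g :: 'p dcochain. cobd 1 g = 0 \<Longrightarrow> pair_op g 0 [] = k * secondary g 0 []"
proof (rule front_op_multiple[OF odd front_op_pair_op(1)])
  fix g :: "'p dcochain" assume "homog 2 g" "cobd 1 g = 0" "secondary g = 0"
  then obtain t v where t: "base_free t" "cobd 1 t = 0"
    "\<And>y r. length r = 2 \<Longrightarrow> g y r = t y r + cobd 1 v y r" using kernel_degree2[OF odd] by blast
  have "pair_op g 0 [] = pair_op (t + cobd 1 v) 0 []" using t(3) by (simp add: pair_op_def pair_ins_def)
  also have "\<dots> = 0" using pair_op_base_free_degree2[OF odd t(1,2)] by (simp add: pair_op_cobd)
  finally show "pair_op g 0 [] = 0" .
qed (use that in \<open>auto simp: front_pair_op\<close>)

section \<open>The Mochizuki cocycle\<close>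

text \<open>
  The carry of \<open>a + (2 b - a) = 2 b\<close> for representatives in \<open>{0..<p}\<close>; the division is exact
  (\<open>carry_mult\<close>).
\<close>

definition carry :: "'p::prime_card mod_ring \<Rightarrow> 'p mod_ring \<Rightarrow> int" where
  "carry a b = (to_int_mod_ring a + to_int_mod_ring (2 * b - a) - 2 * to_int_mod_ring b) div int CARD('p)"

lemma of_int_to_int: "of_int (to_int_mod_ring a) = (a :: 'p::prime_card mod_ring)"
  by (simp add: of_int_of_int_mod_ring)

lemma carry_mult:
  "int CARD('p) * carry a b
    = to_int_mod_ring a + to_int_mod_ring (2 * b - a) - 2 * to_int_mod_ring (b :: 'p::prime_card mod_ring)"
proof -
  let ?x = "to_int_mod_ring a + to_int_mod_ring (2 * b - a) - 2 * to_int_mod_ring b"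
  have "of_int ?x = (0 :: 'p mod_ring)" by (simp add: of_int_to_int)
  from this[unfolded of_int_eq_0_iff_char_dvd semiring_char_mod_ring] have "int CARD('p) dvd ?x" .
  then show ?thesis by (simp add: carry_def)
qed

lemma carry_cocycle:
  "2 * carry v c = carry u c + carry (2 * v - u) c - carry u v - carry (2 * c - u) (2 * c - (v :: 'p::prime_card mod_ring))"
proof -
  have e: "2 * (2 * c - v) - (2 * c - u) = 2 * c - (2 * v - u)" by (simp add: algebra_simps)
  have "int CARD('p) * (2 * carry v c) = int CARD('p) * (carry u c + carry (2 * v - u) c - carry u v - carry (2 * c - u) (2 * c - v))"
    using carry_mult[of v c] carry_mult[of u c] carry_mult[of "2 * v - u" c] carry_mult[of u v]
      carry_mult[of "2 * c - u" "2 * c - v"]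
    unfolding e by (simp add: algebra_simps)
  then show ?thesis by simp
qed

lemma carry_sym: "carry (2 * b - a) b = carry a b"
  by (simp add: carry_def add.commute)

definition mochizuki :: "'p::prime_card dcochain" where
  "mochizuki y r = (if length r = 2 then (r ! 1 - y) * of_int (carry (r ! 1) (r ! 0)) else 0)"

lemma mochizuki_simps: "mochizuki y [b, a] = (a - y) * of_int (carry a b)"
  "length r \<noteq> 2 \<Longrightarrow> mochizuki y r = 0"
  by (simp_all add: mochizuki_def)

lemma homog_mochizuki: "homog 2 mochizuki"
  by (simp add: homog_def mochizuki_simps)

lemma cobd_mochizuki: "cobd 1 (mochizuki :: 'p::prime_card dcochain) = 0"
proof (intro ext)
  fix y :: "'p mod_ring" and r
  show "cobd 1 mochizuki y r = 0 y r"
  proof (cases "length r = 3")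
    case False
    have "homog (Suc 2) (cobd 1 (mochizuki :: 'p dcochain))" by (rule homog_cobd[OF homog_mochizuki])
    then show ?thesis using False by (simp add: homog_def)
  next
    case True
    then obtain c v u where r: "r = [c, v, u]" by (auto simp: numeral_3_eq_3 length_Suc_conv)
    have k: "of_int (carry u c) + of_int (carry (2 * v - u) c) - of_int (carry u v)
        - of_int (carry (2 * c - u) (2 * c - v)) = 2 * (of_int (carry v c) :: 'p mod_ring)"
      using arg_cong[OF carry_cocycle[of v c u], of "of_int :: int \<Rightarrow> 'p mod_ring"] by simp
    have "cobd 1 mochizuki y r = - (mochizuki y [c, v] - mochizuki (2 * u - y) [c, v])
        + (mochizuki y [c, u] - mochizuki (2 * v - y) [c, 2 * v - u])
        - (mochizuki y [v, u] - mochizuki (2 * c - y) [2 * c - v, 2 * c - u])"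
      by (simp add: r fix_last_def reflect_def)
    also have "\<dots> = (u - y) * ((of_int (carry u c) + of_int (carry (2 * v - u) c) - of_int (carry u v)
        - of_int (carry (2 * c - u) (2 * c - v))) - 2 * of_int (carry v c))"
      by (simp add: mochizuki_simps algebra_simps)
    finally show ?thesis unfolding k by simp
  qed
qed

text \<open>
  The representatives \<open>u, u + 1, u + 2\<close> form an arithmetic progression unless they wrap around
  modulo \<open>p\<close>.
\<close>

lemma carry_next:
  assumes odd: "odd CARD('p::prime_card)"
  shows "carry u (u + 1) = (if u = - 2 then - 1 else if u = (- 1 :: 'p mod_ring) then 1 else 0)"
proof -
  let ?p = "CARD('p)"
  have p3: "?p \<ge> 3"
  proof -
    have "?p > 1" using prime_card[where 'a = 'p] prime_gt_1_nat by blast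
    moreover have "?p \<noteq> 2" using odd by auto
    ultimately show ?thesis by simp
  qed
  have N0: "(of_nat ?p :: 'p mod_ring) = 0" by simp
  have ti: "to_int_mod_ring (of_nat n :: 'p mod_ring) = int n" if "n < ?p" for n
    using to_int_mod_ring_of_int_mod_ring[of "int n", where 'a = 'p] that
    by (simp add: of_int_of_int_mod_ring[symmetric])
  obtain n where n: "n < ?p" "u = of_nat n" using surj_of_nat_mod_ring by blast
  have inj: "n = m" if "(of_nat n :: 'p mod_ring) = of_nat m" "m < ?p" for m
    using ti[OF n(1)] ti[OF that(2)] unfolding that(1) by linarith
  have m2: "(- 2 :: 'p mod_ring) = of_nat (?p - 2)" "(- 1 :: 'p mod_ring) = of_nat (?p - 1)"
  proof -
    have "(of_nat (?p - 2) :: 'p mod_ring) = of_nat ?p - of_nat 2" by (rule of_nat_diff) (use p3 in simp)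
    then show "(- 2 :: 'p mod_ring) = of_nat (?p - 2)" unfolding N0 by simp
    have "(of_nat (?p - 1) :: 'p mod_ring) = of_nat ?p - of_nat 1" by (rule of_nat_diff) (use p3 in simp)
    then show "(- 1 :: 'p mod_ring) = of_nat (?p - 1)" unfolding N0 by simp
  qed
  have u1: "u + 1 = of_nat (n + 1)" "2 * (u + 1) - u = of_nat (n + 2)" using n by simp_all
  consider "n + 2 < ?p" | "n = ?p - 2" | "n = ?p - 1" using n(1) by linarith
  moreover have t0: "to_int_mod_ring u = int n" using ti[OF n(1)] n(2) by (simp only:)
  ultimately show ?thesis
  proof cases
    case 1
    have t1: "to_int_mod_ring (u + 1) = int (n + 1)" unfolding u1(1) by (rule ti) (use 1 in simp)
    have t2: "to_int_mod_ring (2 * (u + 1) - u) = int (n + 2)" unfolding u1(2) by (rule ti) (use 1 in simp)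
    have "carry u (u + 1) = 0" unfolding carry_def t0 t1 t2 by simp
    moreover have "u \<noteq> - 2"
    "u \<noteq> - 1" using inj[of "?p - 2"] inj[of "?p - 1"] 1 p3 n unfolding m2 by auto
    ultimately show ?thesis by simp
  next
    case 2
    have t1: "to_int_mod_ring (u + 1) = int (n + 1)"
      unfolding u1(1) by (rule ti) (use 2 p3 in simp)
    have "n + 2 = ?p" using 2 p3 by simp
    then have "2 * (u + 1) - u = of_nat 0" unfolding u1(2) using N0 by simp
    then have t2: "to_int_mod_ring (2 * (u + 1) - u) = 0" using ti[of 0] p3 by simp
    have "int n + 0 - 2 * int (n + 1) = - int ?p" using \<open>n + 2 = ?p\<close> by simp
    moreover have "- int ?p div int ?p = - 1" using p3 by (simp add: dvd_neg_div)
    ultimately have "carry u (u + 1) = - 1" unfolding carry_def t0 t1 t2 by (simp only:)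
    moreover have "u = - 2" using 2 m2 n by simp
    ultimately show ?thesis by simp
  next
    case 3
    have N: "n + 1 = ?p" using 3 p3 by simp
    then have "u + 1 = of_nat 0" unfolding u1(1) using N0 by simp
    then have t1: "to_int_mod_ring (u + 1) = 0" using ti[of 0] p3 by simp
    have "2 * (u + 1) - u = of_nat ((n + 1) + 1)" unfolding u1(2) by simp
    also have "\<dots> = of_nat 1" unfolding N using N0 by simp
    finally have t2: "to_int_mod_ring (2 * (u + 1) - u) = 1" using ti[of 1] p3 by simp
    have "int n + 1 - 2 * 0 = int ?p" using N by simp
    then have "carry u (u + 1) = 1" unfolding carry_def t0 t1 t2 by simp
    moreover have "u = - 1" "u \<noteq> - 2" using 3 m2 n inj[of "?p - 2"] p3 unfolding m2 by auto
    ultimately show ?thesis by simp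
  qed
qed

text \<open>
  All carries vanish except those at the two places where the representatives wrap around. This
  value is what makes the derivation non-zero.
\<close>

lemma pair_op_mochizuki:
  assumes odd: "odd CARD('p::prime_card)"
  shows "pair_op mochizuki 0 [] = (2 :: 'p mod_ring)"
proof -
  define K where "K u = (of_int (carry u (u + 1)) :: 'p mod_ring)" for u :: "'p mod_ring"
  have ne: "(- 2 :: 'p mod_ring) \<noteq> - 1"
  proof
    assume "(- 2 :: 'p mod_ring) = - 1"
    then have "(2 :: 'p mod_ring) = 1" by simp
    moreover have "(1 :: 'p mod_ring) = 2 - 1" by simp
    ultimately have "(1 :: 'p mod_ring) = 1 - 1" by (simp only:)
    then show False by simp
  qed
  have K: "K u = (if u = - 2 then - 1 else 0) + (if u = - 1 then 1 else 0)" for u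
    unfolding K_def carry_next[OF odd] using ne by auto
  have 1: "(\<Sum>u\<in>UNIV. K u) = 0"
    unfolding K sum.distrib by (simp add: sum.delta)
  have 2: "(\<Sum>u\<in>UNIV. u * K u) = 1"
  proof -
    have "(\<Sum>u\<in>UNIV. u * K u) = (\<Sum>u\<in>(UNIV :: 'p mod_ring set). (if u = - 2 then 2 else 0) + (if u = - 1 then - 1 else 0))"
      by (rule sum.cong) (auto simp: K)
    then show ?thesis unfolding sum.distrib by (simp add: sum.delta)
  qed
  have 3: "(\<Sum>u\<in>UNIV. u * of_int (carry u (u - 1))) = (\<Sum>u\<in>UNIV. (u + 2) * K u)"
  proof -
    have "carry u (u - 1) = carry (u - 2) ((u - 2) + 1)" for u :: "'p mod_ring"
      using carry_sym[of "u - 1" u] by (simp add: algebra_simps)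
    then have "(\<Sum>u\<in>UNIV. u * of_int (carry u (u - 1))) = (\<Sum>u\<in>UNIV. ((u - 2) + 2) * K (u - 2))"
      by (simp add: K_def)
    also have "\<dots> = (\<Sum>u\<in>UNIV. (u + 2) * K u)" by (rule sum_shift(2)[of "\<lambda>u. (u + 2) * K u"])
    finally show ?thesis .
  qed
  have "pair_op mochizuki 0 [] = (\<Sum>u\<in>UNIV. u * K u) + (\<Sum>u\<in>UNIV. u * of_int (carry u (u - 1)))"
    by (simp add: pair_op_def pair_ins_def mochizuki_simps K_def)
  also have "\<dots> = 2" unfolding 3 using 1 2 by (simp add: distrib_right sum.distrib sum_distrib_left[symmetric])
  finally show ?thesis .
qed

section \<open>A projection that annihilates the image of P\<close>

text \<open>
  The part of \<open>F\<close>, with last letter \<open>x\<close>, that changes sign under the reflection of all other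
  arguments in \<open>x\<close>.
\<close>

definition antisym :: "'p::prime_card dcochain \<Rightarrow> 'p mod_ring \<Rightarrow> 'p dcochain" where
  "antisym F x = scale (1 / 2) (fix_last F x - reflect 1 (fix_last F x) x)"

fun proj :: "'p::prime_card dcochain \<Rightarrow> 'p dcochain" where
  "proj F y [] = F y []"
| "proj F y (x # r) = proj (antisym F x) y r"

lemma antisym_lin [simp]: "antisym (F + G) x = antisym F x + antisym G x"
  "antisym (F - G) x = antisym F x - antisym G x"
  "antisym (- F) x = - antisym F x" "antisym 0 x = 0" "antisym (scale c F) x = scale c (antisym F x)"
  by (simp_all add: antisym_def scale_lin mult.commute)

lemma proj_add: "proj (F + G) = proj F + proj G"
proof (intro ext)
  fix y r show "proj (F + G) y r = (proj F + proj G) y r" by (induction r arbitrary: F G) auto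
qed

lemma proj_scale: "proj (scale c F) = scale c (proj F)"
proof (intro ext)
  fix y r show "proj (scale c F) y r = (scale c (proj F)) y r" by (induction r arbitrary: F) auto
qed

lemma proj_uminus: "proj (- F) = - proj F"
  using proj_scale[of "-1" F] by (simp add: scale_lin)

lemma proj_diff: "proj (F - G) = proj F - proj G"
  using proj_add[of F "- G"] by (simp add: proj_uminus)

lemma proj_zero: "proj 0 = 0"
  using proj_scale[of 0 0] by simp

lemmas proj_lin [simp] = proj_add proj_scale proj_uminus proj_diff proj_zero

lemma fix_last_proj: "fix_last (proj F) x = proj (antisym F x)"
  by (simp add: fix_last_def)

lemma antisym_reflect: "antisym (reflect 1 F x) a = reflect 1 (antisym F (2 * x - a)) x"
  using reflect_reflect[of 1 1 "fix_last F (2 * x - a)" x a] by (simp add: antisym_def fix_last_reflect)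

lemma proj_reflect: "proj (reflect 1 F x) = reflect 1 (proj F) x"
proof (intro ext)
  fix y r show "proj (reflect 1 F x) y r = reflect 1 (proj F) x y r"
  proof (induction r arbitrary: F)
    case (Cons a r)
    have "proj (reflect 1 F x) y (a # r) = reflect 1 (proj (antisym F (2 * x - a))) x y r"
      by (simp add: antisym_reflect Cons)
    then show ?case by (simp add: reflect_def)
  qed (simp add: reflect_def)
qed

lemma antisym_dsign: "antisym (dsign F) x = - dsign (antisym F x)"
  by (simp add: antisym_def dsign_reflect[symmetric] scale_lin)

lemma proj_dsign: "proj (dsign F) = dsign (proj F)"
proof (intro ext)
  fix y r show "proj (dsign F) y r = dsign (proj F) y r"
    by (induction r arbitrary: F) (simp_all add: antisym_dsign, simp_all add: dsign_def)
qed

lemma antisym_cobd: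
  assumes odd: "odd CARD('p::prime_card)"
  shows "antisym (cobd 1 (F :: 'p dcochain)) x = cobd 1 (antisym F x) - dsign (F - reflect 1 F x)"
proof -
  have two: "(2 :: 'p mod_ring) \<noteq> 0" by (rule two_neq_zero[OF odd])
  have "antisym (cobd 1 F) x = cobd 1 (antisym F x) - scale (1 / 2) (dsign (F - reflect 1 F x) + dsign (F - reflect 1 F x))"
    by (simp add: antisym_def fix_last_cobd reflect_cobd dsign_reflect[symmetric] reflect_same scale_lin)
  also have "scale (1 / 2) (H + H) = H" for H :: "'p dcochain"
    using two by (auto simp: fun_eq_iff scale_def)
  finally show ?thesis .
qed

text \<open>
  The face terms at the last letter are \<open>F - reflect 1 F x\<close>, and antisymmetrising the coboundary
  reproduces them.
\<close>

lemma proj_cobd: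
  assumes odd: "odd CARD('p::prime_card)"
  shows "proj (cobd 1 (F :: 'p dcochain)) = cobd 1 (proj F)"
proof (intro ext)
  fix y r show "proj (cobd 1 F) y r = cobd 1 (proj F) y r"
  proof (induction r arbitrary: F)
    case (Cons x r)
    have "proj (cobd 1 F) y (x # r) = (proj (cobd 1 (antisym F x)) - dsign (proj F - reflect 1 (proj F) x)) y r"
      by (simp add: antisym_cobd[OF odd] proj_dsign proj_reflect)
    then show ?case by (simp add: Cons fix_last_proj) (simp add: dsign_def right_diff_distrib)
  qed simp
qed

lemma antisym_proj:
  assumes odd: "odd CARD('p::prime_card)"
  shows "antisym (proj (F :: 'p dcochain)) x = proj (antisym F x)"
proof -
  have two: "(2 :: 'p mod_ring) \<noteq> 0" by (rule two_neq_zero[OF odd])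
  have "antisym F x - reflect 1 (antisym F x) x = scale 2 (antisym F x)"
    using two by (simp add: antisym_def reflect_same scale_lin) (auto simp: fun_eq_iff)
  then have "proj (antisym F x) - reflect 1 (proj (antisym F x)) x = scale 2 (proj (antisym F x))"
    by (metis proj_diff proj_reflect proj_scale)
  then show ?thesis using two by (simp add: antisym_def fix_last_proj)
qed

lemma proj_proj:
  assumes odd: "odd CARD('p::prime_card)"
  shows "proj (proj (F :: 'p dcochain)) = proj F"
proof (intro ext)
  fix y r show "proj (proj F) y r = proj F y r"
    by (induction r arbitrary: F) (simp_all add: antisym_proj[OF odd])
qed

lemma base_free_antisym: "base_free F \<Longrightarrow> base_free (antisym F x)"
  unfolding antisym_def by (intro base_free_lin)

text \<open>
  After all letters are absorbed, the last step subtracts a constant from itself.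
\<close>

lemma proj_base_free:
  assumes "base_free F" "r \<noteq> []"
  shows "proj F y r = 0"
  using assms
proof (induction r arbitrary: F)
  case (Cons x r)
  show ?case
  proof (cases r)
    case Nil
    have "F (2 * x - y) [x] = F y [x]" using Cons(2) unfolding base_free_def by blast
    then show ?thesis by (simp add: Nil antisym_def fix_last_def reflect_def)
  next
    case (Cons x' r')
    then show ?thesis using Cons.IH[of "antisym F x"] base_free_antisym[OF Cons.prems(1)] by simp
  qed
qed simp

lemma proj_base_free_homog:
  assumes "base_free F" "homog n F" "n > 0"
  shows "proj F = 0"
proof (intro ext)
  fix y r show "proj F y r = 0 y r"
    using proj_base_free[OF assms(1), of r y] assms(2,3) by (cases "r = []") (auto simp: homog_def)
qed

lemma proj_unit: "proj unit = unit"
proof (intro ext)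
  fix y r show "proj unit y r = (unit :: 'a dcochain) y r"
  proof (cases "r = []")
    case False
    from proj_base_free[OF base_free_lin(7) this, of y] show ?thesis using False by (simp only:) (simp add: unit_def)
  qed simp
qed

lemma proj_vanish:
  assumes "\<And>y r. length r = n \<Longrightarrow> F y r = 0" "length r = n"
  shows "proj F y r = 0"
  using assms
proof (induction r arbitrary: F n)
  case (Cons x r)
  show ?case
    unfolding proj.simps
    by (rule Cons(1)[of "n - 1"]) (use Cons(2,3) in \<open>auto simp: antisym_def fix_last_def reflect_def\<close>)
qed simp

lemma homog_proj: "homog n F \<Longrightarrow> homog n (proj F)"
  unfolding homog_def using proj_vanish by metis

lemma front_op_proj:
  assumes "front_op 2 1 L"
  shows "front_op 2 1 (\<lambda>y g. L y (proj g))"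
  unfolding front_op_def
proof (intro conjI allI impI)
  show "lin_form (\<lambda>g. L y (proj g))" for y
    using front_op_lin_form[OF assms, of y] by (simp add: lin_form_def)
  show "L y (proj g) = L y (proj h)" if "\<forall>w l. length l = 2 \<longrightarrow> g w l = h w l" for y g h
  proof -
    have "proj (g - h) w l = 0" if "length l = 2" for w l
      by (rule proj_vanish[where n = 2]) (use that \<open>\<forall>w l. length l = 2 \<longrightarrow> g w l = h w l\<close> in auto)
    then have "\<forall>w l. length l = 2 \<longrightarrow> proj g w l = proj h w l" by simp
    then show ?thesis using assms unfolding front_op_def by blast
  qed
  show "L (2 * x - y) (proj g) = 1 * L y (proj (reflect 1 g x))" for x y g
    using assms by (simp add: front_op_def proj_reflect)
qed

lemma front_reflect:
  assumes "front_op m 1 L"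
  shows "reflect 1 (front L F) x = front L (reflect 1 F x)"
  using assms by (simp add: front_op_def front_def reflect_def)

text \<open>
  \<open>proj\<close> works letter by letter from the end, so the letters consumed at the front are projected
  last, inside the functional.
\<close>

lemma front_proj:
  assumes L: "front_op 2 1 L"
  shows "front L (proj F) = proj (front (\<lambda>y g. L y (proj g)) F)"
proof (intro ext)
  let ?L = "\<lambda>y g. L y (proj g)"
  have lin: "lin_form (?L y)" for y using front_op_proj[OF L] by (rule front_op_lin_form)
  have anti: "antisym (front ?L F) x = front ?L (antisym F x)" for F x
  proof -
    have "front ?L (scale (1 / 2) (fix_last F x - reflect 1 (fix_last F x) x))
        = scale (1 / 2) (front ?L (fix_last F x) - front ?L (reflect 1 (fix_last F x) x))"
    proof (intro ext)
      fix y r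
      let ?H = "\<lambda>w l. fix_last F x w (r @ l)" and ?H' = "\<lambda>w l. reflect 1 (fix_last F x) x w (r @ l)"
      have e: "(\<lambda>w l. scale (1 / 2) (fix_last F x - reflect 1 (fix_last F x) x) w (r @ l)) = scale (1 / 2) (?H - ?H')"
        by (simp add: fun_eq_iff)
      show "front ?L (scale (1 / 2) (fix_last F x - reflect 1 (fix_last F x) x)) y r
          = scale (1 / 2) (front ?L (fix_last F x) - front ?L (reflect 1 (fix_last F x) x)) y r"
        unfolding front_def e lin_formD(2)[OF lin] lin_formD(3)[OF lin] by simp
    qed
    moreover have "fix_last (front ?L F) x = front ?L (fix_last F x)" by (simp add: front_def fix_last_def)
    ultimately show ?thesis by (simp only: antisym_def front_reflect[OF front_op_proj[OF L]])
  qed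
  fix y r show "front L (proj F) y r = proj (front ?L F) y r"
  proof (induction r arbitrary: F)
    case (Cons x r)
    have "front L (proj F) y (x # r) = front L (fix_last (proj F) x) y r" by (simp add: front_def fix_last_def)
    then show ?case by (simp add: fix_last_proj Cons anti)
  qed (simp add: front_def)
qed

section \<open>The projection is multiplicative\<close>

text \<open>
  The homotopy for \<open>proj_shuf\<close>. Antisymmetrising a product in its last letter is not the product of
  the antisymmetrised factors; the last term accounts for the difference.
\<close>

fun proj_htpy :: "'p::prime_card dcochain \<Rightarrow> 'p dcochain \<Rightarrow> 'p dcochain" where
  "proj_htpy F G y [] = 0"
| "proj_htpy F G y (x # r) = proj_htpy (antisym F x) (reflect 1 G x) y r + proj_htpy (dsign F) (antisym G x) y r
     - 1 / 2 * proj (shuf 1 (reflect 1 (fix_last F x) x) (dsign (reflect 1 (fix_last G x) x))) y r"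

lemma proj_htpy_add_left: "proj_htpy (F + F') G = proj_htpy F G + proj_htpy F' G"
proof (intro ext)
  fix y r show "proj_htpy (F + F') G y r = (proj_htpy F G + proj_htpy F' G) y r"
    by (induction r arbitrary: F F' G) (auto simp: algebra_simps)
qed

lemma proj_htpy_add_right: "proj_htpy F (G + G') = proj_htpy F G + proj_htpy F G'"
proof (intro ext)
  fix y r show "proj_htpy F (G + G') y r = (proj_htpy F G + proj_htpy F G') y r"
    by (induction r arbitrary: F G G') (auto simp: algebra_simps)
qed

lemma proj_htpy_uminus: "proj_htpy (- F) G = - proj_htpy F G" "proj_htpy F (- G) = - proj_htpy F G"
proof -
  have "proj_htpy 0 G y r = 0 \<and> proj_htpy F 0 y r = 0" for F G :: "'a dcochain" and y r
    by (induction r arbitrary: F G) auto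
  then have z: "proj_htpy 0 G = 0" "proj_htpy F 0 = 0" by (auto simp: fun_eq_iff)
  show "proj_htpy (- F) G = - proj_htpy F G" "proj_htpy F (- G) = - proj_htpy F G"
    using proj_htpy_add_left[of F "- F" G] proj_htpy_add_right[of F G "- G"] z by (simp_all add: eq_neg_iff_add_eq_0 add.commute)
qed

lemma proj_htpy_diff: "proj_htpy (F - F') G = proj_htpy F G - proj_htpy F' G"
  "proj_htpy F (G - G') = proj_htpy F G - proj_htpy F G'"
  using proj_htpy_add_left[of F "- F'" G] proj_htpy_add_right[of F G "- G'"] by (simp_all add: proj_htpy_uminus)

lemma fix_last_proj_htpy: "fix_last (proj_htpy F G) x = proj_htpy (antisym F x) (reflect 1 G x) + proj_htpy (dsign F) (antisym G x)
     - scale (1 / 2) (proj (shuf 1 (reflect 1 (fix_last F x) x) (dsign (reflect 1 (fix_last G x) x))))"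
  by (intro ext) (simp add: fix_last_def)

lemma proj_htpy_dsign: "proj_htpy (dsign F) (dsign G) = - dsign (proj_htpy F G)"
proof (intro ext)
  fix y r show "proj_htpy (dsign F) (dsign G) y r = (- dsign (proj_htpy F G)) y r"
  proof (induction r arbitrary: F G)
    case (Cons x r)
    have e: "shuf 1 (- dsign A) (- dsign (dsign C)) = dsign (shuf 1 A (dsign C))" for A C :: "'a dcochain"
      by (simp add: dsign_shuf shuf_uminus)
    have "proj_htpy (dsign F) (dsign G) y (x # r) =
        - proj_htpy (dsign (antisym F x)) (dsign (reflect 1 G x)) y r - proj_htpy (dsign (dsign F)) (dsign (antisym G x)) y r
        - 1 / 2 * dsign (proj (shuf 1 (reflect 1 (fix_last F x) x) (dsign (reflect 1 (fix_last G x) x)))) y r"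
      by (simp only: proj_htpy.simps antisym_dsign fix_last_dsign reflect_lin(3) dsign_lin(3) dsign_reflect[symmetric] proj_htpy_uminus e
          proj_dsign uminus_apply) simp
    also have "\<dots> = dsign (fix_last (proj_htpy F G) x) y r"
      by (simp only: Cons fix_last_proj_htpy uminus_apply dsign_lin plus_fun_apply minus_apply scale_apply) simp
    also have "\<dots> = (- dsign (proj_htpy F G)) y (x # r)" by (simp add: dsign_def fix_last_def)
    finally show ?case .
  qed (simp add: dsign_def)
qed

lemma proj_htpy_reflect: "proj_htpy (reflect 1 F x) (reflect 1 G x) = reflect 1 (proj_htpy F G) x"
proof (intro ext)
  fix y r show "proj_htpy (reflect 1 F x) (reflect 1 G x) y r = reflect 1 (proj_htpy F G) x y r"
  proof (induction r arbitrary: F G)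
    case (Cons a r)
    let ?a = "2 * x - a"
    have e: "reflect 1 (reflect 1 H x) a = reflect 1 (reflect 1 H ?a) x" for H :: "'a dcochain" by (rule reflect_reflect)
    have s: "shuf 1 (reflect 1 A x) (reflect 1 C x) = reflect 1 (shuf 1 A C) x" for A C :: "'a dcochain"
      using reflect_shuf[of 1 1 A C x] by simp
    have "proj_htpy (reflect 1 F x) (reflect 1 G x) y (a # r) = reflect 1 (fix_last (proj_htpy F G) ?a) x y r"
      by (simp only: proj_htpy.simps antisym_reflect e fix_last_reflect dsign_reflect s proj_reflect Cons fix_last_proj_htpy reflect_lin
          plus_fun_apply minus_apply scale_apply)
    then show ?case by (simp add: reflect_def fix_last_def)
  qed (simp add: reflect_def)
qed

text \<open>
  Induction on the last letter. \<open>X\<close> is the difference between the antisymmetrised product and the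
  two products with one antisymmetrised factor; it is matched by the coboundary of the last term of
  \<open>proj_htpy\<close>.
\<close>

theorem proj_shuf:
  assumes odd: "odd CARD('p::prime_card)"
  shows "proj (shuf 1 F G) - shuf 1 (proj F) (proj (G :: 'p dcochain))
    = cobd 1 (proj_htpy F G) + proj_htpy (cobd 1 F) (dsign G) + proj_htpy F (cobd 1 G)"
proof (intro ext)
  fix y r
  show "(proj (shuf 1 F G) - shuf 1 (proj F) (proj G)) y r
    = (cobd 1 (proj_htpy F G) + proj_htpy (cobd 1 F) (dsign G) + proj_htpy F (cobd 1 G)) y r"
  proof (induction r arbitrary: F G)
    case (Cons x r)
    define \<rho> where "\<rho> H = reflect 1 H x" for H :: "'p dcochain"
    have rr: "\<rho> (\<rho> H) = H" for H by (simp add: \<rho>_def reflect_same)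
    have rlin: "\<rho> (H + H') = \<rho> H + \<rho> H'" "\<rho> (H - H') = \<rho> H - \<rho> H'"
      "\<rho> (- H) = - \<rho> H"
      for H H' by (simp_all add: \<rho>_def)
    have rsg: "\<rho> (dsign H) = dsign (\<rho> H)" "\<rho> (cobd 1 H) = cobd 1 (\<rho> H)"
      "\<rho> (proj H) = proj (\<rho> H)" for H
      by (simp_all add: \<rho>_def dsign_reflect reflect_cobd proj_reflect)
    have rshuf: "\<rho> (shuf 1 A C) = shuf 1 (\<rho> A) (\<rho> C)"
      "\<rho> (proj_htpy A C) = proj_htpy (\<rho> A) (\<rho> C)" for A C
      using reflect_shuf[of 1 1 A C x] by (simp_all add: \<rho>_def proj_htpy_reflect)
    define f g where "f = fix_last F x" and "g = fix_last G x"
    define a b where "a = antisym F x" and "b = antisym G x"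
    define X where "X = scale (1 / 2) (shuf 1 (\<rho> f) (\<rho> G - G) + shuf 1 (dsign F - dsign (\<rho> F)) (\<rho> g))"
    have ab: "a = scale (1 / 2) (f - \<rho> f)" "b = scale (1 / 2) (g - \<rho> g)"
      by (simp_all add: a_def b_def f_def g_def \<rho>_def antisym_def)
    have s: "antisym (shuf 1 F G) x = shuf 1 a (\<rho> G) + shuf 1 (dsign F) b + X"
    proof -
      have "antisym (shuf 1 F G) x = scale (1 / 2) ((shuf 1 f (\<rho> G) + shuf 1 (dsign F) g)
          - \<rho> (shuf 1 f (\<rho> G) + shuf 1 (dsign F) g))"
        by (simp only: antisym_def fix_last_shuf f_def g_def \<rho>_def)
      then show ?thesis
        by (simp only: ab X_def rlin rshuf rr rsg shuf_lin scale_lin) (simp only: algebra_simps)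
    qed
    have L: "(proj (shuf 1 F G) - shuf 1 (proj F) (proj G)) y (x # r)
       = (proj (shuf 1 a (\<rho> G)) - shuf 1 (proj a) (proj (\<rho> G))) y r
       + (proj (shuf 1 (dsign F) b) - shuf 1 (proj (dsign F)) (proj b)) y r + proj X y r"
    proof -
      have "(proj (shuf 1 F G) - shuf 1 (proj F) (proj G)) y (x # r)
        = proj (antisym (shuf 1 F G) x) y r - (shuf 1 (fix_last (proj F) x) (reflect 1 (proj G) x)
          + shuf 1 (dsign (proj F)) (fix_last (proj G) x)) y r" by simp
      also have "(shuf 1 (fix_last (proj F) x) (reflect 1 (proj G) x) + shuf 1 (dsign (proj F)) (fix_last (proj G) x))
        = shuf 1 (proj a) (proj (\<rho> G)) + shuf 1 (proj (dsign F)) (proj b)"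
        by (simp only: fix_last_proj a_def b_def \<rho>_def proj_reflect proj_dsign)
      finally have *: "(proj (shuf 1 F G) - shuf 1 (proj F) (proj G)) y (x # r)
        = proj (antisym (shuf 1 F G) x) y r - (shuf 1 (proj a) (proj (\<rho> G)) + shuf 1 (proj (dsign F)) (proj b)) y r" .
      have "proj (antisym (shuf 1 F G) x) = proj (shuf 1 a (\<rho> G)) + proj (shuf 1 (dsign F) b) + proj X"
        unfolding s proj_add ..
      then have e: "proj (antisym (shuf 1 F G) x) y r
          = proj (shuf 1 a (\<rho> G)) y r + proj (shuf 1 (dsign F) b) y r + proj X y r"
        by (simp only: plus_fun_apply)
      show ?thesis
        by (rule trans[OF *], unfold e plus_fun_apply minus_apply) (simp only: algebra_simps)
    qed
    have d: "cobd 1 (proj_htpy F G) y (x # r) = (cobd 1 (proj_htpy a (\<rho> G)) + cobd 1 (proj_htpy (dsign F) b)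
        - scale (1 / 2) (proj (shuf 1 (cobd 1 (\<rho> f)) (\<rho> g) - shuf 1 (\<rho> f) (dsign (cobd 1 (\<rho> g)))))
        - (dsign (proj_htpy F G) - dsign (proj_htpy (\<rho> F) (\<rho> G)))) y r"
    proof -
      have 1: "fix_last (proj_htpy F G) x = proj_htpy a (\<rho> G) + proj_htpy (dsign F) b - scale (1 / 2) (proj (shuf 1 (\<rho> f) (dsign (\<rho> g))))"
        by (simp only: fix_last_proj_htpy a_def b_def f_def g_def \<rho>_def)
      have 2: "cobd 1 (proj (shuf 1 (\<rho> f) (dsign (\<rho> g))))
          = proj (shuf 1 (cobd 1 (\<rho> f)) (\<rho> g) - shuf 1 (\<rho> f) (dsign (cobd 1 (\<rho> g))))"
        using cobd_shuf[of 1 1 "\<rho> f" "dsign (\<rho> g)"] by (simp flip: proj_cobd[OF odd])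
      have 3: "(-1) ^ length r * (proj_htpy F G y r - reflect 1 (proj_htpy F G) x y r)
          = (dsign (proj_htpy F G) - dsign (proj_htpy (\<rho> F) (\<rho> G))) y r"
        by (simp add: \<rho>_def proj_htpy_reflect) (simp add: dsign_def algebra_simps)
      show ?thesis
        unfolding cobd.simps 1 3 by (simp only: cobd_add cobd_diff cobd_scale 2 plus_fun_apply minus_apply scale_apply)
    qed
    have k1: "proj_htpy (cobd 1 F) (dsign G) y (x # r) = (proj_htpy (cobd 1 a) (dsign (\<rho> G)) - proj_htpy (dsign F) (dsign (\<rho> G))
        + proj_htpy (dsign (\<rho> F)) (dsign (\<rho> G)) - proj_htpy (dsign (cobd 1 F)) (dsign b)
        + scale (1 / 2) (proj (shuf 1 (cobd 1 (\<rho> f)) (\<rho> g) - shuf 1 (dsign (\<rho> F) - dsign F) (\<rho> g)))) y r"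
    proof -
      have 1: "antisym (cobd 1 F) x = cobd 1 a - (dsign F - dsign (\<rho> F))"
        by (simp add: antisym_cobd[OF odd] a_def \<rho>_def)
      have 2: "antisym (dsign G) x = - dsign b" by (simp only: antisym_dsign b_def)
      have 3: "reflect 1 (fix_last (cobd 1 F) x) x = cobd 1 (\<rho> f) - (dsign (\<rho> F) - dsign F)"
        unfolding fix_last_cobd f_def[symmetric] \<rho>_def[symmetric] by (simp only: rlin rsg rr dsign_lin)
      have 4: "dsign (reflect 1 (fix_last (dsign G) x) x) = - \<rho> g"
        unfolding fix_last_dsign g_def[symmetric] \<rho>_def[symmetric] by (simp only: rlin rsg dsign_lin dsign_dsign)
      have 5: "reflect 1 (dsign G) x = dsign (\<rho> G)" by (simp only: \<rho>_def dsign_reflect)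
      show ?thesis
        unfolding proj_htpy.simps 1 2 3 4 5
        by (simp only: proj_htpy_diff proj_htpy_uminus shuf_lin proj_lin plus_fun_apply minus_apply uminus_apply scale_apply
            mult_minus_right)
           (simp add: algebra_simps)
    qed
    have k2: "proj_htpy F (cobd 1 G) y (x # r) = (proj_htpy a (cobd 1 (\<rho> G)) + proj_htpy (dsign F) (cobd 1 b)
        - proj_htpy (dsign F) (dsign G) + proj_htpy (dsign F) (dsign (\<rho> G))
        - scale (1 / 2) (proj (shuf 1 (\<rho> f) (dsign (cobd 1 (\<rho> g))) - shuf 1 (\<rho> f) (\<rho> G - G)))) y r"
    proof -
      have 1: "antisym (cobd 1 G) x = cobd 1 b - (dsign G - dsign (\<rho> G))"
        by (simp add: antisym_cobd[OF odd] b_def \<rho>_def)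
      have 2: "reflect 1 (cobd 1 G) x = cobd 1 (\<rho> G)" by (simp only: \<rho>_def reflect_cobd)
      have 3: "dsign (reflect 1 (fix_last (cobd 1 G) x) x) = dsign (cobd 1 (\<rho> g)) - (\<rho> G - G)"
        unfolding fix_last_cobd g_def[symmetric] \<rho>_def[symmetric] by (simp only: rlin rsg rr dsign_lin dsign_dsign)
      show ?thesis
        unfolding proj_htpy.simps 1 2 3 unfolding a_def[symmetric] f_def[symmetric] \<rho>_def[symmetric]
        by (simp only: proj_htpy_diff shuf_lin proj_lin plus_fun_apply minus_apply scale_apply)
           (simp only: algebra_simps)
    qed
    have X: "proj X y r = (scale (1 / 2) (proj (shuf 1 (\<rho> f) (\<rho> G - G)))
        - scale (1 / 2) (proj (shuf 1 (dsign (\<rho> F) - dsign F) (\<rho> g)))) y r"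
      unfolding X_def by (simp only: shuf_lin proj_lin scale_lin plus_fun_apply minus_apply scale_apply)
        (simp only: algebra_simps)
    have sb: "cobd 1 (dsign F) = - dsign (cobd 1 F)" by simp
    show ?case
      unfolding L Cons plus_fun_apply d k1 k2 X
      by (simp only: sb proj_htpy_uminus proj_htpy_dsign cobd_dsign proj_lin scale_lin shuf_lin
          plus_fun_apply minus_apply uminus_apply scale_apply)
         (simp add: algebra_simps)
  qed simp
qed

section \<open>Cohomologous functions\<close>

definition coh :: "'p::prime_card dcochain \<Rightarrow> 'p dcochain \<Rightarrow> bool" where
  "coh F G \<longleftrightarrow> (\<exists>v. F = G + cobd 1 v)"

lemma cohI: "F = G + cobd 1 v \<Longrightarrow> coh F G"
  by (auto simp: coh_def)

lemma coh_refl [simp]: "coh F F"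
  by (rule cohI[of _ _ 0]) simp

lemma coh_sym: "coh F G \<Longrightarrow> coh G F"
  unfolding coh_def
proof (elim exE)
  fix v assume "F = G + cobd 1 v"
  then have "G = F + cobd 1 (- v)" by simp
  then show "\<exists>v. G = F + cobd 1 v" by blast
qed

lemma coh_trans [trans]: "coh F G \<Longrightarrow> coh G H \<Longrightarrow> coh F H"
  unfolding coh_def
proof (elim exE)
  fix v w assume "F = G + cobd 1 v" "G = H + cobd 1 w"
  then have "F = H + cobd 1 (w + v)" by (simp add: add.assoc)
  then show "\<exists>v. F = H + cobd 1 v" by blast
qed

lemma coh_add: "coh F G \<Longrightarrow> coh F' G' \<Longrightarrow> coh (F + F') (G + G')"
  unfolding coh_def
proof (elim exE)
  fix v w assume "F = G + cobd 1 v" "F' = G' + cobd 1 w"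
  then have "F + F' = G + G' + cobd 1 (v + w)" by (simp add: algebra_simps)
  then show "\<exists>v. F + F' = G + G' + cobd 1 v" by blast
qed

lemma coh_scale: "coh F G \<Longrightarrow> coh (scale c F) (scale c G)"
  unfolding coh_def by (metis scale_lin(1) cobd_scale)

lemma coh_diff: "coh F G \<Longrightarrow> coh F' G' \<Longrightarrow> coh (F - F') (G - G')"
  using coh_add[of F G "scale (-1) F'" "scale (-1) G'"] coh_scale[of F' G' "-1"]
  by (simp add: scale_lin)

lemma coh_sum: "(\<And>i. i \<in> S \<Longrightarrow> coh (f i) (g i)) \<Longrightarrow> coh (sum f S) (sum g S)"
  by (induction S rule: infinite_finite_induct) (auto intro: coh_add)

lemma coh_diff_0: "coh (F - G) 0 \<Longrightarrow> coh F G"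
  unfolding coh_def by (metis add.commute add_0 diff_add_cancel)

lemma coh_cut:
  assumes "coh F G" shows "coh (cut n F) (cut n G)"
proof -
  obtain v where v: "F = G + cobd 1 v" using assms by (auto simp: coh_def)
  show ?thesis
  proof (cases n)
    case 0
    have "cut 0 (cobd 1 v) = 0"
    proof (intro ext)
      fix y r show "cut 0 (cobd 1 v) y r = 0 y r" by (cases r) (auto simp: cut_def)
    qed
    then show ?thesis by (simp add: 0 v)
  next
    case (Suc m)
    then show ?thesis by (intro cohI[of _ _ "cut m v"]) (simp add: v cobd_cut)
  qed
qed

lemma coh_shuf_left: "coh F F' \<Longrightarrow> cobd 1 G = 0 \<Longrightarrow> coh (shuf 1 F G) (shuf 1 F' G)"
  unfolding coh_def
proof (elim exE)
  fix v assume v: "F = F' + cobd 1 v" and G: "cobd 1 G = 0"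
  have "shuf 1 F G = shuf 1 F' G + cobd 1 (shuf 1 v (dsign G))"
    using cobd_shuf[of 1 1 v "dsign G"] G by (simp add: v)
  then show "\<exists>v. shuf 1 F G = shuf 1 F' G + cobd 1 v" by blast
qed

lemma coh_shuf_right: "coh G G' \<Longrightarrow> cobd 1 F = 0 \<Longrightarrow> coh (shuf 1 F G) (shuf 1 F G')"
  unfolding coh_def
proof (elim exE)
  fix v assume v: "G = G' + cobd 1 v" and F: "cobd 1 F = 0"
  have "shuf 1 F G = shuf 1 F G' + cobd 1 (shuf 1 F v)"
    using cobd_shuf[of 1 1 F v] F by (simp add: v)
  then show "\<exists>v. shuf 1 F G = shuf 1 F G' + cobd 1 v" by blast
qed

definition cocycle :: "nat \<Rightarrow> 'p::prime_card dcochain \<Rightarrow> bool" where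
  "cocycle n F \<longleftrightarrow> homog n F \<and> cobd 1 F = 0"

lemma cocycle_lin: "cocycle n F \<Longrightarrow> cocycle n G \<Longrightarrow> cocycle n (F + G)"
  "cocycle n F \<Longrightarrow> cocycle n G \<Longrightarrow> cocycle n (F - G)"
  "cocycle n F \<Longrightarrow> cocycle n (scale c F)" "cocycle n 0"
  by (auto simp: cocycle_def homog_lin)

lemma cocycle_sum: "(\<And>i. i \<in> S \<Longrightarrow> cocycle n (f i)) \<Longrightarrow> cocycle n (sum f S)"
  by (induction S rule: infinite_finite_induct) (auto intro: cocycle_lin)

lemma cocycle_shuf: "cocycle k F \<Longrightarrow> cocycle m G \<Longrightarrow> cocycle (k + m) (shuf 1 F G)"
  using cobd_shuf[of 1 1 F G] by (auto simp: cocycle_def homog_shuf)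

lemma cocycle_unit: "cocycle 0 unit"
  by (simp add: cocycle_def) (simp add: homog_def unit_def)

lemma cocycle_cut: "cobd 1 F = 0 \<Longrightarrow> cocycle n (cut n F)"
  by (simp add: cocycle_def homog_cut cobd_cut)

lemma cocycle_drop_base:
  assumes "odd CARD('p::prime_card)" "cocycle n (F :: 'p dcochain)"
  shows "cocycle (Suc n) (drop_base F)"
proof -
  have "homog (Suc n) (drop_base F)"
    unfolding homog_def
  proof (intro allI impI)
    fix y :: "'p mod_ring" and r :: "'p mod_ring list" assume "length r \<noteq> Suc n"
    then show "drop_base F y r = 0"
      using assms(2) by (cases r rule: rev_cases) (auto simp: drop_base_def cocycle_def homog_def)
  qed
  then show ?thesis using assms(2) by (simp add: cocycle_def cobd_drop_base[OF assms(1)])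
qed

lemma shuf_sum_cong:
  assumes "\<And>c b a. length b + length a = length r \<Longrightarrow> h c b a = h' c b a"
  shows "shuf_sum r h = shuf_sum r h'"
  using assms
proof (induction r arbitrary: h h')
  case (Cons x r)
  show ?case
    unfolding shuf_sum.simps by (rule Cons(1)) (use Cons(2) in auto)
qed simp

lemma cut_shuf:
  fixes F :: "('a::comm_ring_1, 'k::comm_ring_1) cochain"
  assumes "homog k F"
  shows "cut n (shuf s F G) = (if k \<le> n then shuf s F (cut (n - k) G) else 0)"
proof (intro ext)
  fix y r
  have F: "F y b = 0" if "length b \<noteq> k" for b :: "'a list" using assms that by (simp add: homog_def)
  show "cut n (shuf s F G) y r = (if k \<le> n then shuf s F (cut (n - k) G) else 0) y r"
  proof (cases "k \<le> n")
    case True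
    show ?thesis
    proof (cases "length r = n")
      case n: True
      have "shuf s F G y r = shuf s F (cut (n - k) G) y r"
        unfolding shuf_shuf_sum
      proof (rule shuf_sum_cong)
        fix c :: 'k and b a :: "'a list" assume "length b + length a = length r"
        then show "c * (F y b * (s ^ length b * G (act y b) a))
            = c * (F y b * (s ^ length b * cut (n - k) G (act y b) a))"
          using n True by (cases "length b = k") (auto simp: F cut_def)
      qed
      then show ?thesis using n True by (simp add: cut_def)
    next
      case False
      then have "shuf s F (cut (n - k) G) y r = 0"
        using homog_shuf[OF assms homog_cut[of "n - k" G], of s] True by (simp add: homog_def)
      then show ?thesis using False True by (simp add: cut_def)
    qed
  next
    case False
    then show ?thesis
      using shuf_low[of k F r s G y] assms by (auto simp: cut_def homog_def)
  qed
qed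

lemma coh_proj:
  assumes "odd CARD('p::prime_card)" "coh (F :: 'p dcochain) G"
  shows "coh (proj F) (proj G)"
  using assms(2) by (auto simp: coh_def proj_cobd[OF assms(1)])

lemma proj_shuf_coh:
  assumes "odd CARD('p::prime_card)" "cobd 1 (F :: 'p dcochain) = 0" "cobd 1 G = 0"
  shows "coh (proj (shuf 1 F G)) (shuf 1 (proj F) (proj G))"
proof (rule cohI[of _ _ "proj_htpy F G"])
  have z: "proj_htpy 0 G = 0" "proj_htpy F 0 = 0" for F G :: "'p dcochain"
    using proj_htpy_diff(1)[of 0 0 G] proj_htpy_diff(2)[of F 0 0] by simp_all
  show "proj (shuf 1 F G) = shuf 1 (proj F) (proj G) + cobd 1 (proj_htpy F G)"
    using proj_shuf[OF assms(1), of F G] assms(2,3) by (simp add: z algebra_simps)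
qed

lemma coh_drop_base:
  assumes "odd CARD('p::prime_card)" "coh (F :: 'p dcochain) G"
  shows "coh (drop_base F) (drop_base G)"
  using assms(2) by (auto simp: coh_def cobd_drop_base[OF assms(1), symmetric])

section \<open>The derivation and its kernel\<close>

text \<open>
  The interface between the cochain computations and the algebra of words. \<open>der\<close> is the secondary
  operation on cohomology, realised by a chain map that is a derivation. The last two assumptions
  describe its kernel as the direct sum of \<open>T\<close> and \<open>B \<union> T\<close>, where \<open>T\<close> stands for the classes of
  cocycles without base point.
\<close>

locale dihedral_cohomology =
  fixes B :: "'p::prime_card dcochain" and der :: "'p dcochain \<Rightarrow> 'p dcochain"
  assumes odd: "odd CARD('p)"
    and B: "cocycle 3 B"
    and der_add: "der (F + G) = der F + der G"
    and der_scale: "der (scale c F) = scale c (der F)"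
    and der_cut: "der (cut (Suc (Suc n)) F) = cut n (der F)"
    and der_low: "homog n F \<Longrightarrow> n < 2 \<Longrightarrow> der F = 0"
    and der_del: "der (cobd 1 F) = cobd 1 (der F)"
    and der_shuf: "cobd 1 F = 0 \<Longrightarrow> cobd 1 G = 0 \<Longrightarrow>
      coh (der (shuf 1 F G)) (shuf 1 (der F) G + shuf 1 F (der G))"
    and der_base_free: "base_free t \<Longrightarrow> cobd 1 t = 0 \<Longrightarrow> coh (der t) 0"
    and der_B: "coh (der B) 0"
    and der_proj: "cobd 1 F = 0 \<Longrightarrow> coh (der (proj F)) (proj (der F))"
    and der_surj: "cobd 1 x = 0 \<Longrightarrow> \<exists>F. cobd 1 F = 0 \<and> coh (der F) x"
    and der_kernel: "cobd 1 F = 0 \<Longrightarrow> coh (der F) 0 \<Longrightarrow>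
      \<exists>t f. base_free t \<and> base_free f \<and> cobd 1 t = 0 \<and> cobd 1 f = 0 \<and> coh F (t + shuf 1 B f)"
    and direct: "base_free t \<Longrightarrow> base_free f \<Longrightarrow> cobd 1 f = 0 \<Longrightarrow> coh (t + shuf 1 B f) 0 \<Longrightarrow>
      \<exists>t' f'. base_free t' \<and> base_free f' \<and> t = cobd 1 t' \<and> f = cobd 1 f'"

text \<open>
  Both \<open>pair_op\<close> and the secondary operation are needed: they agree on cohomology up to a non-zero
  factor \<open>k\<close>, the former is a derivation, and for the latter image and kernel are known.
\<close>

lemma dihedral_cohomology_exists:
  assumes odd: "odd CARD('p::prime_card)"
  obtains B :: "'p::prime_card dcochain" and der where "dihedral_cohomology B der"
proof -
  obtain B E0 G0 :: "'p dcochain" where B: "is_B B E0 G0" "homog 3 B" using is_B_homog_exists[OF odd] .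
  obtain k where k: "\<And>F :: 'p dcochain. cobd 1 F = 0 \<Longrightarrow> \<exists>v. pair_op F = scale k (secondary F) + cobd 1 v"
    "\<And>g :: 'p dcochain. cobd 1 g = 0 \<Longrightarrow> pair_op g 0 [] = k * secondary g 0 []" using pair_op_multiple[OF odd] by blast
  have mochizuki: "pair_op mochizuki 0 [] = (2 :: 'p mod_ring)" by (rule pair_op_mochizuki[OF odd])
  have k0: "k \<noteq> 0" using k(2)[OF cobd_mochizuki] two_neq_zero[OF odd] mochizuki by auto
  define der where "der F = scale (1 / k) (pair_op F)" for F :: "'p dcochain"
  have phk: "coh (pair_op F) (scale k (secondary F))" if "cobd 1 F = 0" for F :: "'p dcochain"
    using k(1)[OF that] by (auto simp: coh_def)
  have der: "coh (der F) (secondary F)" if "cobd 1 F = 0" for F :: "'p dcochain"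
    using coh_scale[OF phk[OF that], of "1 / k"] k0 by (simp add: der_def)
  have Bc: "cobd 1 B = 0" using B(1) by (simp add: is_B_def)
  have "dihedral_cohomology B der"
  proof (unfold_locales)
    show "odd CARD('p)" by (rule odd)
    show "cocycle 3 B" using B(2) Bc by (simp add: cocycle_def)
    show "der (F + G) = der F + der G" "der (scale c F) = scale c (der F)" for F G c
      by (simp_all add: der_def scale_lin mult.commute)
    show "der (cut (Suc (Suc n)) F) = cut n (der F)" for n F
      by (intro ext) (simp add: der_def pair_op_def pair_ins_def cut_def)
    show "der F = 0" if "homog n F" "n < 2" for n F
      using that by (intro ext) (simp add: der_def pair_op_def pair_ins_def homog_def)
    show "der (cobd 1 F) = cobd 1 (der F)" for F by (simp add: der_def pair_op_cobd)
    show "coh (der (shuf 1 F G)) (shuf 1 (der F) G + shuf 1 F (der G))"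
      if FG: "cobd 1 F = 0" "cobd 1 G = 0" for F G
    proof -
      obtain v where v: "pair_op (shuf 1 F G) = shuf 1 (pair_op F) G + shuf 1 F (pair_op G) + cobd 1 v"
        using pair_op_derivation[OF odd FG] .
      show ?thesis
        by (rule cohI[of _ _ "scale (1 / k) v"]) (simp add: der_def v scale_lin)
    qed
    show "coh (der t) 0" if t: "base_free t" "cobd 1 t = 0" for t
    proof -
      have "base_diff t = 0" using t(1) by (simp add: base_free_iff_base_diff[OF odd])
      then have "secondary t = 0" by (simp add: secondary_def)
      then show ?thesis using der[OF t(2)] by simp
    qed
    show "coh (der B) 0"
    proof -
      obtain E G where d: "descent B E G"
      "secondary B = base_diff G" using descent_secondary[OF odd Bc] .
      have "descent B E0 G0" "base_diff G0 = cobd 1 (base_delta unit)" using B(1) by (simp_all add: is_B_def)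
      from descent_unique[OF odd d(1) this(1)] obtain g where "base_diff G - base_diff G0 = cobd 1 g" .
      then have "secondary B = 0 + cobd 1 (base_delta unit + g)"
        using d(2) \<open>base_diff G0 = _\<close> by (simp add: algebra_simps)
      then have "coh (secondary B) 0" by (rule cohI)
      with der[OF Bc] show ?thesis by (rule coh_trans)
    qed
    show "coh (der (proj F)) (proj (der F))" if F: "cobd 1 F = 0" for F
    proof -
      let ?L = "\<lambda>y (g :: 'p dcochain). pair_op (proj g) y []"
      \<comment> \<open>\<open>proj\<close> kills the part of \<open>g\<close> without base point, so \<open>?L\<close> satisfies the hypothesis of \<open>front_op_multiple\<close>\<close>
      have van: "?L 0 g = 0" if g: "homog 2 g" "cobd 1 g = 0" "secondary g = 0" for g :: "'p dcochain"
      proof -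
        obtain t v where t: "base_free t" "cobd 1 t = 0"
          "\<And>y r. length r = 2 \<Longrightarrow> g y r = t y r + cobd 1 v y r" using kernel_degree2[OF odd g] by blast
        have "proj (g - (t + cobd 1 v)) y r = 0" if "length r = 2" for y r
          by (rule proj_vanish[where n = 2]) (use t(3) that in auto)
        then have e: "proj g y r = proj t y r + cobd 1 (proj v) y r" if "length r = 2" for y r
          using that by (simp add: proj_cobd[OF odd])
        have "proj g y r = cobd 1 (proj v) y r" if "length r = 2" for y r
          using e[OF that] proj_base_free[OF t(1), of r y] that by (cases "r = []") auto
        then have "?L 0 g = pair_op (cobd 1 (proj v)) 0 []"
          by (simp add: pair_op_def pair_ins_def del: cobd.simps proj.simps)
        then show ?thesis by (simp add: pair_op_cobd)
      qed
      obtain k' where k': "\<And>F :: 'p dcochain. cobd 1 F = 0 \<Longrightarrow> \<exists>v. front ?L F = scale k' (secondary F) + cobd 1 v"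
        "\<And>g :: 'p dcochain. cobd 1 g = 0 \<Longrightarrow> ?L 0 g = k' * secondary g 0 []"
        using front_op_multiple[OF odd front_op_proj[OF front_op_pair_op(1)] van] by blast
      \<comment> \<open>the cocycle is fixed by \<open>proj\<close>, which identifies the factor \<open>k'\<close> with \<open>k\<close>\<close>
      have "proj mochizuki y r = mochizuki y r" if len: "length r = 2" for y :: "'p mod_ring" and r
      proof -
        obtain b a where r: "r = [b, a]" using len by (auto simp: numeral_2_eq_2 length_Suc_conv)
        have two: "(2 :: 'p mod_ring) \<noteq> 0" by (rule two_neq_zero[OF odd])
        define K where "K = (of_int (carry a b) :: 'p mod_ring)"
        have m: "mochizuki y [b, a] = (a - y) * K"
          "mochizuki y [b, 2 * b - a] = (2 * b - a - y) * K" for y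
          by (simp_all add: mochizuki_simps K_def carry_sym)
        have half: "1 / 2 * (z + z) = z" for z :: "'p mod_ring"
          using two by (simp add: mult_2[symmetric])
        have h: "antisym mochizuki b y [a] = (a - y) * K" for y
        proof -
          have "antisym mochizuki b y [a] = 1 / 2 * (mochizuki y [b, a] - mochizuki (2 * b - y) [b, 2 * b - a])"
            by (simp add: antisym_def fix_last_def reflect_def)
          also have "mochizuki y [b, a] - mochizuki (2 * b - y) [b, 2 * b - a] = (a - y) * K + (a - y) * K"
            by (simp only: m) (simp add: algebra_simps)
          finally show ?thesis by (simp only: half)
        qed
        have "proj mochizuki y r = 1 / 2 * (antisym mochizuki b y [a] - antisym mochizuki b (2 * a - y) [2 * a - a])"
          by (simp add: r antisym_def[of "antisym mochizuki b"] fix_last_def reflect_def)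
        also have "antisym mochizuki b y [a] - antisym mochizuki b (2 * a - y) [2 * a - a] = (a - y) * K + (a - y) * K"
        proof -
          have "2 * a - a = a" by simp
          then show ?thesis by (simp only: h) (simp add: algebra_simps)
        qed
        finally show ?thesis by (simp only: half r m)
      qed
      then have "?L 0 (mochizuki :: 'p dcochain) = pair_op mochizuki 0 []"
        by (simp add: pair_op_def pair_ins_def del: proj.simps)
      then have "k' * secondary mochizuki 0 [] = k * secondary (mochizuki :: 'p dcochain) 0 []"
        using k(2)[OF cobd_mochizuki] k'(2)[OF cobd_mochizuki] by simp
      moreover have "secondary (mochizuki :: 'p dcochain) 0 [] \<noteq> 0"
        using k(2)[OF cobd_mochizuki] two_neq_zero[OF odd] mochizuki by auto
      ultimately have "k' = k" by simp
      have "coh (front ?L F) (scale k (secondary F))" using k'(1)[OF F] by (auto simp: coh_def \<open>k' = k\<close>)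
      also have "coh (scale k (secondary F)) (pair_op F)" by (rule coh_sym[OF phk[OF F]])
      finally have "coh (proj (front ?L F)) (proj (pair_op F))" by (rule coh_proj[OF odd])
      moreover have "pair_op (proj F) = proj (front ?L F)"
        using front_proj[OF front_op_pair_op(1), of F] by (simp add: front_pair_op)
      ultimately show ?thesis using coh_scale[of "pair_op (proj F)" "proj (pair_op F)"
      "1 / k"] by (simp add: der_def)
    qed
    show "\<exists>F. cobd 1 F = 0 \<and> coh (der F) x" if x: "cobd 1 x = 0" for x
    proof -
      obtain F g where F: "cobd 1 F = 0" "secondary F = x + cobd 1 g" using secondary_surj[OF odd x] .
      have "coh (secondary F) x" using F(2) by (rule cohI)
      with der[OF F(1)] have "coh (der F) x" by (rule coh_trans)
      then show ?thesis using F(1) by blast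
    qed
    show "\<exists>t f. base_free t \<and> base_free f \<and> cobd 1 t = 0 \<and> cobd 1 f = 0 \<and> coh F (t + shuf 1 B f)"
      if F: "cobd 1 F = 0" "coh (der F) 0" for F
    proof -
      have "coh (secondary F) 0" using coh_trans[OF coh_sym[OF der[OF F(1)]] F(2)] .
      then obtain u where "secondary F = cobd 1 u" by (auto simp: coh_def)
      from secondary_kernel[OF odd B(1) F(1) this] obtain t f v where
        "base_free t" "base_free f" "cobd 1 t = 0" "cobd 1 f = 0" "F = t + shuf 1 B f + cobd 1 v" .
      then show ?thesis unfolding coh_def by blast
    qed
    show "\<exists>t' f'. base_free t' \<and> base_free f' \<and> t = cobd 1 t' \<and> f = cobd 1 f'"
      if f: "base_free t" "base_free f" "cobd 1 f = 0" "coh (t + shuf 1 B f) 0" for t f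
    proof -
      obtain v where "t + shuf 1 B f = cobd 1 v" using f(4) by (auto simp: coh_def)
      from base_free_B_direct[OF odd B(1) f(1-3) this] show ?thesis by metis
    qed
  qed
  then show ?thesis by (rule that)
qed

context dihedral_cohomology
begin

lemma Bc: "homog 3 B" "cobd 1 B = 0"
  using B by (simp_all add: cocycle_def)

lemma der_0: "der 0 = 0"
  using der_scale[of 0 0] by simp

lemma der_diff: "der (F - G) = der F - der G"
  using der_add[of F "scale (-1) G"] der_scale[of "-1" G] by (simp add: scale_lin)

lemma der_sum: "der (sum f S) = (\<Sum>i\<in>S. der (f i))"
  by (induction S rule: infinite_finite_induct) (simp_all add: der_0 der_add del: plus_fun_apply)

lemma coh_der: "coh F G \<Longrightarrow> coh (der F) (der G)"
  by (auto simp: coh_def der_add der_del)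

lemma cocycle_der: "cocycle (Suc (Suc n)) F \<Longrightarrow> cocycle n (der F)"
  using der_cut[of n F] der_del[of F] by (auto simp: cocycle_def homog_iff_cut der_0)

text \<open>
  The kernel description, restricted to one degree; \<open>B\<close> shifts degrees by 3, so \<open>f\<close> disappears
  below degree 3.
\<close>

lemma kernel_homogeneous:
  assumes F: "cocycle n F" "coh (der F) 0"
  obtains t f where "base_free t" "base_free f" "cocycle n t"
    "if n < 3 then f = 0 else cocycle (n - 3) f"
    "coh F (t + shuf 1 B f)"
proof -
  obtain t f where t: "base_free t" "base_free f" "cobd 1 t = 0" "cobd 1 f = 0" "coh F (t + shuf 1 B f)"
    using der_kernel[of F] F by (auto simp: cocycle_def)
  let ?f = "if n < 3 then 0 else cut (n - 3) f"
  have "coh F (cut n t + shuf 1 B ?f)"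
    using coh_cut[OF t(5), of n] F(1) by (auto simp: cocycle_def cut_homog cut_shuf[OF Bc(1)])
  then show ?thesis
    using t by (intro that[of "cut n t" ?f]) (auto simp: base_free_cut cocycle_cut base_free_lin)
qed

lemma divided_power_sequence:
  obtains A where "A 0 = unit" "\<And>m. cocycle (2 * m) (A m)" "\<And>m. proj (A m) = A m"
    "\<And>m. coh (der (A (Suc m))) (A m)"
proof -
  let ?P = "\<lambda>m (F :: 'p dcochain). cocycle (2 * m) F \<and> proj F = F \<and> (m = 0 \<longrightarrow> F = unit)"
  have "\<exists>A. \<forall>m. ?P m (A m) \<and> coh (der (A (Suc m))) (A m)"
  proof (rule dependent_nat_choice)
    show "\<exists>F. ?P 0 F" by (rule exI[of _ unit]) (simp add: cocycle_unit proj_unit)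
    fix X :: "'p dcochain" and m assume X: "?P m X"
    obtain F where F: "cobd 1 F = 0" "coh (der F) X" using der_surj X by (auto simp: cocycle_def)
    let ?F = "cut (2 * Suc m) F"
    have "coh (der ?F) X"
      using coh_cut[OF F(2), of "2 * m"] der_cut[of "2 * m" F] X by (simp add: cocycle_def cut_homog)
    then have "coh (proj (der ?F)) X" using coh_proj[OF odd, of "der ?F" X] X by simp
    with der_proj[of ?F] have "coh (der (proj ?F)) X"
      using cocycle_cut[OF F(1), of "2 * Suc m"] coh_trans by (auto simp: cocycle_def)
    moreover have "cocycle (2 * Suc m) (proj ?F)"
      using cocycle_cut[OF F(1), of "2 * Suc m"] by (simp add: cocycle_def homog_proj flip: proj_cobd[OF odd])
    ultimately show "\<exists>Y. ?P (Suc m) Y \<and> coh (der Y) X"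
      by (intro exI[of _ "proj ?F"]) (simp add: proj_proj[OF odd])
  qed
  then obtain A where "\<forall>m. ?P m (A m) \<and> coh (der (A (Suc m))) (A m)" by blast
  then show ?thesis by (intro that[of A]) auto
qed

text \<open>
  \<open>F\<close> is cohomologous to \<open>t + B \<union> f\<close> with \<open>t\<close> and \<open>f\<close> without base point. Both have positive
  degree, that of \<open>f\<close> being odd, so \<open>proj\<close> kills them; but \<open>proj\<close> fixes the class of \<open>F\<close>.
\<close>

lemma fixed_class_zero:
  assumes F: "cocycle (2 * n) F" "n > 0" "coh (proj F) F" "coh (der F) 0"
  shows "coh F 0"
proof -
  obtain t f where t: "base_free t" "base_free f" "cocycle (2 * n) t"
  "if 2 * n < 3 then f = 0 else cocycle (2 * n - 3) f"
    "coh F (t + shuf 1 B f)" using kernel_homogeneous[OF F(1,4)] .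
  have "proj t = 0" by (rule proj_base_free_homog[OF t(1), of "2 * n"]) (use t(3) F(2) in \<open>auto simp: cocycle_def\<close>)
  moreover have "coh (proj (shuf 1 B f)) 0"
  proof (cases "2 * n < 3")
    case True
    then show ?thesis using t(4) by simp
  next
    case False
    then have f: "homog (2 * n - 3) f" "cobd 1 f = 0" using t(4) by (auto simp: cocycle_def)
    have "proj f = 0" by (rule proj_base_free_homog[OF t(2) f(1)]) (use False in presburger)
    then show ?thesis using proj_shuf_coh[OF odd Bc(2) f(2)] by simp
  qed
  ultimately have "coh (proj (t + shuf 1 B f)) 0" by simp
  with coh_proj[OF odd t(5)] have "coh (proj F) 0" by (rule coh_trans)
  with coh_sym[OF F(3)] show ?thesis by (rule coh_trans)
qed

text \<open>
  Both sides have the same derivative, by the Leibniz rule, the induction hypothesis and Pascal's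
  rule, and both are fixed by \<open>proj\<close>.
\<close>

lemma divided_powers:
  assumes A: "A 0 = unit" "\<And>m. cocycle (2 * m) (A m)" "\<And>m. proj (A m) = A m"
    "\<And>m. coh (der (A (Suc m))) (A m)"
  shows "coh (shuf 1 (A k) (A m)) (scale (of_nat ((k + m) choose k)) (A (k + m)))"
proof (induction "k + m" arbitrary: k m)
  case 0
  then show ?case by (simp add: A(1) unit_shuf)
next
  case (Suc n)
  show ?case
  proof (cases "k = 0 \<or> m = 0")
    case True
    then show ?thesis by (auto simp: A(1) unit_shuf shuf_unit)
  next
    case False
    then obtain k' m' where km: "k = Suc k'" "m = Suc m'" by (metis not0_implies_Suc)
    have d: "cobd 1 (A i) = 0" for i using A(2) by (simp add: cocycle_def)
    have n: "n = k' + m" "n = k + m'" "k + m = Suc n" using Suc(2) km by auto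
    let ?c = "\<lambda>i. of_nat (n choose i) :: 'p mod_ring"
    let ?F = "shuf 1 (A k) (A m) - scale (of_nat (Suc n choose k)) (A (Suc n))"
    have "coh (der (shuf 1 (A k) (A m))) (shuf 1 (der (A k)) (A m) + shuf 1 (A k) (der (A m)))"
      by (rule der_shuf[OF d d])
    also have "coh \<dots> (shuf 1 (A k') (A m) + shuf 1 (A k) (A m'))"
      unfolding km by (intro coh_add coh_shuf_left coh_shuf_right A(4) d)
    also have "coh \<dots> (scale (?c k') (A n) + scale (?c k) (A n))"
      using Suc(1)[of k' m] Suc(1)[of k m'] n by (intro coh_add) auto
    also have "scale (?c k') (A n) + scale (?c k) (A n) = scale (of_nat (Suc n choose k)) (A n)"
      by (simp add: km scale_lin)
    finally have "coh (der (shuf 1 (A k) (A m))) (scale (of_nat (Suc n choose k)) (A n))" .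
    then have "coh (der ?F) (scale (of_nat (Suc n choose k)) (A n) - scale (of_nat (Suc n choose k)) (A n))"
      unfolding der_diff der_scale by (intro coh_diff coh_scale A(4))
    then have "coh (der ?F) 0" by simp
    moreover have "cocycle (2 * Suc n) ?F"
    proof -
      have "2 * k + 2 * m = 2 * Suc n" using n(3) by simp
      then show ?thesis using cocycle_shuf[OF A(2)[of k] A(2)[of m]] A(2)[of "Suc n"]
        by (metis cocycle_lin(2,3))
    qed
    moreover have "coh (proj ?F) ?F"
      using proj_shuf_coh[OF odd d d, of k m] by (simp add: A(3) coh_diff)
    ultimately have "coh ?F 0" using fixed_class_zero[of "Suc n" ?F] by simp
    then show ?thesis unfolding n(3) by (rule coh_diff_0)
  qed
qed

end

section \<open>The cochains of the words and the basis theorem\<close>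

lemma word_degree_Cons:
  "word_degree ((m, e) # w) = 2 * m + 3 * e + (if w = [] then 0 else Suc (word_degree w))"
  by (cases w) auto

text \<open>
  The shift by \<open>k\<close> makes the degrees of the pieces in \<open>words_deg_decomp\<close> explicit without natural
  subtraction: \<open>words_deg k n\<close> is empty for \<open>n < k\<close>.
\<close>

definition words_deg :: "nat \<Rightarrow> nat \<Rightarrow> (nat \<times> nat) list set" where
  "words_deg k n = {w \<in> words. word_degree w + k = n}"

fun raise :: "(nat \<times> nat) list \<Rightarrow> (nat \<times> nat) list" where
  "raise [] = []"
| "raise ((m, e) # w) = (Suc m, e) # w"

lemma words_Cons: "(m, e) # w \<in> words \<longleftrightarrow> (e = 0 \<or> e = 1) \<and> (w = [] \<or> w \<in> words)"
  by (auto simp: words_def)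

lemma word_bounds: "w \<noteq> [] \<Longrightarrow> length w \<le> Suc (word_degree w) \<and> set w \<subseteq> {..word_degree w} \<times> {..word_degree w}"
proof (induction w)
  case (Cons a w)
  obtain m e where a: "a = (m, e)" by (cases a)
  show ?case
  proof (cases "w = []")
    case False
    then have "length w \<le> Suc (word_degree w)"
      "set w \<subseteq> {..word_degree w} \<times> {..word_degree w}"
      using Cons by auto
    then show ?thesis unfolding a using False by (force simp: word_degree_Cons)
  qed (auto simp: a word_degree_Cons)
qed simp

lemma finite_words_deg: "finite (words_deg k n)"
proof (rule finite_subset)
  show "words_deg k n \<subseteq> {w. set w \<subseteq> {..n} \<times> {..n} \<and> length w \<le> Suc n}"
  proof
    fix w assume "w \<in> words_deg k n"
    then have w: "w \<noteq> []" "word_degree w \<le> n" by (auto simp: words_deg_def words_def)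
    have "{..word_degree w} \<times> {..word_degree w} \<subseteq> {..n} \<times> {..n}" using w(2) by auto
    then show "w \<in> {w. set w \<subseteq> {..n} \<times> {..n} \<and> length w \<le> Suc n}"
      using word_bounds[OF w(1)] w(2) by auto
  qed
  show "finite {w. set w \<subseteq> {..n} \<times> {..n} \<and> length w \<le> Suc n}"
    by (rule finite_lists_length_le) simp
qed

lemma words_deg_shift: "words_deg k (k + n) = words_deg 0 n" "n < k \<Longrightarrow> words_deg k n = {}"
  by (auto simp: words_deg_def)

text \<open>
  The five parts are the words with positive first exponent and then \<open>1\<close>, \<open>P w\<close>, \<open>B\<close> and \<open>B \<union> P w\<close>:
  the image of a section of the derivation and the generators of its kernel.
\<close>

lemma words_deg_decomp:
  "words_deg 0 n = raise ` words_deg 2 n \<union> ((if n = 0 then {[(0, 0)]} else {}) \<union> (Cons (0, 0) ` words_deg 1 n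
     \<union> ((if n = 3 then {[(0, 1)]} else {}) \<union> Cons (0, 1) ` words_deg 4 n)))"
proof (rule Set.set_eqI, rule iffI)
  fix w assume w: "w \<in> words_deg 0 n"
  then obtain m e v where w': "w = (m, e) # v" by (cases w) (auto simp: words_deg_def words_def)
  show "w \<in> raise ` words_deg 2 n \<union> ((if n = 0 then {[(0, 0)]} else {}) \<union> (Cons (0, 0) ` words_deg 1 n
     \<union> ((if n = 3 then {[(0, 1)]} else {}) \<union> Cons (0, 1) ` words_deg 4 n)))"
  proof (cases m)
    case 0
    then show ?thesis using w by (auto simp: w' words_deg_def words_Cons word_degree_Cons split: if_splits)
  next
    case (Suc m')
    have "w = raise ((m', e) # v)" "(m', e) # v \<in> words_deg 2 n"
      using w by (auto simp: w' Suc words_deg_def words_Cons word_degree_Cons)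
    then show ?thesis by blast
  qed
next
  fix w assume "w \<in> raise ` words_deg 2 n \<union> ((if n = 0 then {[(0, 0)]} else {}) \<union> (Cons (0, 0) ` words_deg 1 n
     \<union> ((if n = 3 then {[(0, 1)]} else {}) \<union> Cons (0, 1) ` words_deg 4 n)))"
  then consider v where "v \<in> words_deg 2 n" "w = raise v" | "n = 0" "w = [(0, 0)]"
    | v where "v \<in> words_deg 1 n" "w = (0, 0) # v" | "n = 3" "w = [(0, 1)]"
    | v where "v \<in> words_deg 4 n" "w = (0, 1) # v" by (auto split: if_splits)
  then show "w \<in> words_deg 0 n"
  proof cases
    case (1 v)
    then obtain m e v' where "v = (m, e) # v'" by (cases v) (auto simp: words_deg_def words_def)
    then show ?thesis using 1 by (auto simp: words_deg_def words_Cons word_degree_Cons)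
  qed (auto simp: words_deg_def words_Cons word_degree_Cons, auto simp: words_def)
qed

lemma sum_words_deg:
  fixes h :: "(nat \<times> nat) list \<Rightarrow> 'b::comm_monoid_add"
  shows "(\<Sum>w\<in>words_deg 0 n. h w) = (\<Sum>w\<in>words_deg 2 n. h (raise w)) + ((if n = 0 then h [(0, 0)] else 0)
     + ((\<Sum>v\<in>words_deg 1 n. h ((0, 0) # v)) + ((if n = 3 then h [(0, 1)] else 0)
     + (\<Sum>v\<in>words_deg 4 n. h ((0, 1) # v)))))"
proof -
  have ne: "v \<noteq> []" if "v \<in> words_deg k n" for v k using that by (auto simp: words_deg_def words_def)
  have inj: "inj_on raise (words_deg 2 n)"
  proof (rule inj_onI)
    fix v w assume "v \<in> words_deg 2 n" "w \<in> words_deg 2 n" "raise v = raise w"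
    then show "v = w" using ne[of v 2] ne[of w 2] by (cases v; cases w) auto
  qed
  have R: "\<exists>m e v'. w = (Suc m, e) # v'" if w: "w \<in> raise ` words_deg 2 n" for w
  proof -
    obtain v where "v \<in> words_deg 2 n" "w = raise v" using w by blast
    then show ?thesis using ne[of v 2] by (cases v) auto
  qed
  have s: "sum h (raise ` words_deg 2 n) = (\<Sum>w\<in>words_deg 2 n. h (raise w))"
    by (simp add: sum.reindex[OF inj])
  have c: "sum h (Cons a ` words_deg k n) = (\<Sum>v\<in>words_deg k n. h (a # v))" for a k
    by (subst sum.reindex) (auto simp: inj_on_def)
  have i: "sum h (if P then {w} else {}) = (if P then h w else 0)" for P w by simp
  define R P0 C0 P3 C1 where "R = raise ` words_deg 2 n"
    and "P0 = (if n = 0 then {[(0, 0)]} else {} :: (nat \<times> nat) list set)"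
    and "C0 = Cons (0, 0) ` words_deg 1 n"
    and "P3 = (if n = 3 then {[(0, 1)]} else {} :: (nat \<times> nat) list set)"
    and "C1 = Cons (0, 1) ` words_deg 4 n"
  note defs = R_def P0_def C0_def P3_def C1_def
  have fin: "finite R" "finite P0" "finite C0" "finite P3" "finite C1"
    by (simp_all add: defs finite_words_deg)
  have hR: "fst (hd w) \<noteq> 0" if "w \<in> R" for w using R[of w] that by (auto simp: defs)
  have hP: "w \<in> P0 \<Longrightarrow> fst (hd w) = 0 \<and> snd (hd w) = 0 \<and> tl w = []"
    "w \<in> P3 \<Longrightarrow> fst (hd w) = 0 \<and> snd (hd w) = 1 \<and> tl w = []" for w
    by (auto simp: defs split: if_splits)
  have hC: "w \<in> C0 \<Longrightarrow> fst (hd w) = 0 \<and> snd (hd w) = 0 \<and> tl w \<noteq> []"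
    "w \<in> C1 \<Longrightarrow> fst (hd w) = 0 \<and> snd (hd w) = 1 \<and> tl w \<noteq> []" for w
    by (auto simp: defs dest: ne)
  have dis: "R \<inter> (P0 \<union> (C0 \<union> (P3 \<union> C1))) = {}"
    "P0 \<inter> (C0 \<union> (P3 \<union> C1)) = {}"
    "C0 \<inter> (P3 \<union> C1) = {}" "P3 \<inter> C1 = {}"
    by (auto dest!: hR hP hC)
  have "(\<Sum>w\<in>words_deg 0 n. h w) = sum h (R \<union> (P0 \<union> (C0 \<union> (P3 \<union> C1))))"
    unfolding words_deg_decomp[of n] defs ..
  also have "\<dots> = sum h R + (sum h P0 + (sum h C0 + (sum h P3 + sum h C1)))"
    by (simp only: sum.union_disjoint fin finite_UnI dis)
  finally show ?thesis unfolding defs s c i .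
qed

text \<open>
  The empty list is not a word; its value is a default.
\<close>

fun word_cochain :: "(nat \<Rightarrow> 'p::prime_card dcochain) \<Rightarrow> 'p dcochain \<Rightarrow> (nat \<times> nat) list \<Rightarrow> 'p dcochain" where
  "word_cochain A B [] = 0"
| "word_cochain A B ((m, e) # w) = shuf 1 (A m) (shuf 1 (if e = 0 then unit else B) (if w = [] then unit else drop_base (word_cochain A B w)))"

locale divided_power_data = dihedral_cohomology B der
  for B :: "'p::prime_card dcochain" and der +
  fixes A :: "nat \<Rightarrow> 'p dcochain"
  assumes A_0: "A 0 = unit"
    and A_cyc: "cocycle (2 * m) (A m)"
    and A_der: "coh (der (A (Suc m))) (A m)"
begin

abbreviation "W \<equiv> word_cochain A B"

definition tail :: "(nat \<times> nat) list \<Rightarrow> 'p dcochain" where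
  "tail w = (if w = [] then unit else drop_base (W w))"

lemma W_Cons: "W ((m, e) # w) = shuf 1 (A m) (shuf 1 (if e = 0 then unit else B) (tail w))"
  by (simp add: tail_def)

lemma W_0_Cons: "W ((0, 0) # w) = tail w" "W ((0, 1) # w) = shuf 1 B (tail w)"
  by (simp_all add: W_Cons A_0 unit_shuf del: word_cochain.simps)

lemma cocycle_W: "w \<in> words \<Longrightarrow> cocycle (word_degree w) (W w)"
proof (induction w)
  case (Cons a w)
  obtain m e where a: "a = (m, e)" by (cases a)
  have e: "e = 0 \<or> e = 1" using Cons(2) by (auto simp: a words_Cons)
  have t: "cocycle (if w = [] then 0 else Suc (word_degree w)) (tail w)"
  proof (cases "w = []")
    case False
    then have "w \<in> words" using Cons(2) by (auto simp: a words_Cons)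
    then show ?thesis using Cons(1) False by (simp add: tail_def cocycle_drop_base[OF odd])
  qed (simp add: tail_def cocycle_unit)
  have "cocycle (3 * e) (if e = 0 then unit else B)" using e B by (auto simp: cocycle_unit)
  from cocycle_shuf[OF A_cyc[of m] cocycle_shuf[OF this t]] show ?case
    unfolding a W_Cons word_degree_Cons by (simp add: add.assoc)
qed (simp add: words_def)

lemma cocycle_tail: "w = [] \<or> w \<in> words \<Longrightarrow> cocycle (if w = [] then 0 else Suc (word_degree w)) (tail w)"
  using cocycle_W[of w] by (auto simp: tail_def cocycle_unit cocycle_drop_base[OF odd] words_def)

lemma base_free_tail: "base_free (tail w)"
  by (simp add: tail_def base_free_lin base_free_drop_base)

text \<open>
  The tail of a word and \<open>B\<close> have derivative zero, so by the Leibniz rule the derivative acts on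
  the first factor \<open>A m\<close> only.
\<close>

lemma der_W:
  assumes "(m, e) # w \<in> words"
  shows "coh (der (W ((m, e) # w))) (if m = 0 then 0 else W ((m - 1, e) # w))"
proof -
  have w: "w = [] \<or> w \<in> words" using assms by (auto simp: words_Cons)
  have t: "cobd 1 (tail w) = 0" using cocycle_tail[OF w] by (simp add: cocycle_def)
  let ?g = "shuf 1 (if e = 0 then unit else B) (tail w)"
  have g: "cobd 1 ?g = 0" using cobd_shuf[of 1 1 B "tail w"] t Bc(2) by (simp add: unit_shuf)
  have dg: "coh (der ?g) 0"
  proof (cases "e = 0")
    case True
    then show ?thesis using der_base_free[OF base_free_tail t] by (simp add: unit_shuf)
  next
    case False
    have "coh (der (shuf 1 B (tail w))) (shuf 1 (der B) (tail w) + shuf 1 B (der (tail w)))"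
      by (rule der_shuf[OF Bc(2) t])
    also have "coh \<dots> (shuf 1 0 (tail w) + shuf 1 B 0)"
      by (intro coh_add coh_shuf_left coh_shuf_right der_B der_base_free[OF base_free_tail t] t Bc(2))
    finally show ?thesis using False by simp
  qed
  show ?thesis
  proof (cases m)
    case 0
    then show ?thesis using dg by (simp add: W_Cons A_0 unit_shuf del: word_cochain.simps)
  next
    case (Suc m')
    have dA: "cobd 1 (A i) = 0" for i using A_cyc by (simp add: cocycle_def)
    have "coh (der (shuf 1 (A m) ?g)) (shuf 1 (der (A m)) ?g + shuf 1 (A m) (der ?g))"
      by (rule der_shuf[OF dA g])
    also have "coh \<dots> (shuf 1 (A m') ?g + shuf 1 (A m) 0)"
      unfolding Suc by (intro coh_add coh_shuf_left coh_shuf_right A_der dg g dA)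
    finally show ?thesis by (simp add: Suc W_Cons del: word_cochain.simps)
  qed
qed

lemma der_W_raise: "w \<in> words \<Longrightarrow> coh (der (W (raise w))) (W w)"
  using der_W[of "Suc (fst (hd w))" "snd (hd w)" "tl w"]
  by (cases w) (auto simp: words_def words_Cons simp del: word_cochain.simps)

definition word_comb :: "nat \<Rightarrow> nat \<Rightarrow> ((nat \<times> nat) list \<Rightarrow> 'p mod_ring) \<Rightarrow> 'p dcochain" where
  "word_comb k n c = (\<Sum>w\<in>words_deg k n. scale (c w) (W w))"

lemma cocycle_word_comb: "cocycle n (word_comb 0 n c)"
  unfolding word_comb_def by (intro cocycle_sum cocycle_lin) (auto simp: words_deg_def dest: cocycle_W)

definition word_span :: "nat \<Rightarrow> 'p dcochain \<Rightarrow> bool" where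
  "word_span n F \<longleftrightarrow> (\<exists>c. coh F (word_comb 0 n c))"

lemma word_span_coh: "coh F G \<Longrightarrow> word_span n G \<Longrightarrow> word_span n F"
  unfolding word_span_def by (blast intro: coh_trans)

lemma word_comb_add: "word_comb k n c + word_comb k n c' = word_comb k n (\<lambda>w. c w + c' w)"
  unfolding word_comb_def sum.distrib[symmetric] by (simp add: scale_lin)

lemma scale_sum: "scale a (sum f S) = (\<Sum>i\<in>S. scale a (f i))" for f :: "'i \<Rightarrow> 'p dcochain"
  by (induction S rule: infinite_finite_induct) (simp_all add: scale_lin del: plus_fun_apply scale_apply)

lemma drop_base_sum: "drop_base (sum f S) = (\<Sum>i\<in>S. drop_base (f i))" for f :: "'i \<Rightarrow> 'p dcochain"
  by (induction S rule: infinite_finite_induct) (simp_all del: plus_fun_apply)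

lemma shuf_sum: "shuf 1 F (sum f S) = (\<Sum>i\<in>S. shuf 1 F (f i))" for f :: "'i \<Rightarrow> 'p dcochain"
  by (induction S rule: infinite_finite_induct) (simp_all del: plus_fun_apply)

lemma word_span_add: "word_span n F \<Longrightarrow> word_span n G \<Longrightarrow> word_span n (F + G)"
  unfolding word_span_def by (metis coh_add word_comb_add)

lemma word_span_scale: "word_span n F \<Longrightarrow> word_span n (scale a F)"
proof -
  assume "word_span n F"
  then obtain c where "coh F (word_comb 0 n c)" by (auto simp: word_span_def)
  then have "coh (scale a F) (word_comb 0 n (\<lambda>w. a * c w))"
    using coh_scale[of F "word_comb 0 n c" a] by (simp add: word_comb_def scale_sum)
  then show ?thesis by (auto simp: word_span_def)
qed

lemma word_span_0: "word_span n 0"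
  unfolding word_span_def by (rule exI[of _ "\<lambda>_. 0"]) (simp add: word_comb_def)

lemma word_span_sum: "(\<And>i. i \<in> S \<Longrightarrow> word_span n (f i)) \<Longrightarrow> word_span n (sum f S)"
  by (induction S rule: infinite_finite_induct) (auto intro: word_span_0 word_span_add simp del: plus_fun_apply)

lemma word_span_W: "w \<in> words_deg 0 n \<Longrightarrow> word_span n (W w)"
proof -
  assume w: "w \<in> words_deg 0 n"
  have "word_comb 0 n (\<lambda>v. if v = w then 1 else 0) = (\<Sum>v\<in>words_deg 0 n. if v = w then W v else 0)"
    unfolding word_comb_def by (rule sum.cong) auto
  also have "\<dots> = W w" using w finite_words_deg[of 0 n] by (simp add: sum.delta)
  finally show ?thesis unfolding word_span_def by (metis coh_refl)
qed

lemma word_span_drop_base: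
  assumes "word_span n F" shows "word_span (Suc n) (drop_base F)"
proof -
  obtain c where "coh F (word_comb 0 n c)" using assms by (auto simp: word_span_def)
  then have "coh (drop_base F) (drop_base (word_comb 0 n c))" by (rule coh_drop_base[OF odd])
  moreover have "word_span (Suc n) (drop_base (word_comb 0 n c))"
    unfolding word_comb_def drop_base_sum drop_base_lin
  proof (intro word_span_sum word_span_scale)
    fix w assume w: "w \<in> words_deg 0 n"
    then have "w \<noteq> []" by (auto simp: words_deg_def words_def)
    then have "drop_base (W w) = W ((0, 0) # w)" by (simp add: W_0_Cons tail_def del: word_cochain.simps)
    moreover have "(0, 0) # w \<in> words_deg 0 (Suc n)" using w \<open>w \<noteq> []\<close> by (auto simp: words_deg_def words_Cons word_degree_Cons)
    ultimately show "word_span (Suc n) (drop_base (W w))" by (metis word_span_W)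
  qed
  ultimately show ?thesis by (rule word_span_coh)
qed

lemma word_span_B_drop_base:
  assumes "word_span n F" shows "word_span (n + 4) (shuf 1 B (drop_base F))"
proof -
  obtain c where "coh F (word_comb 0 n c)" using assms by (auto simp: word_span_def)
  then have "coh (shuf 1 B (drop_base F)) (shuf 1 B (drop_base (word_comb 0 n c)))"
    by (intro coh_shuf_right coh_drop_base[OF odd] Bc(2))
  moreover have "word_span (n + 4) (shuf 1 B (drop_base (word_comb 0 n c)))"
    unfolding word_comb_def drop_base_sum drop_base_lin shuf_sum shuf_scale_right
  proof (intro word_span_sum word_span_scale)
    fix w assume w: "w \<in> words_deg 0 n"
    then have "w \<noteq> []" by (auto simp: words_deg_def words_def)
    then have "shuf 1 B (drop_base (W w)) = W ((0, 1) # w)" by (simp add: W_0_Cons(2)[unfolded One_nat_def] tail_def del: word_cochain.simps)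
    moreover have "(0, 1) # w \<in> words_deg 0 (n + 4)" using w \<open>w \<noteq> []\<close> by (auto simp: words_deg_def words_Cons word_degree_Cons)
    ultimately show "word_span (n + 4) (shuf 1 B (drop_base (W w)))" by (metis word_span_W)
  qed
  ultimately show ?thesis by (rule word_span_coh)
qed

text \<open>
  Refines \<open>base_free_decomp\<close>: inserting the base point preserves cocycles, so the preimage under
  \<open>P\<close> is again a cocycle.
\<close>

lemma base_free_cocycle_cases:
  assumes "base_free t" "cocycle n t"
  obtains a where "n = 0" "t = scale a unit" | m X where "n = Suc m" "cocycle m X" "t = drop_base X"
proof (cases n)
  case 0
  have "insert_base t = 0" using assms(2) 0 by (intro ext) (simp add: insert_base_def cocycle_def homog_def)
  then have "t = scale (t 0 []) unit" using base_free_decomp[OF assms(1)] by simp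
  then show ?thesis using that(1)[OF 0] by blast
next
  case (Suc m)
  have "t 0 [] = 0" using assms(2) Suc by (simp add: cocycle_def homog_def)
  then have t: "t = drop_base (dsign (insert_base t))" using base_free_decomp[OF assms(1)] by simp
  have "homog m (insert_base t)" using assms(2) Suc by (simp add: insert_base_def cocycle_def homog_def)
  moreover have "cobd 1 (insert_base t) = 0"
  proof -
    have "insert_base (cobd 1 t) = - cobd 1 (insert_base t)" by (simp add: insert_base_cobd)
    moreover have "cobd 1 t = 0" using assms(2) by (simp add: cocycle_def)
    ultimately show ?thesis by simp
  qed
  ultimately have "cocycle m (dsign (insert_base t))" by (simp add: cocycle_def homog_dsign)
  then show ?thesis using that(2)[OF Suc _ t] by blast
qed

text \<open>
  Induction on the degree: \<open>der F\<close> is a combination of words, and raising the first exponents gives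
  a combination \<open>G\<close> with the same derivative. Then \<open>F - G\<close> lies in the kernel of \<open>der\<close>, whose
  elements come from words of lower degree through \<open>P\<close> and \<open>B\<close>.
\<close>

theorem span: "cocycle n F \<Longrightarrow> word_span n F"
proof (induction n arbitrary: F rule: less_induct)
  case (less n)
  obtain G where G: "word_span n G" "cocycle n G" "coh (der G) (der F)"
  proof (cases "n < 2")
    case True
    then have "der F = 0" using der_low[of n F] less(2) by (simp add: cocycle_def)
    then show ?thesis using that[of 0] by (simp add: word_span_0 cocycle_lin der_0)
  next
    case False
    then have "n = Suc (Suc (n - 2))" by simp
    then obtain k where k: "n = Suc (Suc k)" by blast
    have "cocycle k (der F)" using cocycle_der less(2) k by simp
    then have "word_span k (der F)" using less(1)[of k] k by simp
    then obtain c where c: "coh (der F) (word_comb 0 k c)" by (auto simp: word_span_def)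
    have up: "raise w \<in> words_deg 0 n" if "w \<in> words_deg 0 k" for w
      unfolding words_deg_decomp[of n] using that words_deg_shift(1)[of 2 k] k by simp
    \<comment> \<open>lift of \<open>der F\<close>\<close>
    let ?G = "\<Sum>w\<in>words_deg 0 k. scale (c w) (W (raise w))"
    show ?thesis
    proof (rule that[of ?G])
      show "word_span n ?G" by (intro word_span_sum word_span_scale word_span_W up)
      show "cocycle n ?G" using up by (intro cocycle_sum cocycle_lin) (auto simp: words_deg_def dest: cocycle_W)
      have "coh (der ?G) (word_comb 0 k c)"
        unfolding der_sum der_scale word_comb_def
        by (intro coh_sum coh_scale der_W_raise) (auto simp: words_deg_def)
      then show "coh (der ?G) (der F)" using coh_sym[OF c] by (rule coh_trans)
    qed
  qed
  have "cocycle n (F - G)" using less(2) G(2) by (rule cocycle_lin)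
  moreover have "coh (der (F - G)) 0"
    using coh_diff[OF coh_refl[of "der F"] G(3)] by (simp add: der_diff)
  ultimately obtain t f where t: "base_free t" "base_free f" "cocycle n t"
  "if n < 3 then f = 0 else cocycle (n - 3) f"
    "coh (F - G) (t + shuf 1 B f)" by (rule kernel_homogeneous)
  have "word_span n t"
    using t(1,3)
  proof (cases rule: base_free_cocycle_cases)
    case (1 a)
    have "[(0, 0)] \<in> words_deg 0 n" using 1 by (simp add: words_deg_def words_def)
    from word_span_scale[OF word_span_W[OF this], of a] show ?thesis using 1 by (simp add: A_0 shuf_unit)
  next
    case (2 m X)
    then show ?thesis using word_span_drop_base less(1)[of m X] by simp
  qed
  moreover have "word_span n (shuf 1 B f)"
  proof (cases "n < 3")
    case True
    then show ?thesis using t(4) by (simp add: word_span_0)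
  next
    case False
    then have "cocycle (n - 3) f" using t(4) by simp
    with t(2) show ?thesis
    proof (cases rule: base_free_cocycle_cases)
      case (1 a)
      then have "[(0, 1)] \<in> words_deg 0 n" using False by (simp add: words_deg_def words_def)
      from word_span_scale[OF word_span_W[OF this], of a] show ?thesis using 1 by (simp add: A_0 shuf_unit unit_shuf)
    next
      case (2 m X)
      then have "n = m + 4" by simp
      then show ?thesis using word_span_B_drop_base[of m X] less(1)[of m X] 2 by simp
    qed
  qed
  ultimately have "word_span n (F - G)" using word_span_coh[OF t(5)] word_span_add by blast
  from word_span_add[OF this G(1)] show ?case by simp
qed

text \<open>
  \<open>P\<close> is injective on cohomology: inserting the base point inverts it up to sign.
\<close>

lemma drop_base_exact:
  assumes "drop_base X = cobd 1 t" shows "coh X 0"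
proof -
  have "dsign X = - cobd 1 (insert_base t)" using arg_cong[OF assms, of insert_base] by (simp add: insert_base_drop_base insert_base_cobd)
  then have "dsign (dsign X) = dsign (- cobd 1 (insert_base t))" by simp
  then have "X = 0 + cobd 1 (dsign (insert_base t))" by simp
  then show ?thesis by (rule cohI)
qed

text \<open>
  The derivative of a relation is a relation between the words with lowered first exponent, so by
  induction only words with first exponent zero occur. These split into a part \<open>t\<close> and a part
  \<open>B \<union> f\<close>, and both reduce to relations of lower degree because \<open>P\<close> is injective.
\<close>

theorem independent: "coh (word_comb 0 n c) 0 \<Longrightarrow> w \<in> words_deg 0 n \<Longrightarrow> c w = 0"
proof (induction n arbitrary: c w rule: less_induct)
  case (less n)
  have IH: "c' v = 0" if "coh (word_comb k n c') 0" "v \<in> words_deg k n" "k > 0" for k c' v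
  proof (cases "k \<le> n")
    case True
    then obtain j where j: "n = k + j" using le_Suc_ex by blast
    then show ?thesis using less(1)[of j c' v] that by (simp add: word_comb_def words_deg_shift(1))
  next
    case False
    then show ?thesis using that words_deg_shift(2)[of n k] by simp
  qed
  have dec: "word_comb 0 n c = word_comb' + ((if n = 0 then scale (c [(0, 0)]) unit else 0)
     + (drop_base X0 + ((if n = 3 then scale (c [(0, 1)]) B else 0) + shuf 1 B (drop_base X1))))"
    if "word_comb' = (\<Sum>w\<in>words_deg 2 n. scale (c (raise w)) (W (raise w)))"
      "X0 = word_comb 1 n (\<lambda>v. c ((0, 0) # v))"
      "X1 = word_comb 4 n (\<lambda>v. c ((0, 1) # v))" for word_comb' X0 X1
  proof -
    have ne: "v \<noteq> []" if "v \<in> words_deg k n" for v k using that by (auto simp: words_deg_def words_def)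
    have 0: "(\<Sum>v\<in>words_deg 1 n. scale (c ((0, 0) # v)) (W ((0, 0) # v))) = drop_base X0"
      unfolding that word_comb_def drop_base_sum drop_base_lin
      by (rule sum.cong) (auto simp: W_0_Cons tail_def ne simp del: word_cochain.simps)
    have 1: "(\<Sum>v\<in>words_deg 4 n. scale (c ((0, 1) # v)) (W ((0, 1) # v))) = shuf 1 B (drop_base X1)"
      unfolding that word_comb_def drop_base_sum drop_base_lin shuf_sum shuf_scale_right W_0_Cons(2)
      by (rule sum.cong) (auto simp: tail_def dest: ne)
    have 2: "W [(0, 0)] = unit" "W [(0, 1)] = B" by (simp_all add: A_0 unit_shuf shuf_unit)
    show ?thesis unfolding word_comb_def[of 0] sum_words_deg[of _ n] 0 1 2 that(1) ..
  qed
  define word_comb' where "word_comb' = (\<Sum>w\<in>words_deg 2 n. scale (c (raise w)) (W (raise w)))"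
  define X0 where "X0 = word_comb 1 n (\<lambda>v. c ((0, 0) # v))"
  define X1 where "X1 = word_comb 4 n (\<lambda>v. c ((0, 1) # v))"
  define a b where "a = (if n = 0 then c [(0, 0)] else 0)" and "b = (if n = 3 then c [(0, 1)] else 0)"
  define t f where "t = scale a unit + drop_base X0" and "f = scale b unit + drop_base X1"
  have dec': "word_comb 0 n c = word_comb' + (t + shuf 1 B f)"
    using dec[OF word_comb'_def X0_def X1_def]
    by (simp add: t_def f_def a_def b_def shuf_unit add.assoc del: plus_fun_apply)
  have delX: "cobd 1 X0 = 0" "cobd 1 X1 = 0"
  proof -
    have "cobd 1 (word_comb k n c') = 0" for k c'
    proof (cases "k \<le> n")
      case True
      then obtain j where "n = k + j" using le_Suc_ex by blast
      then show ?thesis using cocycle_word_comb[of j c'] by (simp add: word_comb_def words_deg_shift(1) cocycle_def)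
    next
      case False
      then show ?thesis by (simp add: word_comb_def words_deg_shift(2))
    qed
    then show "cobd 1 X0 = 0" "cobd 1 X1 = 0" by (simp_all add: X0_def X1_def)
  qed
  have yt: "base_free t" "base_free f" by (auto simp: t_def f_def intro!: base_free_lin base_free_drop_base)
  have dt: "cobd 1 t = 0" "cobd 1 f = 0" by (simp_all add: t_def f_def cobd_drop_base[OF odd] delX)
  have dtf: "coh (der (t + shuf 1 B f)) 0"
  proof -
    have "coh (der (shuf 1 B f)) (shuf 1 (der B) f + shuf 1 B (der f))" by (rule der_shuf[OF Bc(2) dt(2)])
    also have "coh \<dots> (shuf 1 0 f + shuf 1 B 0)"
      by (intro coh_add coh_shuf_left coh_shuf_right der_B der_base_free[OF yt(2) dt(2)] dt Bc(2))
    finally have "coh (der t + der (shuf 1 B f)) (0 + (shuf 1 0 f + shuf 1 B 0))"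
      by (intro coh_add der_base_free[OF yt(1) dt(1)])
    then show ?thesis by (simp add: der_add)
  qed
  have "coh (word_comb 2 n (\<lambda>w. c (raise w))) (der word_comb')"
    unfolding word_comb_def word_comb'_def der_sum der_scale
    by (intro coh_sum coh_scale coh_sym[OF der_W_raise]) (auto simp: words_deg_def)
  also have "coh (der word_comb') 0"
  proof -
    have e: "word_comb' = word_comb 0 n c - (t + shuf 1 B f)" by (simp add: dec')
    have "coh (der (word_comb 0 n c)) (der 0)" by (rule coh_der[OF less(2)])
    then have "coh (der (word_comb 0 n c) - der (t + shuf 1 B f)) (der 0 - 0)" using dtf by (rule coh_diff)
    then show ?thesis by (simp add: e der_diff der_0)
  qed
  finally have l2: "coh (word_comb 2 n (\<lambda>w. c (raise w))) 0" .
  have c2: "c (raise v) = 0" if "v \<in> words_deg 2 n" for v by (rule IH[OF l2 that]) simp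
  then have "word_comb' = 0" unfolding word_comb'_def by (intro sum.neutral) simp
  then have "word_comb 0 n c = t + shuf 1 B f" using dec' by (simp del: plus_fun_apply)
  then have "coh (t + shuf 1 B f) 0" using less(2) by (simp only:)
  then obtain t' f' where tf: "t = cobd 1 t'" "f = cobd 1 f'" using direct[OF yt dt(2)] by blast
  have ab: "a = 0" "b = 0"
    using arg_cong[OF tf(1), of "\<lambda>F. F 0 []"] arg_cong[OF tf(2), of "\<lambda>F. F 0 []"]
    by (simp_all add: t_def f_def unit_def drop_base_def)
  have "drop_base X0 = cobd 1 t'" "drop_base X1 = cobd 1 f'" using tf by (simp_all add: t_def f_def ab)
  then have "coh X0 0" "coh X1 0" by (blast intro: drop_base_exact)+
  then have l0: "coh (word_comb 1 n (\<lambda>v. c ((0, 0) # v))) 0" and l1: "coh (word_comb 4 n (\<lambda>v. c ((0, 1) # v))) 0"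
    unfolding X0_def X1_def .
  have c01: "c ((0, 0) # v) = 0" if "v \<in> words_deg 1 n" for v by (rule IH[OF l0 that]) simp
  have c11: "c ((0, 1) # v) = 0" if "v \<in> words_deg 4 n" for v by (rule IH[OF l1 that]) simp
  from less(3) show ?case
    unfolding words_deg_decomp using c2 c01 c11 ab by (auto simp: a_def b_def split: if_splits)
qed

end

section \<open>Comparison with the rack complex\<close>

definition unrev :: "('a, 'k) cochain \<Rightarrow> ('a, 'k) rack_cochain" where
  "unrev F z = F (fst z) (rev (snd z))"

lemma unrev_surj: "\<exists>F. f = unrev F"
  by (rule exI[of _ "\<lambda>y r. f (y, rev r)"]) (auto simp: unrev_def fun_eq_iff)

lemma unrev_lin:
  "unrev (F + G) = (\<lambda>z. unrev F z + unrev G z)"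
  "unrev (F - G) = (\<lambda>z. unrev F z - unrev G z)"
  "unrev (scale c F) = (\<lambda>z. c * unrev F z)" "unrev 0 = (\<lambda>_. 0)"
  by (auto simp: unrev_def fun_eq_iff)

lemma unrev_inject: "unrev F = unrev G \<longleftrightarrow> F = G"
proof
  assume e: "unrev F = unrev G"
  show "F = G"
  proof (intro ext)
    fix y r show "F y r = G y r" using fun_cong[OF e, of "(y, rev r)"] by (simp add: unrev_def)
  qed
qed simp

lemma unrev_cochains: "unrev F \<in> cochains n \<longleftrightarrow> homog n F"
proof
  assume "unrev F \<in> cochains n"
  then have "unrev F (y, rev r) = 0" if "length r \<noteq> n" for y r
    using that by (simp add: cochains_def)
  then show "homog n F" by (simp add: homog_def unrev_def)
qed (auto simp: cochains_def homog_def unrev_def)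

text \<open>
  The last letter is the head of the reversed word, where the recursions for \<open>cobd\<close> and \<open>shuf\<close>
  proceed.
\<close>

definition snocs :: "'a \<Rightarrow> 'a rack_symbol \<Rightarrow> 'a rack_symbol" where
  "snocs x z = (fst z, snd z @ [x])"

definition reflz :: "'a::comm_ring_1 \<Rightarrow> 'a rack_symbol \<Rightarrow> 'a rack_symbol" where
  "reflz x z = (2 * x - fst z, map (\<lambda>a. 2 * x - a) (snd z))"

lemma unrev_snocs: "unrev F (snocs x z) = unrev (fix_last F x) z"
  by (simp add: unrev_def snocs_def fix_last_def)

lemma unrev_reflz: "unrev F (reflz x z) = unrev (reflect 1 F x) z"
  by (simp add: unrev_def reflz_def reflect_def rev_map)

lemma unrev_dsign: "unrev (dsign F) z = (-1) ^ length (snd z) * unrev F z"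
  by (simp add: unrev_def dsign_def)

lemma length_snocs: "length (snd (snocs x z)) = Suc (length (snd z))"
  by (simp add: snocs_def)

lemma length_faces:
  assumes "1 \<le> i" "i \<le> length (snd z)"
  shows "length (snd (face0 i z)) = length (snd z) - 1" "length (snd (face1 s i z)) = length (snd z) - 1"
  using assms by (auto simp: face0_def face1_def Let_def)

lemma faces_snocs:
  assumes "1 \<le> i" "i \<le> length (snd z)"
  shows "face0 i (snocs x z) = snocs x (face0 i z)" "face1 s i (snocs x z) = snocs x (face1 s i z)"
  using assms by (auto simp: face0_def face1_def snocs_def Let_def nth_append)

lemma faces_last:
  "face0 (Suc (length (snd z))) (snocs x z) = z"
  "face1 dihedral (Suc (length (snd z))) (snocs x z) = reflz x z"
  by (auto simp: face0_def face1_def snocs_def reflz_def Let_def dihedral_def)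

lemma face1_reflz:
  assumes "1 \<le> i" "i \<le> length (snd z)"
  shows "face1 dihedral i (reflz x z) = reflz x (face1 dihedral i z)"
  using assms
  by (auto simp: face1_def reflz_def Let_def dihedral_def take_map drop_map algebra_simps)

lemma coboundary_unrev: "coboundary dihedral (unrev F) = unrev (cobd 1 F)"
proof
  fix z :: "'a rack_symbol"
  have "(\<Sum>i = 1..length (snd z). (-1) ^ i * (unrev F (face0 i z) - unrev F (face1 dihedral i z)))
      = unrev (cobd 1 F) z" if "snd z = rev r" for r F and z :: "'a rack_symbol"
    using that
  proof (induction r arbitrary: F z)
    case (Cons x r)
    define y w where "y = fst z" and "w = (y, rev r)"
    have z: "z = snocs x w" using Cons(2) by (cases z) (simp add: w_def y_def snocs_def)
    have l: "length (snd w) = length r" by (simp add: w_def)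
    have "(\<Sum>i = 1..length (snd w). (-1) ^ i * (unrev F (face0 i z) - unrev F (face1 dihedral i z)))
        = (\<Sum>i = 1..length (snd w). (-1) ^ i * (unrev (fix_last F x) (face0 i w) - unrev (fix_last F x) (face1 dihedral i w)))"
      by (rule sum.cong) (auto simp: z faces_snocs unrev_snocs)
    also have "\<dots> = unrev (cobd 1 (fix_last F x)) w" by (rule Cons(1)) (simp add: w_def)
    finally show ?case
      by (simp add: z length_snocs sum.atLeast_Suc_atMost_Suc_shift faces_last unrev_reflz)
        (simp add: unrev_def w_def snocs_def algebra_simps)
  qed (simp add: unrev_def)
  from this[of z "rev (snd z)" F] show "coboundary dihedral (unrev F) z = unrev (cobd 1 F) z"
    by (simp add: coboundary_eq)
qed

text \<open>
  The largest face is applied first; when the face \<open>a\<close> is due, the word still has at least \<open>a\<close>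
  letters.
\<close>

lemma sorted_head_le:
  assumes "sorted_wrt (<) (a # L)" "set (a # L) \<subseteq> {1..n::nat}"
  shows "1 \<le> a" "a \<le> n - length L"
proof -
  show "1 \<le> a" using assms(2) by simp
  have "x \<in> {Suc a..n}" if "x \<in> set L" for x using assms that by (simp add: Suc_le_eq subset_eq)
  then have "set L \<subseteq> {Suc a..n}" by (rule subsetI)
  then have "card (set L) \<le> n - a" using card_mono[of "{Suc a..n}" "set L"] by simp
  moreover have "card (set L) = length L"
    using assms(1) by (intro distinct_card) (simp add: strict_sorted_iff)
  moreover have "a \<le> n" using assms(2) by simp
  ultimately show "a \<le> n - length L" by linarith
qed

lemma iterated_faces:
  assumes "sorted_wrt (<) L" "set L \<subseteq> {1..length (snd z)}"
  shows "length (snd (foldr face0 L z)) = length (snd z) - length L"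
    "length (snd (foldr (face1 s) L z)) = length (snd z) - length L"
    "foldr face0 L (snocs x z) = snocs x (foldr face0 L z)"
    "foldr (face1 s) L (snocs x z) = snocs x (foldr (face1 s) L z)"
proof -
  have "length (snd (foldr face0 L z)) = length (snd z) - length L
    \<and> length (snd (foldr (face1 s) L z)) = length (snd z) - length L
    \<and> foldr face0 L (snocs x z) = snocs x (foldr face0 L z)
    \<and> foldr (face1 s) L (snocs x z) = snocs x (foldr (face1 s) L z)"
    using assms
  proof (induction L)
    case (Cons a L)
    have L: "sorted_wrt (<) L" "set L \<subseteq> {1..length (snd z)}" using Cons(2,3) by auto
    show ?case using sorted_head_le[OF Cons(2,3)] Cons(1)[OF L]
      by (simp add: length_faces faces_snocs)
  qed simp
  then show "length (snd (foldr face0 L z)) = length (snd z) - length L"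
    "length (snd (foldr (face1 s) L z)) = length (snd z) - length L"
    "foldr face0 L (snocs x z) = snocs x (foldr face0 L z)"
    "foldr (face1 s) L (snocs x z) = snocs x (foldr (face1 s) L z)" by blast+
qed

lemma iterated_face1_reflz:
  assumes "sorted_wrt (<) L" "set L \<subseteq> {1..length (snd z)}"
  shows "foldr (face1 dihedral) L (reflz x z) = reflz x (foldr (face1 dihedral) L z)"
  using assms
proof (induction L)
  case (Cons a L)
  have L: "sorted_wrt (<) L" "set L \<subseteq> {1..length (snd z)}" using Cons by auto
  show ?case using sorted_head_le[OF Cons(2,3)] Cons(1)[OF L] iterated_faces(2)[OF L, of dihedral]
    by (simp add: face1_reflz)
qed simp

text \<open>
  Precomposition with this cycle takes the value at the last of the positions \<open>1, \<dots>, k + m + 1\<close> and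
  puts it in front of the \<open>m\<close> positions before it, which is where a new largest element of the
  first block of a shuffle stands.
\<close>

definition rot :: "nat \<Rightarrow> nat \<Rightarrow> nat \<Rightarrow> nat" where
  "rot k m i = (if i = k + 1 then k + m + 1 else if k + 1 < i \<and> i \<le> k + m + 1 then i - 1 else i)"

lemma sign_rot: "permutation (rot k m) \<and> sign (rot k m) = (-1) ^ m"
proof (induction m)
  case 0
  have "rot k 0 = id" by (auto simp: rot_def fun_eq_iff)
  then show ?case by simp
next
  case (Suc m)
  let ?t = "Transposition.transpose (k + m + 1) (k + m + 2)"
  have e: "rot k (Suc m) = ?t \<circ> rot k m"
    by (auto simp: rot_def fun_eq_iff Transposition.transpose_def)
  have t: "permutation ?t" "sign ?t = -1" by (simp_all add: permutation_swap_id sign_swap_id)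
  show ?case
    unfolding e using permutation_compose[OF t(1)] sign_compose[OF t(1)] Suc t(2) by (simp only: power_Suc)
qed

lemma sorted_list_insert_last:
  assumes "A \<subseteq> {1..n::nat}"
  shows "sorted_list_of_set (insert (Suc n) A) = sorted_list_of_set A @ [Suc n]"
proof (rule sorted_distinct_set_unique)
  have f: "finite A" using assms by (rule finite_subset) simp
  have lt: "a < Suc n" if "a \<in> A" for a using assms that by force
  show "sorted (sorted_list_of_set A @ [Suc n])" using f lt by (simp add: sorted_append less_imp_le)
  show "distinct (sorted_list_of_set A @ [Suc n])" using f lt by auto
  show "set (sorted_list_of_set (insert (Suc n) A)) = set (sorted_list_of_set A @ [Suc n])"
    unfolding set_append using f by (simp only: set_sorted_list_of_set finite_insert) simp
qed (rule sorted_sorted_list_of_set distinct_sorted_list_of_set)+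

lemma shuffle_perm_Suc:
  assumes "A \<subseteq> {1..n}"
  shows "shuffle_perm (Suc n) (insert (Suc n) A) = shuffle_perm n A"
    "shuffle_perm (Suc n) A = shuffle_perm n A \<circ> rot (n - card A) (card A)"
proof -
  define bs as where "bs = sorted_list_of_set ({1..n} - A)" and "as = sorted_list_of_set A"
  have f: "finite A" using assms by (rule finite_subset) simp
  have c: "card A \<le> n" using card_mono[OF _ assms] by simp
  have lb: "length bs = n - card A" using card_Diff_subset[OF f assms] by (simp add: bs_def)
  have la: "length as = card A" using f by (simp add: as_def)
  have 1: "{1..Suc n} - insert (Suc n) A = {1..n} - A" by auto
  have 2: "{1..Suc n} - A = insert (Suc n) ({1..n} - A)" using assms by auto
  have sb: "sorted_list_of_set ({1..Suc n} - A) = bs @ [Suc n]"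
    unfolding 2 bs_def by (rule sorted_list_insert_last) auto
  \<comment> \<open>appending the new last position to the second block does not change the others\<close>
  define L where "L = bs @ as"
  have lL: "length L = n" using c by (simp add: L_def lb la)
  have s1: "sorted_list_of_set ({1..Suc n} - insert (Suc n) A) @ sorted_list_of_set (insert (Suc n) A) = L @ [Suc n]"
    unfolding 1 sorted_list_insert_last[OF assms] L_def as_def bs_def by simp
  show "shuffle_perm (Suc n) (insert (Suc n) A) = shuffle_perm n A"
  proof
    fix i
    show "shuffle_perm (Suc n) (insert (Suc n) A) i = shuffle_perm n A i"
      unfolding shuffle_perm_def s1 bs_def[symmetric] as_def[symmetric] L_def[symmetric]
      by (auto simp: nth_append lL le_Suc_eq)
  qed
  have sp: "shuffle_perm (Suc n) A i = (if i \<in> {1..Suc n} then (bs @ Suc n # as) ! (i - 1) else i)" for i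
    unfolding shuffle_perm_def sb as_def[symmetric] by simp
  have sq: "shuffle_perm n A i = (if i \<in> {1..n} then (bs @ as) ! (i - 1) else i)" for i
    unfolding shuffle_perm_def bs_def as_def ..
  show "shuffle_perm (Suc n) A = shuffle_perm n A \<circ> rot (n - card A) (card A)"
  proof
    fix i
    have s: "n - card A + card A + 1 = Suc n" using c by simp
    have r: "rot (n - card A) (card A) i = (if i = Suc (n - card A) then Suc n
        else if Suc (n - card A) < i \<and> i \<le> Suc n then i - 1 else i)"
      unfolding rot_def s by simp
    consider "i = 0" | "i > Suc n" | "1 \<le> i" "i \<le> n - card A" | "i = Suc (n - card A)"
      | "Suc (n - card A) < i" "i \<le> Suc n" by linarith
    then show "shuffle_perm (Suc n) A i = (shuffle_perm n A \<circ> rot (n - card A) (card A)) i"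
      unfolding comp_apply r sp sq
    proof cases
      case 5
      define j where "j = i - Suc (Suc (n - card A))"
      have j: "i = Suc (Suc (n - card A + j))" "n - card A + j < n"
        using 5 c by (simp_all add: j_def)
      then show "(if i \<in> {1..Suc n} then (bs @ Suc n # as) ! (i - 1) else i) =
          (if (if i = Suc (n - card A) then Suc n
            else if Suc (n - card A) < i \<and> i \<le> Suc n then i - 1 else i) \<in> {1..n}
           then (bs @ as) ! ((if i = Suc (n - card A) then Suc n
            else if Suc (n - card A) < i \<and> i \<le> Suc n then i - 1 else i) - 1)
           else if i = Suc (n - card A) then Suc n
            else if Suc (n - card A) < i \<and> i \<le> Suc n then i - 1 else i)"
        by (simp add: nth_append lb)
    qed (auto simp: nth_append lb)
  qed
qed

lemma permutation_shuffle_perm: "A \<subseteq> {1..n} \<Longrightarrow> permutation (shuffle_perm n A)"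
proof (induction n arbitrary: A)
  case 0
  have "shuffle_perm 0 A = id" by (auto simp: shuffle_perm_def fun_eq_iff)
  then show ?case by simp
next
  case (Suc n)
  show ?case
  proof (cases "Suc n \<in> A")
    case True
    have A: "A - {Suc n} \<subseteq> {1..n}" using Suc(2) by (auto simp: le_Suc_eq)
    have "insert (Suc n) (A - {Suc n}) = A" using True by blast
    then show ?thesis using shuffle_perm_Suc(1)[OF A] Suc(1)[OF A] by simp
  next
    case False
    then have A: "A \<subseteq> {1..n}" using Suc(2) by (auto simp: le_Suc_eq)
    show ?thesis
      unfolding shuffle_perm_Suc(2)[OF A] by (intro permutation_compose Suc(1)[OF A] conjunct1[OF sign_rot])
  qed
qed

lemma sign_shuffle_perm:
  assumes "A \<subseteq> {1..n}"
  shows "sign (shuffle_perm (Suc n) A) = (-1) ^ card A * sign (shuffle_perm n A)"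
  unfolding shuffle_perm_Suc(2)[OF assms]
    sign_compose[OF permutation_shuffle_perm[OF assms] conjunct1[OF sign_rot]] conjunct2[OF sign_rot]
  by (rule mult.commute)

text \<open>
  The permutation sign together with the global factor \<open>(-1)\<^sup>k\<^sup>m\<close> of the cup product; the product
  of both has a simple recursion in the last position (\<open>shuffle_sign_Suc\<close>).
\<close>

definition shuffle_sign :: "nat \<Rightarrow> nat set \<Rightarrow> 'k::comm_ring_1" where
  "shuffle_sign n A = (-1) ^ ((n - card A) * card A) * of_int (sign (shuffle_perm n A))"

lemma shuffle_sign_Suc:
  assumes "A \<subseteq> {1..n}"
  shows "shuffle_sign (Suc n) A = (shuffle_sign n A :: 'k::comm_ring_1)"
    "shuffle_sign (Suc n) (insert (Suc n) A) = ((-1) ^ (n - card A) * shuffle_sign n A :: 'k)"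
proof -
  have f: "finite A" "Suc n \<notin> A" using finite_subset[OF assms] assms by auto
  have c: "card A \<le> n" using card_mono[OF _ assms] by simp
  have "(Suc n - card A) * card A = card A + (n - card A) * card A" using c by (simp add: Suc_diff_le)
  moreover have "(-1) ^ card A * ((-1) ^ card A * x) = (x :: 'k)" for x
    by (simp flip: mult.assoc power_add mult_2)
  ultimately show "shuffle_sign (Suc n) A = (shuffle_sign n A :: 'k)"
    by (simp add: shuffle_sign_def sign_shuffle_perm[OF assms] power_add ac_simps)
  show "shuffle_sign (Suc n) (insert (Suc n) A) = ((-1) ^ (n - card A) * shuffle_sign n A :: 'k)"
    using f by (simp add: shuffle_sign_def shuffle_perm_Suc(1)[OF assms] power_add mult.assoc)
qed

definition cup_term ::
    "('a::comm_ring_1, 'k::comm_ring_1) cochain \<Rightarrow> ('a, 'k) cochain \<Rightarrow> 'a rack_symbol \<Rightarrow> nat set \<Rightarrow> 'k" where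
  "cup_term F G z A = shuffle_sign (length (snd z)) A *
     unrev F (foldr face0 (sorted_list_of_set A) z) *
     unrev G (foldr (face1 dihedral) (sorted_list_of_set ({1..length (snd z)} - A)) z)"

lemma cup_term_snocs:
  assumes "A \<subseteq> {1..length (snd z)}"
  shows "cup_term F G (snocs x z) A = cup_term (fix_last F x) (reflect 1 G x) z A"
    "cup_term F G (snocs x z) (insert (Suc (length (snd z))) A) = cup_term (dsign F) (fix_last G x) z A"
proof -
  let ?n = "length (snd z)"
  have f: "finite A" using finite_subset[OF assms] by simp
  have a: "sorted_wrt (<) (sorted_list_of_set A)" "set (sorted_list_of_set A) \<subseteq> {1..?n}"
    using assms f by auto
  have b: "sorted_wrt (<) (sorted_list_of_set ({1..?n} - A))"
    "set (sorted_list_of_set ({1..?n} - A)) \<subseteq> {1..?n}"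
    by auto
  have 1: "{1..Suc ?n} - insert (Suc ?n) A = {1..?n} - A" by auto
  have 2: "{1..Suc ?n} - A = insert (Suc ?n) ({1..?n} - A)" using assms by auto
  have 3: "sorted_list_of_set (insert (Suc ?n) ({1..?n} - A)) = sorted_list_of_set ({1..?n} - A) @ [Suc ?n]"
    by (rule sorted_list_insert_last) auto
  show "cup_term F G (snocs x z) A = cup_term (fix_last F x) (reflect 1 G x) z A"
    unfolding cup_term_def length_snocs 2 3 shuffle_sign_Suc[OF assms] iterated_faces(3)[OF a]
      foldr_append foldr.simps o_def id_def faces_last iterated_face1_reflz[OF b] unrev_snocs unrev_reflz ..
  have 4: "length (snd (foldr face0 (sorted_list_of_set A) z)) = ?n - card A"
    using iterated_faces(1)[OF a] f by simp
  show "cup_term F G (snocs x z) (insert (Suc ?n) A) = cup_term (dsign F) (fix_last G x) z A"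
    unfolding cup_term_def length_snocs 1 sorted_list_insert_last[OF assms] shuffle_sign_Suc[OF assms]
      iterated_faces(4)[OF b] foldr_append foldr.simps o_def id_def faces_last unrev_snocs unrev_dsign 4
    by (simp add: ac_simps)
qed

text \<open>
  Subsets of all sizes are summed here, which makes the induction on the last letter go through.
  For homogeneous arguments only those of the right size contribute.
\<close>

lemma sum_cup_term:
  fixes F G :: "('a::comm_ring_1, 'k::comm_ring_1) cochain"
  shows "(\<Sum>A\<in>Pow {1..length (snd z)}. cup_term F G z A) = unrev (shuf 1 F G) z"
proof -
  have "(\<Sum>A\<in>Pow {1..length (snd z)}. cup_term F G z A) = unrev (shuf 1 F G) z"
    if "snd z = rev r" for r z and F G :: "('a, 'k) cochain"
    using that
  proof (induction r arbitrary: F G z)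
    case Nil
    have "shuffle_perm 0 {} = id" by (auto simp: shuffle_perm_def fun_eq_iff)
    then show ?case using Nil by (simp add: cup_term_def shuffle_sign_def unrev_def)
  next
    case (Cons x r)
    define y w where "y = fst z" and "w = (y, rev r)"
    have z: "z = snocs x w" using Cons(2) by (cases z) (simp add: w_def y_def snocs_def)
    let ?n = "length (snd w)"
    have P: "Pow {1..Suc ?n} = Pow {1..?n} \<union> insert (Suc ?n) ` Pow {1..?n}"
    proof -
      have "{1..Suc ?n} = insert (Suc ?n) {1..?n}" by auto
      then show ?thesis by (simp only: Pow_insert)
    qed
    have inj: "inj_on (insert (Suc ?n)) (Pow {1..?n})"
    proof (rule inj_onI)
      fix A B assume "A \<in> Pow {1..?n}" "B \<in> Pow {1..?n}" "insert (Suc ?n) A = insert (Suc ?n) B"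
      moreover from this(1,2) have "Suc ?n \<notin> A" "Suc ?n \<notin> B" by auto
      ultimately show "A = B" by (metis insert_ident)
    qed
    have w: "snd w = rev r" by (simp add: w_def)
    have "(\<Sum>A\<in>Pow {1..length (snd z)}. cup_term F G z A)
        = (\<Sum>A\<in>Pow {1..?n}. cup_term F G z A) + (\<Sum>A\<in>insert (Suc ?n) ` Pow {1..?n}. cup_term F G z A)"
      unfolding z length_snocs P by (rule sum.union_disjoint) auto
    also have "\<dots> = (\<Sum>A\<in>Pow {1..?n}. cup_term (fix_last F x) (reflect 1 G x) w A)
        + (\<Sum>A\<in>Pow {1..?n}. cup_term (dsign F) (fix_last G x) w A)"
      unfolding z sum.reindex[OF inj] o_def
      by (intro arg_cong2[of _ _ _ _ "(+)"] sum.cong) (auto simp: cup_term_snocs)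
    also have "\<dots> = unrev (shuf 1 (fix_last F x) (reflect 1 G x)) w + unrev (shuf 1 (dsign F) (fix_last G x)) w"
      by (simp only: Cons(1)[OF w])
    also have "\<dots> = unrev (shuf 1 F G) z"
      by (simp add: z w_def unrev_def snocs_def)
    finally show ?case .
  qed
  from this[of z "rev (snd z)" F G] show ?thesis by simp
qed

lemma cup_unrev:
  assumes "homog k F" "homog m G"
  shows "cup dihedral k m (unrev F) (unrev G) = unrev (shuf 1 F G)"
proof
  fix z :: "'a rack_symbol"
  show "cup dihedral k m (unrev F) (unrev G) z = unrev (shuf 1 F G) z"
  proof (cases "length (snd z) = k + m")
    case True
    have zero: "cup_term F G z A = 0" if "A \<subseteq> {1..k + m}" "card A \<noteq> m" for A
    proof -
      have f: "finite A" using finite_subset[OF that(1)] by simp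
      have "card A \<le> k + m" using card_mono[OF _ that(1)] by simp
      moreover have "length (snd (foldr face0 (sorted_list_of_set A) z)) = k + m - card A"
        using iterated_faces(1)[of "sorted_list_of_set A" z] that(1) f True by simp
      ultimately have "length (snd (foldr face0 (sorted_list_of_set A) z)) \<noteq> k" using that(2) by simp
      then show ?thesis using assms(1) by (simp add: cup_term_def unrev_def homog_def)
    qed
    have "cup dihedral k m (unrev F) (unrev G) z = (\<Sum>A | A \<subseteq> {1..k + m} \<and> card A = m. cup_term F G z A)"
      unfolding cup_def sum_distrib_left using True
      by (auto intro!: sum.cong simp: cup_term_def shuffle_sign_def mult.assoc)
    also have "\<dots> = (\<Sum>A\<in>Pow {1..k + m}. cup_term F G z A)"
      by (rule sum.mono_neutral_left) (auto simp: zero)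
    finally show ?thesis using sum_cup_term[of F G z] True by simp
  next
    case False
    then show ?thesis using homog_shuf[OF assms, of 1] by (simp add: cup_def unrev_def homog_def)
  qed
qed

lemma P_op_unrev:
  fixes F :: "'p::prime_card dcochain"
  assumes "homog k F" shows "P_op k (unrev F) = unrev (drop_base F)"
proof
  fix z :: "'p mod_ring rack_symbol"
  show "P_op k (unrev F) z = unrev (drop_base F) z"
  proof (cases "length (snd z) = k + 1")
    case True
    then obtain x xs where "snd z = x # xs" "length xs = k" by (cases "snd z") auto
    then show ?thesis by (simp add: P_op_def unrev_def drop_base_def)
  next
    case False
    then show ?thesis using assms
      by (cases "snd z") (auto simp: P_op_def unrev_def drop_base_def homog_def)
  qed
qed

definition hclass :: "nat \<Rightarrow> 'p::prime_card dcochain \<Rightarrow> ('p mod_ring, 'p mod_ring) coh_class" where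
  "hclass n F = rack_class dihedral n (unrev F)"

lemma unrev_cocycles: "unrev F \<in> cocycles dihedral n \<longleftrightarrow> cocycle n F"
  by (simp add: cocycles_def unrev_cochains coboundary_unrev cocycle_def unrev_inject flip: unrev_lin(4))

text \<open>
  A primitive may be an inhomogeneous family; its component in the right degree is still a
  primitive.
\<close>

lemma unrev_coboundaries:
  fixes F :: "'p::prime_card dcochain"
  assumes "homog n F"
  shows "unrev F \<in> coboundaries dihedral n \<longleftrightarrow> coh F 0"
proof (cases n)
  case 0
  have "F = 0" if "coh F 0"
  proof -
    obtain v where "F = cobd 1 v" using \<open>coh F 0\<close> by (auto simp: coh_def)
    then have "F y [] = 0" for y by simp
    then have "F y r = 0" for y r using assms 0 by (cases "r = []") (auto simp: homog_def)
    then show ?thesis by (intro ext) simp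
  qed
  then show ?thesis using 0 by (auto simp: coboundaries_def unrev_inject simp flip: unrev_lin(4))
next
  case (Suc k)
  have "unrev F \<in> coboundary dihedral ` cochains k" if "coh F 0"
  proof -
    obtain v where v: "F = cobd 1 v" using \<open>coh F 0\<close> by (auto simp: coh_def)
    then have "F = cobd 1 (cut k v)" using assms Suc by (simp add: cobd_cut cut_homog)
    then have "unrev F = coboundary dihedral (unrev (cut k v))" by (simp only: coboundary_unrev)
    moreover have "unrev (cut k v) \<in> cochains k" by (simp add: unrev_cochains homog_cut)
    ultimately show ?thesis by blast
  qed
  moreover have "coh F 0" if f: "unrev F = coboundary dihedral f" for f
  proof -
    obtain v where "f = unrev v" using unrev_surj by blast
    then have "F = 0 + cobd 1 v" using f by (simp add: coboundary_unrev unrev_inject)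
    then show ?thesis by (rule cohI)
  qed
  ultimately show ?thesis using Suc by (auto simp: coboundaries_def)
qed

lemma unrev_cohomologous:
  fixes F G :: "'p::prime_card dcochain"
  shows "(unrev F, unrev G) \<in> cohomologous dihedral n \<longleftrightarrow> cocycle n F \<and> cocycle n G \<and> coh F G"
proof -
  have "coh (G - F) 0 \<longleftrightarrow> coh F G"
    using coh_diff_0[of G F] coh_sym[of G F] coh_sym[of F G] coh_diff[OF _ coh_refl[of F], of G F]
    by (metis diff_self)
  moreover have "homog n (G - F)" if "cocycle n F"
  "cocycle n G" using cocycle_lin(2)[OF that(2,1)] by (simp add: cocycle_def)
  ultimately show ?thesis
    unfolding cohomologous_def by (auto simp: unrev_cocycles unrev_coboundaries simp flip: unrev_lin(2))
qed

lemma hclass_eq_iff: "cocycle n F \<Longrightarrow> cocycle n G \<Longrightarrow> hclass n F = hclass n G \<longleftrightarrow> coh F G"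
  using eq_equiv_class_iff[OF equiv_cohomologous[of dihedral n], of "unrev F" "unrev G"]
  by (simp add: hclass_def rack_class_def unrev_cocycles unrev_cohomologous)

lemma hclass_in: "cocycle n F \<Longrightarrow> hclass n F \<in> cohomology dihedral n"
  by (simp add: hclass_def rack_class_in unrev_cocycles)

lemma hclass_mem: "f \<in> hclass n F \<longleftrightarrow> (\<exists>F'. f = unrev F' \<and> cocycle n F \<and> cocycle n F' \<and> coh F F')"
  unfolding hclass_def rack_class_def using unrev_surj[of f] by (auto simp: unrev_cohomologous unrev_inject)

lemma hclass_self: "cocycle n F \<Longrightarrow> unrev F \<in> hclass n F"
  by (simp add: hclass_def mem_rack_class unrev_cocycles)

lemma cohomology_cases:
  assumes "u \<in> cohomology dihedral n"
  obtains F :: "'p::prime_card dcochain" where "cocycle n F" "u = hclass n F"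
proof -
  obtain f where f: "f \<in> cocycles dihedral n" "u = rack_class dihedral n f"
    using assms by (rule cohomologyE)
  obtain F where "f = unrev F" using unrev_surj by blast
  then show ?thesis using f that[of F] by (simp add: hclass_def unrev_cocycles)
qed

lemma coh_zero_hclass: "coh_zero dihedral n = hclass n 0"
  by (simp add: coh_zero_def hclass_def unrev_lin)

lemma coh_one_hclass: "coh_one dihedral = hclass 0 (unit :: 'p::prime_card dcochain)"
proof -
  have "unrev (unit :: 'p dcochain) = (\<lambda>z. if length (snd z) = 0 then 1 else 0)"
    by (auto simp: unrev_def unit_def fun_eq_iff)
  then show ?thesis by (simp only: coh_one_def hclass_def)
qed

lemma coh_add_hclass: "cocycle n F \<Longrightarrow> cocycle n G \<Longrightarrow> coh_add dihedral n (hclass n F) (hclass n G) = hclass n (F + G)"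
  by (simp add: hclass_def coh_add_class unrev_cocycles unrev_lin)

lemma coh_scale_hclass: "cocycle n F \<Longrightarrow> coh_scale dihedral n c (hclass n F) = hclass n (scale c F)"
  by (simp add: hclass_def coh_scale_class unrev_cocycles unrev_lin)

text \<open>
  The cup product of cochains respects cohomologous representatives, so the union over all
  representatives in the induced operation is one class.
\<close>

lemma coh_cup_hclass:
  assumes "cocycle k F" "cocycle m G"
  shows "coh_cup dihedral k m (hclass k F) (hclass m G) = hclass (k + m) (shuf 1 F G)"
proof -
  have e: "rack_class dihedral (k + m) (cup dihedral k m f g) = hclass (k + m) (shuf 1 F G)"
    if fg: "f \<in> hclass k F" "g \<in> hclass m G" for f g
  proof -
    obtain F' G' where F': "f = unrev F'" "cocycle k F'" "coh F F'" and G': "g = unrev G'"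
    "cocycle m G'" "coh G G'"
      using fg by (auto simp: hclass_mem)
    have "coh (shuf 1 F G) (shuf 1 F' G)" using F' assms by (intro coh_shuf_left) (auto simp: cocycle_def)
    also have "coh \<dots> (shuf 1 F' G')" using G' F' by (intro coh_shuf_right) (auto simp: cocycle_def)
    finally have "hclass (k + m) (shuf 1 F G) = hclass (k + m) (shuf 1 F' G')"
      using assms F' G' by (simp add: hclass_eq_iff cocycle_shuf)
    moreover have "cup dihedral k m f g = unrev (shuf 1 F' G')"
      using F' G' by (simp add: cup_unrev cocycle_def)
    ultimately show ?thesis by (simp add: hclass_def)
  qed
  have "coh_cup dihedral k m (hclass k F) (hclass m G) = (\<Union>f\<in>hclass k F. \<Union>g\<in>hclass m G. hclass (k + m) (shuf 1 F G))"
    unfolding coh_cup_def induced2_def by (intro SUP_cong refl e)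
  then show ?thesis using hclass_self[OF assms(1)] hclass_self[OF assms(2)] by blast
qed

lemma coh_P_hclass:
  assumes "odd CARD('p::prime_card)" "cocycle k (F :: 'p dcochain)"
  shows "coh_P dihedral k (hclass k F) = hclass (Suc k) (drop_base F)"
proof -
  have e: "rack_class dihedral (k + 1) (P_op k f) = hclass (Suc k) (drop_base F)" if f: "f \<in> hclass k F" for f
  proof -
    obtain F' where F': "f = unrev F'" "cocycle k F'" "coh F F'" using f by (auto simp: hclass_mem)
    have "hclass (Suc k) (drop_base F) = hclass (Suc k) (drop_base F')"
      using assms F' by (simp add: hclass_eq_iff cocycle_drop_base coh_drop_base)
    moreover have "P_op k f = unrev (drop_base F')" using F' by (simp add: P_op_unrev cocycle_def)
    ultimately show ?thesis by (simp add: hclass_def)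
  qed
  have "coh_P dihedral k (hclass k F) = (\<Union>f\<in>hclass k F. hclass (Suc k) (drop_base F))"
    unfolding coh_P_def induced_def by (intro SUP_cong refl e)
  then show ?thesis using hclass_self[OF assms(2)] by blast
qed

section \<open>The basis of the total cohomology\<close>

context divided_power_data
begin

abbreviation "A_cls \<equiv> \<lambda>m. hclass (2 * m) (A m)"
abbreviation "E \<equiv> word_element dihedral A_cls (hclass 3 B)"
abbreviation "M \<equiv> total_cohomology dihedral :: ('p mod_ring, nat \<Rightarrow> ('p mod_ring, 'p mod_ring) coh_class) module"

lemma cocycle_B: "cocycle 3 B"
  by (simp add: cocycle_def Bc)

lemma word_class_hclass: "w \<in> words \<Longrightarrow> word_class dihedral A_cls (hclass 3 B) w = hclass (word_degree w) (W w)"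
proof (induction w)
  case (Cons a w)
  obtain m e where a: "a = (m, e)" by (cases a)
  have e: "e = 0 \<or> e = 1" using Cons(2) by (auto simp: a words_Cons)
  let ?b = "if e = 0 then unit else B"
  have b: "cocycle (3 * e) ?b" "B_power dihedral (hclass 3 B) e = hclass (3 * e) ?b"
    using e cocycle_B by (auto simp: cocycle_unit B_power_def coh_one_hclass)
  show ?case
  proof (cases w)
    case Nil
    then show ?thesis
      by (simp add: a b(2) coh_cup_hclass A_cyc b(1) W_Cons tail_def shuf_unit del: word_cochain.simps)
  next
    case (Cons v u)
    have w: "w \<in> words" using Cons.prems Cons by (simp add: a words_Cons)
    let ?d = "word_degree w"
    have P: "coh_P dihedral ?d (word_class dihedral A_cls (hclass 3 B) w) = hclass (?d + 1) (drop_base (W w))"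
      using coh_P_hclass[OF odd cocycle_W[OF w]] Cons.IH[OF w] by simp
    have p: "cocycle (?d + 1) (drop_base (W w))" using cocycle_drop_base[OF odd cocycle_W[OF w]] by simp
    have "word_class dihedral A_cls (hclass 3 B) (a # w)
        = coh_cup dihedral (2 * m) (3 * e + (?d + 1)) (hclass (2 * m) (A m))
            (coh_cup dihedral (3 * e) (?d + 1) (hclass (3 * e) ?b) (hclass (?d + 1) (drop_base (W w))))"
      unfolding a Cons word_class.simps Let_def b(2) by (simp only: P[unfolded Cons])
    also have "\<dots> = hclass (2 * m + (3 * e + (?d + 1))) (shuf 1 (A m) (shuf 1 ?b (drop_base (W w))))"
      by (simp only: coh_cup_hclass[OF b(1) p] coh_cup_hclass[OF A_cyc cocycle_shuf[OF b(1) p]])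
    also have "\<dots> = hclass (word_degree (a # w)) (W (a # w))"
      using Cons by (simp add: a W_Cons tail_def del: word_cochain.simps)
    finally show ?thesis .
  qed
qed (simp add: words_def)

lemma M_ops:
  "add M g h = (\<lambda>n. coh_add dihedral n (g n) (h n))" "zero M = (\<lambda>n. hclass n 0)"
  "module.smult M c h = (\<lambda>n. coh_scale dihedral n c (h n))"
  "h \<in> carrier M \<longleftrightarrow> (\<forall>n. h n \<in> cohomology dihedral n) \<and> finite {n. h n \<noteq> hclass n 0}"
  by (auto simp: total_cohomology_def coh_zero_hclass fun_eq_iff)

definition part :: "(nat \<times> nat) list \<Rightarrow> nat \<Rightarrow> 'p dcochain" where
  "part w n = (if word_degree w = n then W w else 0)"

lemma cocycle_part: "w \<in> words \<Longrightarrow> cocycle n (part w n)"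
  by (auto simp: part_def cocycle_W cocycle_lin)

lemma E_eq: "w \<in> words \<Longrightarrow> E w = (\<lambda>n. hclass n (part w n))"
  by (auto simp: word_element_def homogeneous_def part_def word_class_hclass coh_zero_hclass fun_eq_iff)

lemma E_carrier: "w \<in> words \<Longrightarrow> E w \<in> carrier M"
proof -
  assume w: "w \<in> words"
  have "finite {n. hclass n (part w n) \<noteq> hclass n 0}"
    by (rule finite_subset[of _ "{word_degree w}"]) (auto simp: part_def)
  then show ?thesis using w by (simp add: M_ops E_eq hclass_in cocycle_part)
qed

lemma sum_part:
  assumes "finite S" "S \<subseteq> words"
  shows "(\<Sum>w\<in>S. scale (c w) (part w n)) = word_comb 0 n (\<lambda>w. if w \<in> S then c w else 0)"
proof -
  have "(\<Sum>w\<in>S. scale (c w) (part w n)) = (\<Sum>w\<in>S \<inter> words_deg 0 n. scale (c w) (W w))"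
    using assms by (intro sum.mono_neutral_cong_right) (auto simp: part_def words_deg_def)
  also have "\<dots> = (\<Sum>w\<in>words_deg 0 n. scale (if w \<in> S then c w else 0) (W w))"
    by (intro sum.mono_neutral_cong_left) (auto simp: finite_words_deg)
  finally show ?thesis by (simp add: word_comb_def)
qed

lemma E_inj: "inj_on E words"
proof (rule inj_onI, rule ccontr)
  fix v w assume vw: "v \<in> words" "w \<in> words" "E v = E w" "v \<noteq> w"
  let ?n = "word_degree v"
  have "hclass ?n (part v ?n) = hclass ?n (part w ?n)"
    using vw(3) by (simp add: E_eq vw(1,2) fun_eq_iff)
  then have c: "coh (part v ?n) (part w ?n)" by (simp add: hclass_eq_iff cocycle_part vw)
  have d: "part u ?n = word_comb 0 ?n (\<lambda>x. if x = u then 1 else 0)" if "u \<in> words" for u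
    using sum_part[of "{u}" "\<lambda>_. 1" ?n] that by simp
  have "coh (part v ?n - part w ?n) (part w ?n - part w ?n)" using c by (rule coh_diff) simp
  moreover have "part v ?n - part w ?n = word_comb 0 ?n (\<lambda>x. (if x = v then 1 else 0) - (if x = w then 1 else 0))"
    unfolding d[OF vw(1)] d[OF vw(2)] by (simp only: word_comb_def sum_subtractf[symmetric] scale_lin(5))
  ultimately have "coh (word_comb 0 ?n (\<lambda>x. (if x = v then 1 else 0) - (if x = w then 1 else 0))) 0" by simp
  from independent[OF this, of v] show False using vw by (simp add: words_deg_def)
qed

interpretation V: vectorspace "class_ring :: 'p mod_ring ring" M
  by (rule vectorspace_total_cohomology)

text \<open>
  In degree \<open>n\<close> a linear combination of word elements only sees the words of degree \<open>n\<close>.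
\<close>

lemma lincomb_E:
  assumes "finite S" "S \<subseteq> words"
  shows "V.lincomb a (E ` S) = (\<lambda>n. hclass n (\<Sum>w\<in>S. scale (a (E w)) (part w n)))"
  using assms
proof (induction S rule: finite_induct)
  case empty
  show ?case by (simp add: V.lincomb_def M_ops)
next
  case (insert w S)
  have w: "w \<in> words" "S \<subseteq> words" using insert by auto
  have notin: "E w \<notin> E ` S"
    using inj_on_image_mem_iff[OF E_inj w] insert(2) by simp
  have smult: "module.smult M c (E v) \<in> carrier M" if "v \<in> words" for c v
    using V.smult_closed[of c "E v"] E_carrier[OF that] by simp
  have "V.lincomb a (E ` insert w S) = add M (module.smult M (a (E w)) (E w)) (V.lincomb a (E ` S))"
    unfolding V.lincomb_def image_insert
    using insert(1) notin smult w by (intro V.finsum_insert) auto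
  also have "\<dots> = (\<lambda>n. hclass n (scale (a (E w)) (part w n) + (\<Sum>w\<in>S. scale (a (E w)) (part w n))))"
  proof
    fix n
    have "cocycle n (\<Sum>w\<in>S. scale (a (E w)) (part w n))"
      using w by (intro cocycle_sum cocycle_lin cocycle_part) auto
    then show "add M (module.smult M (a (E w)) (E w)) (V.lincomb a (E ` S)) n
        = hclass n (scale (a (E w)) (part w n) + (\<Sum>w\<in>S. scale (a (E w)) (part w n)))"
      unfolding insert(3)[OF w(2)] M_ops
      by (subst (2) E_eq[OF w(1)]) (simp only: coh_scale_hclass coh_add_hclass cocycle_lin cocycle_part w)
  qed
  finally show ?case unfolding sum.insert[OF insert(1,2)] .
qed

text \<open>
  A relation or an element of the direct sum is examined degree by degree, where \<open>independent\<close> and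
  \<open>span\<close> apply. An element has finitely many non-zero components, and there are finitely many words
  in each degree.
\<close>

theorem words_basis: "V.basis (E ` words)"
proof -
  have car: "E ` words \<subseteq> carrier M" using E_carrier by blast
  have "\<not> V.lin_dep (E ` words)"
  proof
    assume "V.lin_dep (E ` words)"
    then obtain T a v where T: "finite T" "T \<subseteq> E ` words" "V.lincomb a T = zero M"
      "v \<in> T" "a v \<noteq> 0"
      unfolding V.lin_dep_def by auto
    obtain S where S: "S \<subseteq> words" "finite S" "T = E ` S"
      using finite_subset_image[OF T(1,2)] by blast
    obtain w where w: "w \<in> S" "v = E w" using S T by blast
    let ?n = "word_degree w"
    let ?F = "\<Sum>w\<in>S. scale (a (E w)) (part w ?n)"
    have "hclass ?n ?F = hclass ?n 0"
      using fun_cong[OF T(3), of ?n] unfolding S(3) lincomb_E[OF S(2,1)] M_ops .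
    moreover have "cocycle ?n ?F" using S by (intro cocycle_sum cocycle_lin cocycle_part) auto
    ultimately have "coh ?F 0" by (simp only: hclass_eq_iff cocycle_lin)
    then have "coh (word_comb 0 ?n (\<lambda>w. if w \<in> S then a (E w) else 0)) 0"
      by (simp only: sum_part[OF S(2,1)])
    from independent[OF this, of w] show False using w S T by (auto simp: words_deg_def)
  qed
  moreover have "V.span (E ` words) = carrier M"
  proof
    show "V.span (E ` words) \<subseteq> carrier M" using car by (rule V.span_is_subset2)
    show "carrier M \<subseteq> V.span (E ` words)"
    proof
      fix h assume h: "h \<in> carrier M"
      have "\<exists>c. h n = hclass n (word_comb 0 n c)" for n
      proof -
        have "h n \<in> cohomology dihedral n" using h by (simp add: M_ops)
        then obtain F where F: "cocycle n F" "h n = hclass n F" by (rule cohomology_cases)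
        obtain c where "coh F (word_comb 0 n c)" using span[OF F(1)] by (auto simp: word_span_def)
        then show ?thesis using F by (auto simp: hclass_eq_iff cocycle_word_comb)
      qed
      then obtain c where c: "h n = hclass n (word_comb 0 n (c n))" for n by metis
      let ?N = "{n. h n \<noteq> hclass n 0}"
      define S where "S = (\<Union>n\<in>?N. words_deg 0 n)"
      have "finite ?N" using h by (simp add: M_ops)
      then have "finite S" unfolding S_def by (intro finite_UN_I finite_words_deg)
      moreover have "S \<subseteq> words" by (auto simp: S_def words_deg_def)
      ultimately have S: "finite S" "S \<subseteq> words" .
      \<comment> \<open>the coefficient of the basis element of \<open>w\<close>; its degree selects the component\<close>
      define a where "a v = (let w = inv_into words E v in c (word_degree w) w)" for v
      have a: "a (E w) = c (word_degree w) w" if "w \<in> words" for w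
        using inv_into_f_f[OF E_inj that] by (simp add: a_def)
      have "V.lincomb a (E ` S) = h"
      proof
        fix n
        have "(\<Sum>w\<in>S. scale (a (E w)) (part w n)) = word_comb 0 n (\<lambda>w. if w \<in> S then a (E w) else 0)"
          by (rule sum_part[OF S])
        also have "\<dots> = (if n \<in> ?N then word_comb 0 n (c n) else 0)"
        proof (cases "n \<in> ?N")
          case True
          then show ?thesis unfolding word_comb_def
            by (auto intro!: sum.cong simp: S_def words_deg_def a)
        next
          case False
          then have "w \<notin> S" if "w \<in> words_deg 0 n" for w using that by (auto simp: S_def words_deg_def)
          then show ?thesis using False unfolding word_comb_def by (simp add: sum.neutral)
        qed
        finally have "V.lincomb a (E ` S) n = hclass n (if n \<in> ?N then word_comb 0 n (c n) else 0)"
          by (simp only: lincomb_E[OF S])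
        then show "V.lincomb a (E ` S) n = h n" using c[of n] by auto
      qed
      moreover have "finite (E ` S)" "E ` S \<subseteq> E ` words" using S by auto
      ultimately show "h \<in> V.span (E ` words)" unfolding V.span_def by fastforce
    qed
  qed
  ultimately show ?thesis using car by (simp add: V.basis_def)
qed

end

theorem theorem2:
  assumes "odd CARD('p::prime_card)"
  shows "\<exists>(A :: nat \<Rightarrow> ('p mod_ring, 'p mod_ring) coh_class) B.
    (\<forall>m. A m \<in> cohomology dihedral (2 * m)) \<and>
    A 0 = coh_one dihedral \<and>
    B \<in> cohomology dihedral 3 \<and>
    inj_on (word_element dihedral A B) words \<and>
    vectorspace.basis class_ring (total_cohomology dihedral) (word_element dihedral A B ` words) \<and>
    (\<forall>k m. coh_cup dihedral (2 * k) (2 * m) (A k) (A m) =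
       coh_scale dihedral (2 * (k + m)) (of_nat ((k + m) choose k)) (A (k + m)))"
proof -
  obtain B :: "'p dcochain" and der where loc: "dihedral_cohomology B der"
    using dihedral_cohomology_exists[OF assms] by blast
  then interpret dihedral_cohomology B der .
  obtain A where A: "A 0 = unit" "\<And>m. cocycle (2 * m) (A m)" "\<And>m. proj (A m) = A m"
    "\<And>m. coh (der (A (Suc m))) (A m)"
    by (rule divided_power_sequence) blast
  interpret divided_power_data B der A by unfold_locales (use A in auto)
  let ?A = "\<lambda>m. hclass (2 * m) (A m)"
  have "coh_cup dihedral (2 * k) (2 * m) (?A k) (?A m) =
      coh_scale dihedral (2 * (k + m)) (of_nat ((k + m) choose k)) (?A (k + m))" for k m
  proof -
    have e: "2 * k + 2 * m = 2 * (k + m)" by simp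
    have c: "cocycle (2 * (k + m)) (shuf 1 (A k) (A m))"
      using cocycle_shuf[OF A(2)[of k] A(2)[of m]] unfolding e .
    have "coh_cup dihedral (2 * k) (2 * m) (?A k) (?A m) = hclass (2 * k + 2 * m) (shuf 1 (A k) (A m))"
      by (rule coh_cup_hclass[OF A(2) A(2)])
    also have "\<dots> = hclass (2 * (k + m)) (scale (of_nat ((k + m) choose k)) (A (k + m)))"
      unfolding e
      by (rule iffD2[OF hclass_eq_iff[OF c cocycle_lin(3)[OF A(2)]] divided_powers[of A, OF A]])
    also have "\<dots> = coh_scale dihedral (2 * (k + m)) (of_nat ((k + m) choose k)) (?A (k + m))"
      by (rule coh_scale_hclass[OF A(2), symmetric])
    finally show ?thesis .
  qed
  moreover have "?A m \<in> cohomology dihedral (2 * m)" for m by (rule hclass_in[OF A(2)])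
  moreover have "?A 0 = coh_one dihedral" by (simp add: A(1) coh_one_hclass)
  moreover have "hclass 3 B \<in> cohomology dihedral 3" by (rule hclass_in[OF cocycle_B])
  ultimately show ?thesis
    by (intro exI[of _ ?A] exI[of _ "hclass 3 B"] conjI allI E_inj words_basis)
qed

end
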